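(* Let $\Theta$ be either $\Theta_{\mathcal T}$ (with data from the tournament model) or $\Theta_{\mathcal G}$ (with data from the graph model). There exists a universal constant $C<\infty$ such that for every integer $n\ge 2$, every $p\in[0,1]$ with $p\ge \frac{2\log n}{n}$, and every $\theta^*\in\Theta$, $$\frac{1}{n^2}\,\mathbb{E}\|\hat\theta-\theta^*\|^2\le C\Big[\frac{(\log n)^2}{np}+\frac{Q(p,\theta^* )}{n^2p^2}\Big].$$
   Context: Notation: $[n]=\{1,\dots,n\}$; $S_n$ is the set of permutations of $[n]$; for an $n\times n$ matrix $\theta$ and $\pi\in S_n$, $(\theta\circ\pi)_{ij}=\theta_{\pi(i),\pi(j)}$; $\|\cdot\|$ is the Frobenius norm; $\log$ is the natural logarithm. Parameter spaces: $\mathcal T$ is the set of $\theta\in[0,1]^{n\times n}$ such that $\theta_{ij}\le\theta_{ik}$ whenever $i\ne k$, $i\ne j$, $k<j$; $\theta_{ji}=1-\theta_{ij}$ for all $i\neq j$; $\theta_{ii}=0$ for all $i$; and $\theta_{ij}\le\frac12$ for all $i<j$. $\mathcal G$ is the set of $\theta\in[0,1]^{n\times n}$ such that $\theta_{ij}\le\theta_{ik}$ whenever $i\ne k$, $i\ne j$, $j<k$; $\theta_{ji}=\theta_{ij}$ for all $i\ne j$; and $\theta_{ii}=0$ for all $i$. Set $\Theta_{\mathcal T}=\{\theta\circ\pi:\theta\in\mathcal T,\pi\in S_n\}$ and $\Theta_{\mathcal G}=\{\theta\circ\pi:\theta\in\mathcal G,\pi\in S_n\}$. Data with true parameter $\theta^*$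 and observation probability $p$: for $i<j$ there are independent outcomes with law $\mathrm{Bern}(\theta^*_{ij})$; each above-diagonal entry is observed with probability $p$, independently over entries and independently of the outcomes. For $i<j$ set $y_{ij}$ equal to the outcome if it is observed and $y_{ij}=\frac12$ if it is missing. The lower triangle is $y_{ji}=1-y_{ij}$ in the tournament model and $y_{ji}=y_{ij}$ in the graph model ($i<j$), and $y_{ii}=0$. Let $\hat p$ be the number of observed above-diagonal entries divided by $\binom n2$. Estimator: let $r_i=\sum_{j=1}^n y_{ij}$ and let $\hat\sigma$ be a permutation with $r_{\hat\sigma(1)}\le\dots\le r_{\hat\sigma(n)}$, ties being broken uniformly at random. Let $J$ be the $n\times n$ matrix with $J_{ij}=1$ for $i\ne j$ and $J_{ii}=0$. Let $\mathrm{Proj}$ be the Euclidean (Frobenius) projection onto the closed convex set $\mathcal T$ in the tournament model, and onto $\mathcal G$ in the graph model. Then $$\hat\theta=\mathrm{Proj}\Big(\big(\tfrac{y-J/2}{\hat p}+\tfrac J2\big)\circ\hat\sigma\Big)\circ\hat\sigma^{-1}\ \text{ if }\hat p\ge\tfrac1n,\qquad \hat\theta=\tfrac J2\ \text{ otherwise}.$$ For a matrix $\theta$ let $R_i(\theta)=\sum_{j\in[n]}\theta_{ij}$ be its row sums, and for $\theta\in\Theta$, $p\in[0,1]$ define $$Q(p,\theta)=\sum_{i\in[n]}\ \max_{j:\,|R_j(p\theta)-R_i(p\theta)|\le 4\sqrt{np\log n}}\ \sum_{k=1}^n(p\theta_{ik}-p\theta_{jk})^2 .$$ *)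

theory Defs
  imports "HOL-Probability.Probability" "HOL-Probability.Product_PMF"
    "HOL-Combinatorics.Permutations"
begin

text \<open>
  Since the size \<open>n\<close> of the matrices is quantified inside the theorem, an \<open>n \<times> n\<close> matrix is a
  function on \<open>{1..n} \<times> {1..n}\<close>, extended by \<open>0\<close> outside this range. The zero extension makes
  two matrices equal as functions as soon as their entries agree.
\<close>

type_synonym matrix = "nat \<Rightarrow> nat \<Rightarrow> real"

definition mats01 :: "nat \<Rightarrow> matrix set" where
  "mats01 n = {\<theta>. (\<forall>i\<in>{1..n}. \<forall>j\<in>{1..n}. 0 \<le> \<theta> i j \<and> \<theta> i j \<le> 1) \<and>
                  (\<forall>i j. i \<notin> {1..n} \<or> j \<notin> {1..n} \<longrightarrow> \<theta> i j = 0)}"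

definition frob_norm :: "nat \<Rightarrow> matrix \<Rightarrow> real" where
  "frob_norm n A = sqrt (\<Sum>i\<in>{1..n}. \<Sum>j\<in>{1..n}. (A i j)\<^sup>2)"

definition relabel :: "matrix \<Rightarrow> (nat \<Rightarrow> nat) \<Rightarrow> matrix" where
  "relabel \<theta> \<pi> = (\<lambda>i j. \<theta> (\<pi> i) (\<pi> j))"

definition row_sum :: "nat \<Rightarrow> matrix \<Rightarrow> nat \<Rightarrow> real" where
  "row_sum n \<theta> i = (\<Sum>j\<in>{1..n}. \<theta> i j)"

definition Jmat :: "nat \<Rightarrow> matrix" where
  "Jmat n = (\<lambda>i j. if i \<in> {1..n} \<and> j \<in> {1..n} \<and> i \<noteq> j then 1 else 0)"

datatype model = Tournament | Graph

definition tournament_mats :: "nat \<Rightarrow> matrix set" where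
  "tournament_mats n = {\<theta> \<in> mats01 n.
     (\<forall>i\<in>{1..n}. \<forall>j\<in>{1..n}. \<forall>k\<in>{1..n}. i \<noteq> k \<and> i \<noteq> j \<and> k < j \<longrightarrow> \<theta> i j \<le> \<theta> i k) \<and>
     (\<forall>i\<in>{1..n}. \<forall>j\<in>{1..n}. i \<noteq> j \<longrightarrow> \<theta> j i = 1 - \<theta> i j) \<and>
     (\<forall>i\<in>{1..n}. \<theta> i i = 0) \<and>
     (\<forall>i\<in>{1..n}. \<forall>j\<in>{1..n}. i < j \<longrightarrow> \<theta> i j \<le> 1 / 2)}"

definition graph_mats :: "nat \<Rightarrow> matrix set" where
  "graph_mats n = {\<theta> \<in> mats01 n.
     (\<forall>i\<in>{1..n}. \<forall>j\<in>{1..n}. \<forall>k\<in>{1..n}. i \<noteq> k \<and> i \<noteq> j \<and> j < k \<longrightarrow> \<theta> i j \<le> \<theta> i k) \<and>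
     (\<forall>i\<in>{1..n}. \<forall>j\<in>{1..n}. i \<noteq> j \<longrightarrow> \<theta> j i = \<theta> i j) \<and>
     (\<forall>i\<in>{1..n}. \<theta> i i = 0)}"

definition ordered_mats :: "model \<Rightarrow> nat \<Rightarrow> matrix set" where
  "ordered_mats m n = (case m of Tournament \<Rightarrow> tournament_mats n | Graph \<Rightarrow> graph_mats n)"

definition param_space :: "model \<Rightarrow> nat \<Rightarrow> matrix set" where
  "param_space m n = {relabel \<theta> \<pi> | \<theta> \<pi>. \<theta> \<in> ordered_mats m n \<and> \<pi> permutes {1..n}}"

text \<open>
  A sample assigns to each pair \<open>(i, j)\<close> with \<open>i < j\<close> the outcome of the Bernoulli trial and the
  indicator that this outcome is observed. The second argument of \<^const>\<open>Pi_pmf\<close> is only the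
  value of a sample outside the index set; it is never used.
\<close>

type_synonym sample = "nat \<times> nat \<Rightarrow> bool \<times> bool"

definition upper_pairs :: "nat \<Rightarrow> (nat \<times> nat) set" where
  "upper_pairs n = {(i, j). i \<in> {1..n} \<and> j \<in> {1..n} \<and> i < j}"

definition sample_pmf :: "nat \<Rightarrow> real \<Rightarrow> matrix \<Rightarrow> sample pmf" where
  "sample_pmf n p \<theta> = Pi_pmf (upper_pairs n) (False, False)
     (\<lambda>(i, j). pair_pmf (bernoulli_pmf (\<theta> i j)) (bernoulli_pmf p))"

definition upper_entry :: "sample \<Rightarrow> nat \<Rightarrow> nat \<Rightarrow> real" where
  "upper_entry \<omega> i j =
     (case \<omega> (i, j) of (outcome, observed) \<Rightarrow> if observed then of_bool outcome else 1 / 2)"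

definition data_matrix :: "model \<Rightarrow> nat \<Rightarrow> sample \<Rightarrow> matrix" where
  "data_matrix m n \<omega> = (\<lambda>i j.
     if i \<notin> {1..n} \<or> j \<notin> {1..n} \<or> i = j then 0
     else if i < j then upper_entry \<omega> i j
     else (case m of Tournament \<Rightarrow> 1 - upper_entry \<omega> j i | Graph \<Rightarrow> upper_entry \<omega> j i))"

definition p_hat :: "nat \<Rightarrow> sample \<Rightarrow> real" where
  "p_hat n \<omega> = real (card {e \<in> upper_pairs n. snd (\<omega> e)}) / real (n choose 2)"

definition sorting_perms :: "nat \<Rightarrow> matrix \<Rightarrow> (nat \<Rightarrow> nat) set" where
  "sorting_perms n y = {\<sigma>. \<sigma> permutes {1..n} \<and> mono_on {1..n} (\<lambda>i. row_sum n y (\<sigma> i))}"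

text \<open>
  The minimizer exists and is unique for the nonempty closed convex sets \<^const>\<open>tournament_mats\<close>
  and \<^const>\<open>graph_mats\<close>, whose elements vanish outside \<open>{1..n} \<times> {1..n}\<close>.
\<close>

definition frob_proj :: "nat \<Rightarrow> matrix set \<Rightarrow> matrix \<Rightarrow> matrix" where
  "frob_proj n S A = (ARG_MIN (\<lambda>B. frob_norm n (\<lambda>i j. A i j - B i j)) B. B \<in> S)"

definition estimate :: "model \<Rightarrow> nat \<Rightarrow> sample \<Rightarrow> (nat \<Rightarrow> nat) \<Rightarrow> matrix" where
  "estimate m n \<omega> \<sigma> =
     (if p_hat n \<omega> \<ge> 1 / real n then
        relabel
          (frob_proj n (ordered_mats m n)
            (relabel
              (\<lambda>i j. (data_matrix m n \<omega> i j - Jmat n i j / 2) / p_hat n \<omega> + Jmat n i j / 2) \<sigma>))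
          (inv \<sigma>)
      else (\<lambda>i j. Jmat n i j / 2))"

text \<open>
  Ties between row sums are broken uniformly at random: given the data, the permutation is
  uniform on the finite nonempty set of all permutations that sort the row sums.
\<close>

definition estimator_pmf :: "model \<Rightarrow> nat \<Rightarrow> real \<Rightarrow> matrix \<Rightarrow> matrix pmf" where
  "estimator_pmf m n p \<theta> =
     bind_pmf (sample_pmf n p \<theta>)
       (\<lambda>\<omega>. map_pmf (estimate m n \<omega>) (pmf_of_set (sorting_perms n (data_matrix m n \<omega>))))"

definition Q :: "nat \<Rightarrow> real \<Rightarrow> matrix \<Rightarrow> real" where
  "Q n p \<theta> =
     (\<Sum>i\<in>{1..n}.
        Max ((\<lambda>j. \<Sum>k\<in>{1..n}. (p * \<theta> i k - p * \<theta> j k)\<^sup>2) `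
          {j \<in> {1..n}. \<bar>row_sum n (\<lambda>a b. p * \<theta> a b) j - row_sum n (\<lambda>a b. p * \<theta> a b) i\<bar>
             \<le> 4 * sqrt (real n * p * ln (real n))}))"

end

theory Submission imports Defs begin

text \<open>
  Write \<open>\<theta> = \<theta>0 \<circ> \<pi>\<close> with \<open>\<theta>0\<close> ordered, and let \<open>X\<close> be the centred data. Up to the fluctuation of
  \<open>p_hat\<close>, the estimator is the projection of \<open>\<theta> \<circ> \<sigma> + (X \<circ> \<sigma>) / p\<close>, so with \<open>D\<close> the difference of this
  projection and \<open>\<theta>0\<close>, the variational inequality gives
  \<open>\<parallel>D\<parallel>\<^sup>2 \<le> \<langle>\<theta> \<circ> \<sigma> - \<theta>0, D\<rangle> + \<langle>X \<circ> \<sigma>, D\<rangle> / p\<close>. Sorting is 1-Lipschitz, so the first term is governed by \<open>Q\<close>.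
  The second one has to be bounded uniformly in \<open>\<sigma>\<close>, because \<open>\<sigma>\<close> depends on the data. No metric entropy
  is needed for this: expand \<open>D\<close> in averages over dyadic blocks. Since the rows and columns of \<open>D\<close> have
  bounded variation, the coefficients of each of the \<open>O(log n)\<close> levels have \<open>\<ell>1\<close> norm \<open>O(n)\<close>, so the blocks
  on which the normalised sum of \<open>X \<circ> \<sigma>\<close> is \<open>O(log n)\<close> contribute \<open>O(n log\<^sup>2 n)\<close>. On the remaining blocks
  use Cauchy-Schwarz; the squares of their normalised sums add up to \<open>O(p n log n)\<close> on each level, for all
  \<open>n!\<close> permutations simultaneously, by a union bound over \<open>\<sigma>\<close> and over the (few) large values.
\<close>

section \<open>Averages over the classes of a partition\<close>

text \<open>The union over permutations costs n log n in the exponent, and bounding the sum of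
  squares of all block sums at that cost would require Gaussian tails. For small p only Bernstein
  tails are available: the tilt exp (v x / (24 p)) of a normalised sum x over a block of side 2^k is
  controlled only while |v| is at most 12 p 2^k. Hence the truncation at 12 log n + 1: smaller sums
  are never squared, and larger ones are forced into the admissible range by the bound on
  submatrices. The threshold also makes the entropy of the values harmless. A nonzero value has
  weight at most n^(-5), which beats the 49 n possible values and the 4 n^2 blocks. The radius 4
  sqrt(n p log n) in \<open>Q\<close> dictates the row bound 2 sqrt(n p log n), because sorting
  doubles the deviation. The assumption p >= 2 log n / n is what keeps the tilt used for that row
  bound at most 1.\<close>

definition class_avg :: "'a set \<Rightarrow> ('a \<Rightarrow> 'b) \<Rightarrow> ('a \<Rightarrow> real) \<Rightarrow> 'a \<Rightarrow> real" where
  "class_avg W \<kappa> f e = (\<Sum>e'\<in>{e'\<in>W. \<kappa> e' = \<kappa> e}. f e') / real (card {e'\<in>W. \<kappa> e' = \<kappa> e})"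

lemma class_avg_cong: "\<kappa> e = \<kappa> e' \<Longrightarrow> class_avg W \<kappa> f e = class_avg W \<kappa> f e'"
  by (simp add: class_avg_def)

lemma class_avg_id:
  assumes "finite W" "e \<in> W" "\<And>e'. e' \<in> W \<Longrightarrow> \<kappa> e' = \<kappa> e \<Longrightarrow> f e' = f e"
  shows "class_avg W \<kappa> f e = f e"
proof -
  have "(\<Sum>e'\<in>{e'\<in>W. \<kappa> e' = \<kappa> e}. f e') = (\<Sum>e'\<in>{e'\<in>W. \<kappa> e' = \<kappa> e}. f e)"
    using assms(3) by (intro sum.cong) auto
  moreover have "card {e'\<in>W. \<kappa> e' = \<kappa> e} \<noteq> 0" using assms by auto
  ultimately show ?thesis by (simp add: class_avg_def)
qed

text \<open>Averaging is a self-adjoint operator: the weight 1 / card is constant on each class, so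
  its kernel is symmetric.\<close>

lemma class_avg_adjoint:
  assumes "finite W"
  shows "(\<Sum>e\<in>W. class_avg W \<kappa> f e * g e) = (\<Sum>e\<in>W. f e * class_avg W \<kappa> g e)"
proof -
  let ?c = "\<lambda>e. real (card {e'\<in>W. \<kappa> e' = \<kappa> e})"
  have "(\<Sum>e\<in>W. class_avg W \<kappa> f e * g e)
      = (\<Sum>e\<in>W. \<Sum>e'\<in>W. if \<kappa> e' = \<kappa> e then f e' * g e / ?c e else 0)"
    using assms by (intro sum.cong refl)
      (simp add: class_avg_def sum_distrib_right sum_divide_distrib flip: sum.inter_filter)
  also have "\<dots> = (\<Sum>e'\<in>W. \<Sum>e\<in>W. if \<kappa> e' = \<kappa> e then f e' * g e / ?c e else 0)"
    by (rule sum.swap)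
  also have "\<dots> = (\<Sum>e'\<in>W. \<Sum>e\<in>W. if \<kappa> e = \<kappa> e' then f e' * g e / ?c e' else 0)"
    by (intro sum.cong refl) auto
  also have "\<dots> = (\<Sum>e\<in>W. f e * class_avg W \<kappa> g e)"
    using assms by (intro sum.cong refl)
      (simp add: class_avg_def sum_distrib_left sum_divide_distrib flip: sum.inter_filter)
  finally show ?thesis .
qed

text \<open>Tower property. Averages over the coarser partition are constant on the finer classes
  and hence fixed by the finer averaging; moving that operator across the inner product leaves the
  squared norm of the coarser average.\<close>

lemma sum_class_avg_mult_coarser:
  assumes "finite W" and coarser: "\<And>e e'. e \<in> W \<Longrightarrow> e' \<in> W \<Longrightarrow> \<kappa> e = \<kappa> e' \<Longrightarrow> \<kappa>' e = \<kappa>' e'"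
  shows "(\<Sum>e\<in>W. class_avg W \<kappa> f e * class_avg W \<kappa>' f e) = (\<Sum>e\<in>W. (class_avg W \<kappa>' f e)\<^sup>2)"
proof -
  have id: "class_avg W \<kappa> (class_avg W \<kappa>' f) e = class_avg W \<kappa>' f e" if "e \<in> W" for e
    by (rule class_avg_id[OF assms(1) that]) (blast intro: class_avg_cong coarser that)
  have id': "class_avg W \<kappa>' (class_avg W \<kappa>' f) e = class_avg W \<kappa>' f e" if "e \<in> W" for e
    by (rule class_avg_id[OF assms(1) that]) (rule class_avg_cong)
  have "(\<Sum>e\<in>W. class_avg W \<kappa> f e * class_avg W \<kappa>' f e)
      = (\<Sum>e\<in>W. f e * class_avg W \<kappa> (class_avg W \<kappa>' f) e)"
    by (rule class_avg_adjoint[OF assms(1)])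
  also have "\<dots> = (\<Sum>e\<in>W. f e * class_avg W \<kappa>' (class_avg W \<kappa>' f) e)"
    by (rule sum.cong) (simp_all add: id id')
  also have "\<dots> = (\<Sum>e\<in>W. class_avg W \<kappa>' f e * class_avg W \<kappa>' f e)"
    by (rule class_avg_adjoint[OF assms(1), symmetric])
  finally show ?thesis by (simp add: power2_eq_square)
qed

lemma class_avg_pythagoras:
  assumes "finite W" "\<And>e e'. e \<in> W \<Longrightarrow> e' \<in> W \<Longrightarrow> \<kappa> e = \<kappa> e' \<Longrightarrow> \<kappa>' e = \<kappa>' e'"
  shows "(\<Sum>e\<in>W. (class_avg W \<kappa> f e - class_avg W \<kappa>' f e)\<^sup>2)
       = (\<Sum>e\<in>W. (class_avg W \<kappa> f e)\<^sup>2) - (\<Sum>e\<in>W. (class_avg W \<kappa>' f e)\<^sup>2)"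
proof -
  have "(\<Sum>e\<in>W. (class_avg W \<kappa> f e - class_avg W \<kappa>' f e)\<^sup>2)
     = (\<Sum>e\<in>W. (class_avg W \<kappa> f e)\<^sup>2) + (\<Sum>e\<in>W. (class_avg W \<kappa>' f e)\<^sup>2)
       - 2 * (\<Sum>e\<in>W. class_avg W \<kappa> f e * class_avg W \<kappa>' f e)"
    by (simp add: power2_diff sum.distrib sum_subtractf sum_distrib_left mult.assoc)
  then show ?thesis using sum_class_avg_mult_coarser[of W \<kappa> \<kappa>' f, OF assms] by linarith
qed

text \<open>Averaging contracts the l1 norm: by self-adjointness the total of the averages of |f|
  pairs |f| with the average of the constant 1, which is 1.\<close>

lemma sum_abs_class_avg_le:
  assumes "finite W"
  shows "(\<Sum>e\<in>W. \<bar>class_avg W \<kappa> f e\<bar>) \<le> (\<Sum>e\<in>W. \<bar>f e\<bar>)"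
proof -
  have "(\<Sum>e\<in>W. \<bar>class_avg W \<kappa> f e\<bar>) \<le> (\<Sum>e\<in>W. class_avg W \<kappa> (\<lambda>e. \<bar>f e\<bar>) e * 1)"
    by (intro sum_mono) (auto simp: class_avg_def abs_divide intro!: divide_right_mono sum_abs)
  also have "\<dots> = (\<Sum>e\<in>W. \<bar>f e\<bar> * class_avg W \<kappa> (\<lambda>_. 1) e)"
    by (rule class_avg_adjoint[OF assms])
  also have "\<dots> = (\<Sum>e\<in>W. \<bar>f e\<bar>)"
    using assms by (intro sum.cong refl) (simp add: class_avg_id)
  finally show ?thesis .
qed

text \<open>Duality on one scale. The block indicators divided by s are orthonormal;
  \<open>x\<close> and the \<open>c\<close> of the proof are the coefficients of \<open>Z\<close>
  and of the blockwise constant \<open>E\<close> in this system. Coefficients \<open>x b\<close> up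
  to \<open>h\<close> are paired with the l1 norm of \<open>c\<close>, the remaining ones with its
  l2 norm by Cauchy-Schwarz.\<close>

lemma abs_sum_mult_blockwise_le:
  fixes W :: "'a set" and Z E :: "'a \<Rightarrow> real" and s h K :: real and \<kappa> :: "'a \<Rightarrow> 'b"
  defines "x \<equiv> \<lambda>b. (\<Sum>e\<in>{e\<in>W. \<kappa> e = b}. Z e) / s"
  assumes W: "finite W" and s: "s > 0" and h: "h \<ge> 0"
    and card: "\<And>b. b \<in> \<kappa> ` W \<Longrightarrow> real (card {e\<in>W. \<kappa> e = b}) = s\<^sup>2"
    and E: "\<And>e e'. e \<in> W \<Longrightarrow> e' \<in> W \<Longrightarrow> \<kappa> e = \<kappa> e' \<Longrightarrow> E e = E e'"
    and K: "(\<Sum>b\<in>{b\<in>\<kappa> ` W. \<bar>x b\<bar> > h}. (x b)\<^sup>2) \<le> K"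
  shows "\<bar>\<Sum>e\<in>W. Z e * E e\<bar> \<le> h * (\<Sum>e\<in>W. \<bar>E e\<bar>) / s + sqrt K * sqrt (\<Sum>e\<in>W. (E e)\<^sup>2)"
proof -
  let ?B = "\<kappa> ` W" and ?L = "{b\<in>\<kappa> ` W. \<bar>x b\<bar> > h}"
  define c where "c b = s * E (inv_into W \<kappa> b)" for b
  have Ec: "E e = c (\<kappa> e) / s" if "e \<in> W" for e
    using E[OF that, of "inv_into W \<kappa> (\<kappa> e)"] that s
    by (simp add: c_def inv_into_into f_inv_into_f)
  have group: "(\<Sum>e\<in>W. g e) = (\<Sum>b\<in>?B. \<Sum>e\<in>{e\<in>W. \<kappa> e = b}. g e)" for g :: "'a \<Rightarrow> real"
    using W by (rule sum.image_gen)
  have 1: "(\<Sum>e\<in>W. Z e * E e) = (\<Sum>b\<in>?B. x b * c b)"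
    unfolding group x_def
    by (intro sum.cong refl) (use s in \<open>auto simp: Ec sum_divide_distrib sum_distrib_right intro!: sum.cong\<close>)
  have const: "(\<Sum>e\<in>{e\<in>W. \<kappa> e = b}. g (E e)) = s\<^sup>2 * g (c b / s)" if "b \<in> ?B" for b and g :: "real \<Rightarrow> real"
  proof -
    have "(\<Sum>e\<in>{e\<in>W. \<kappa> e = b}. g (E e)) = (\<Sum>e\<in>{e\<in>W. \<kappa> e = b}. g (c b / s))"
      by (intro sum.cong refl) (auto simp: Ec)
    then show ?thesis using card[OF that] by simp
  qed
  have 2: "(\<Sum>e\<in>W. \<bar>E e\<bar>) = s * (\<Sum>b\<in>?B. \<bar>c b\<bar>)"
    unfolding group sum_distrib_left
    by (intro sum.cong refl) (use s in \<open>simp add: const[of _ abs] power2_eq_square\<close>)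
  have 3: "(\<Sum>e\<in>W. (E e)\<^sup>2) = (\<Sum>b\<in>?B. (c b)\<^sup>2)"
    unfolding group
    by (intro sum.cong refl) (use s in \<open>simp add: const[of _ "\<lambda>u. u\<^sup>2"] power_divide\<close>)
  have "(\<Sum>b\<in>?L. \<bar>x b\<bar> * \<bar>c b\<bar>) \<le> L2_set x ?L * L2_set c ?L"
    by (rule L2_set_mult_ineq)
  also have "\<dots> \<le> sqrt K * sqrt (\<Sum>b\<in>?B. (c b)\<^sup>2)"
  proof (rule mult_mono)
    show "L2_set x ?L \<le> sqrt K" unfolding L2_set_def using K by simp
    show "L2_set c ?L \<le> sqrt (\<Sum>b\<in>?B. (c b)\<^sup>2)"
      unfolding L2_set_def using W by (intro real_sqrt_le_mono sum_mono2) auto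
    have "0 \<le> K" by (rule order.trans[OF _ K]) (rule sum_nonneg, simp)
    then show "0 \<le> sqrt K" by simp
  qed (rule L2_set_nonneg)
  finally have large: "(\<Sum>b\<in>?L. \<bar>x b\<bar> * \<bar>c b\<bar>) \<le> sqrt K * sqrt (\<Sum>b\<in>?B. (c b)\<^sup>2)" .
  have "\<bar>\<Sum>b\<in>?B. x b * c b\<bar> \<le> (\<Sum>b\<in>?B. \<bar>x b\<bar> * \<bar>c b\<bar>)"
    by (rule order.trans[OF sum_abs]) (simp add: abs_mult)
  also have "\<dots> \<le> (\<Sum>b\<in>?B. h * \<bar>c b\<bar> + (if \<bar>x b\<bar> > h then \<bar>x b\<bar> * \<bar>c b\<bar> else 0))"
    using h by (intro sum_mono) (auto intro!: mult_right_mono)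
  also have "\<dots> = h * (\<Sum>b\<in>?B. \<bar>c b\<bar>) + (\<Sum>b\<in>?L. \<bar>x b\<bar> * \<bar>c b\<bar>)"
    using W by (simp add: sum.distrib sum_distrib_left flip: sum.inter_filter)
  finally have "\<bar>\<Sum>e\<in>W. Z e * E e\<bar> \<le> h * (\<Sum>b\<in>?B. \<bar>c b\<bar>) + sqrt K * sqrt (\<Sum>b\<in>?B. (c b)\<^sup>2)"
    using large by (simp only: 1)
  then show ?thesis using s by (simp only: 2 3) simp
qed

section \<open>The multiscale decomposition of a matrix\<close>

definition dyadic_block :: "nat \<Rightarrow> nat \<times> nat \<Rightarrow> nat \<times> nat" where
  "dyadic_block k = (\<lambda>(i, j). (i div 2 ^ k, j div 2 ^ k))"

definition total_variation :: "nat \<Rightarrow> (nat \<Rightarrow> real) \<Rightarrow> real" where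
  "total_variation N f = (\<Sum>l<N. \<bar>f (Suc l) - f l\<bar>)"

lemma abs_diff_le_variation:
  fixes f :: "nat \<Rightarrow> real"
  assumes "a \<le> i" "i \<le> b" "a \<le> j" "j \<le> b"
  shows "\<bar>f i - f j\<bar> \<le> (\<Sum>l\<in>{a..<b}. \<bar>f (Suc l) - f l\<bar>)"
proof -
  have "\<bar>f j - f i\<bar> \<le> (\<Sum>l\<in>{a..<b}. \<bar>f (Suc l) - f l\<bar>)"
    if "i \<le> j" "a \<le> i" "j \<le> b" for i j
  proof -
    have "\<bar>f j - f i\<bar> = \<bar>\<Sum>l\<in>{i..<j}. f (Suc l) - f l\<bar>"
      using that by (simp add: sum_Suc_diff')
    also have "\<dots> \<le> (\<Sum>l\<in>{i..<j}. \<bar>f (Suc l) - f l\<bar>)" by (rule sum_abs)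
    also have "\<dots> \<le> (\<Sum>l\<in>{a..<b}. \<bar>f (Suc l) - f l\<bar>)"
      using that by (intro sum_mono2) auto
    finally show ?thesis .
  qed
  from this[of i j] this[of j i] assms show ?thesis
    by (cases "i \<le> j") (auto simp: abs_minus_commute)
qed

text \<open>The range stops one short of the block length, so that the increment leaving block
  \<open>b\<close> does not count.\<close>

definition block_variation :: "nat \<Rightarrow> (nat \<Rightarrow> real) \<Rightarrow> nat \<Rightarrow> real" where
  "block_variation s f b = (\<Sum>l\<in>{b * s..<b * s + (s - 1)}. \<bar>f (Suc l) - f l\<bar>)"

lemma abs_diff_le_block_variation:
  assumes "s > 0" "i div s = b" "j div s = b"
  shows "\<bar>f i - f j\<bar> \<le> block_variation s f b"
proof -
  have "b * s \<le> x \<and> x \<le> b * s + (s - 1)" if "x div s = b" for x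
  proof -
    have "b * s + x mod s = x" using that div_mult_mod_eq[of x s] by simp
    moreover have "x mod s < s" using assms by simp
    ultimately show ?thesis by linarith
  qed
  then show ?thesis unfolding block_variation_def
    using assms by (intro abs_diff_le_variation) auto
qed

text \<open>Each of the s positions of a block carries the variation of that block once, and
  distinct blocks use disjoint sets of increments.\<close>

lemma sum_block_variation_le:
  assumes "s > 0"
  shows "(\<Sum>j<m * s. block_variation s f (j div s)) \<le> real s * total_variation (m * s) f"
proof -
  have "(\<Sum>j<m * s. block_variation s f (j div s))
      = (\<Sum>b<m. \<Sum>j\<in>{b * s..<b * s + s}. block_variation s f (j div s))"
    by (rule sum.nat_group[symmetric])
  also have "\<dots> = (\<Sum>b<m. real s * block_variation s f b)"
  proof (rule sum.cong[OF refl])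
    fix b
    have "(\<Sum>j\<in>{b * s..<b * s + s}. block_variation s f (j div s))
        = (\<Sum>j\<in>{b * s..<b * s + s}. block_variation s f b)"
    proof (rule sum.cong[OF refl])
      fix j assume "j \<in> {b * s..<b * s + s}"
      then have "j div s = b" by (intro div_nat_eqI) (auto simp: mult.commute)
      then show "block_variation s f (j div s) = block_variation s f b" by simp
    qed
    then show "(\<Sum>j\<in>{b * s..<b * s + s}. block_variation s f (j div s)) = real s * block_variation s f b"
      by simp
  qed
  also have "\<dots> = real s * (\<Sum>b<m. block_variation s f b)"
    by (simp add: sum_distrib_left)
  also have "\<dots> \<le> real s * (\<Sum>b<m. \<Sum>l\<in>{b * s..<b * s + s}. \<bar>f (Suc l) - f l\<bar>)"
    unfolding block_variation_def by (intro mult_left_mono sum_mono sum_mono2) auto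
  also have "\<dots> = real s * total_variation (m * s) f"
    unfolding total_variation_def by (simp only: sum.nat_group)
  finally show ?thesis .
qed

lemma card_dyadic_block:
  assumes "k \<le> L" "b \<in> dyadic_block k ` ({..<2 ^ L} \<times> {..<2 ^ L})"
  shows "card {e \<in> {..<2 ^ L} \<times> {..<2 ^ L}. dyadic_block k e = b} = (2 ^ k)\<^sup>2"
proof -
  define s :: nat where "s = 2 ^ k"
  define m :: nat where "m = 2 ^ (L - k)"
  have s: "s > 0" and N: "2 ^ L = m * s"
    using assms by (simp_all add: s_def m_def flip: power_add)
  have 1: "{i. i < m * s \<and> i div s = a} = {a * s..<a * s + s}" if "a < m" for a
  proof -
    have le: "a * s + s \<le> m * s" using that by (metis Suc_leI add.commute mult_Suc mult_le_mono1)
    have "i div s = a \<longleftrightarrow> a * s \<le> i \<and> i < a * s + s" for i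
      using div_nat_eqI[of s a i] dividend_less_div_times[OF s, of i] div_times_less_eq_dividend[of i s]
      by (auto simp: algebra_simps)
    then show ?thesis
      using le by (intro set_eqI) (simp only: mem_Collect_eq atLeastLessThan_iff, linarith)
  qed
  obtain a c where b: "b = (a, c)" by fastforce
  have "a < m" "c < m"
    using assms(2) s by (auto simp: b dyadic_block_def N simp flip: s_def intro: less_mult_imp_div_less)
  moreover have "{e \<in> {..<2 ^ L} \<times> {..<2 ^ L}. dyadic_block k e = b}
      = {i. i < m * s \<and> i div s = a} \<times> {j. j < m * s \<and> j div s = c}"
    by (auto simp: b dyadic_block_def N simp flip: s_def)
  ultimately show ?thesis
    by (simp only: 1 card_cartesian_product) (simp add: power2_eq_square s_def)
qed

text \<open>Two entries of a block are joined by a path along the row of the first and then along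
  the column of the second. The oscillation is thus a function of the first entry plus a function of
  the second, and averaging over the second needs only the l1 contraction. The growth like 2^k
  cancels against the normalisation of the block coefficients at level k.\<close>

lemma sum_abs_diff_class_avg_le:
  fixes D :: "nat \<times> nat \<Rightarrow> real" and V :: real
  assumes "k \<le> L"
    and row: "\<And>i. i < 2 ^ L \<Longrightarrow> total_variation (2 ^ L) (\<lambda>j. D (i, j)) \<le> V"
    and col: "\<And>j. j < 2 ^ L \<Longrightarrow> total_variation (2 ^ L) (\<lambda>i. D (i, j)) \<le> V"
  defines "W \<equiv> {..<2 ^ L} \<times> {..<2 ^ L}"
  shows "(\<Sum>e\<in>W. \<bar>D e - class_avg W (dyadic_block k) D e\<bar>) \<le> 2 * 2 ^ L * 2 ^ k * V"
proof -
  define s :: nat where "s = 2 ^ k"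
  define m :: nat where "m = 2 ^ (L - k)"
  have s: "s > 0" and N: "2 ^ L = m * s"
    using assms by (simp_all add: s_def m_def flip: power_add)
  have W: "finite W" by (simp add: W_def)
  define U where "U = (\<lambda>(i, j). block_variation s (\<lambda>j. D (i, j)) (j div s))"
  define U' where "U' = (\<lambda>(i, j). block_variation s (\<lambda>i. D (i, j)) (i div s))"
  have nonneg: "U e \<ge> 0" "U' e \<ge> 0" for e
    by (auto simp: U_def U'_def block_variation_def sum_nonneg split: prod.split)
  have pair: "\<bar>D e - D e'\<bar> \<le> U e + U' e'" if "dyadic_block k e' = dyadic_block k e" for e e'
  proof -
    obtain i j i' j' where e: "e = (i, j)" "e' = (i', j')" by fastforce
    have eq: "i' div s = i div s" "j' div s = j div s"
      using that by (simp_all add: e dyadic_block_def s_def)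
    have "\<bar>D (i, j) - D (i, j')\<bar> \<le> U e"
      unfolding U_def e prod.case using eq by (intro abs_diff_le_block_variation s) auto
    moreover have "\<bar>D (i, j') - D (i', j')\<bar> \<le> U' e'"
      unfolding U'_def e prod.case using eq
      by (intro abs_diff_le_block_variation[where f="\<lambda>i. D (i, j')"] s) auto
    ultimately show ?thesis unfolding e by linarith
  qed
  have "\<bar>D e - class_avg W (dyadic_block k) D e\<bar> \<le> U e + class_avg W (dyadic_block k) U' e"
    if "e \<in> W" for e
  proof -
    let ?C = "{e' \<in> W. dyadic_block k e' = dyadic_block k e}"
    have "e \<in> ?C" using that by simp
    moreover have "finite ?C" using W by simp
    ultimately have c: "real (card ?C) > 0" by (metis card_gt_0_iff emptyE of_nat_0_less_iff)
    have "D e - class_avg W (dyadic_block k) D e = (\<Sum>e'\<in>?C. D e - D e') / card ?C"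
      using c by (simp add: class_avg_def sum_subtractf diff_divide_distrib)
    also have "\<bar>\<dots>\<bar> \<le> (\<Sum>e'\<in>?C. \<bar>D e - D e'\<bar>) / card ?C"
      by (simp add: abs_divide divide_right_mono sum_abs)
    also have "\<dots> \<le> (\<Sum>e'\<in>?C. U e + U' e') / card ?C"
      using pair by (intro divide_right_mono sum_mono) auto
    also have "\<dots> = U e + class_avg W (dyadic_block k) U' e"
      using c by (simp add: class_avg_def sum.distrib add_divide_distrib)
    finally show ?thesis .
  qed
  then have "(\<Sum>e\<in>W. \<bar>D e - class_avg W (dyadic_block k) D e\<bar>)
      \<le> (\<Sum>e\<in>W. U e + class_avg W (dyadic_block k) U' e)"
    by (rule sum_mono)
  also have "\<dots> \<le> (\<Sum>e\<in>W. U e) + (\<Sum>e\<in>W. U' e)"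
  proof -
    have "(\<Sum>e\<in>W. class_avg W (dyadic_block k) U' e) \<le> (\<Sum>e\<in>W. \<bar>class_avg W (dyadic_block k) U' e\<bar>)"
      by (intro sum_mono) simp
    also have "\<dots> \<le> (\<Sum>e\<in>W. \<bar>U' e\<bar>)" by (rule sum_abs_class_avg_le[OF W])
    finally show ?thesis using nonneg by (simp add: sum.distrib)
  qed
  also have "\<dots> \<le> (\<Sum>i<2 ^ L :: nat. real s * V) + (\<Sum>j<2 ^ L :: nat. real s * V)"
  proof (rule add_mono)
    have "(\<Sum>e\<in>W. U e) = (\<Sum>i<2 ^ L. \<Sum>j<2 ^ L. U (i, j))"
      unfolding W_def by (rule sum.cartesian_product')
    also have "\<dots> \<le> (\<Sum>i<2 ^ L :: nat. real s * V)"
    proof (rule sum_mono)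
      fix i :: nat assume "i \<in> {..<2 ^ L}"
      then have "real s * total_variation (2 ^ L) (\<lambda>j. D (i, j)) \<le> real s * V"
        using row by (intro mult_left_mono) auto
      then show "(\<Sum>j<2 ^ L. U (i, j)) \<le> real s * V"
        using sum_block_variation_le[OF s, of "\<lambda>j. D (i, j)" m] by (simp add: U_def N)
    qed
    finally show "(\<Sum>e\<in>W. U e) \<le> (\<Sum>i<2 ^ L :: nat. real s * V)" .
    have "(\<Sum>e\<in>W. U' e) = (\<Sum>i<2 ^ L. \<Sum>j<2 ^ L. U' (i, j))"
      unfolding W_def by (rule sum.cartesian_product')
    also have "\<dots> = (\<Sum>j<2 ^ L. \<Sum>i<2 ^ L. U' (i, j))" by (rule sum.swap)
    also have "\<dots> \<le> (\<Sum>j<2 ^ L :: nat. real s * V)"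
    proof (rule sum_mono)
      fix j :: nat assume "j \<in> {..<2 ^ L}"
      then have "real s * total_variation (2 ^ L) (\<lambda>i. D (i, j)) \<le> real s * V"
        using col by (intro mult_left_mono) auto
      then show "(\<Sum>i<2 ^ L. U' (i, j)) \<le> real s * V"
        using sum_block_variation_le[OF s, of "\<lambda>i. D (i, j)" m] by (simp add: U'_def N)
    qed
    finally show "(\<Sum>e\<in>W. U' e) \<le> (\<Sum>j<2 ^ L :: nat. real s * V)" .
  qed
  finally show ?thesis by (simp add: s_def mult.commute mult.left_commute)
qed

text \<open>\<open>D\<close> is the telescoping sum of differences of its block averages on
  consecutive scales. By Pythagoras their squared norms add up to that of \<open>D\<close>, so
  Cauchy-Schwarz over the L + 1 scales costs only sqrt(L + 1); the l1 parts are added scale by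
  scale.\<close>

theorem multiscale_bound:
  fixes D Z :: "nat \<times> nat \<Rightarrow> real" and V h K :: real
  defines "W \<equiv> \<lambda>L::nat. {..<2 ^ L} \<times> {..<2 ^ L :: nat}"
  assumes row: "\<And>i. i < 2 ^ L \<Longrightarrow> total_variation (2 ^ L) (\<lambda>j. D (i, j)) \<le> V"
    and col: "\<And>j. j < 2 ^ L \<Longrightarrow> total_variation (2 ^ L) (\<lambda>i. D (i, j)) \<le> V"
    and D: "\<And>e. \<bar>D e\<bar> \<le> 1" and h: "h \<ge> 0"
    and K: "\<And>k. k \<le> L \<Longrightarrow>
      (\<Sum>b\<in>{b\<in>dyadic_block k ` W L. \<bar>(\<Sum>e\<in>{e\<in>W L. dyadic_block k e = b}. Z e) / 2 ^ k\<bar> > h}.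
        ((\<Sum>e\<in>{e\<in>W L. dyadic_block k e = b}. Z e) / 2 ^ k)\<^sup>2) \<le> K"
  shows "\<bar>\<Sum>e\<in>W L. Z e * D e\<bar>
    \<le> h * 2 ^ L * (6 * V * real L + 1) + sqrt (K * real (L + 1)) * sqrt (\<Sum>e\<in>W L. (D e)\<^sup>2)"
proof -
  let ?W = "W L" and ?N = "2 ^ L :: real"
  define P where "P k = class_avg ?W (dyadic_block k) D" for k
  \<comment> \<open>The top level keeps the overall mean \<open>P L\<close> instead of a difference,
    so that the sum over all levels returns to \<open>P 0\<close>, which is
    \<open>D\<close>.\<close>
  define E where "E k e = (if k < L then P k e - P (Suc k) e else P k e)" for k e
  have W: "finite ?W" by (simp add: W_def)
  have coarser: "dyadic_block (Suc k) e = dyadic_block (Suc k) e'"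
    if "dyadic_block k e = dyadic_block k e'" for k e e'
    using that by (simp add: dyadic_block_def power_Suc2 div_mult2_eq case_prod_unfold del: power_Suc)
  have P0: "P 0 e = D e" if "e \<in> ?W" for e
    unfolding P_def using that W by (intro class_avg_id) (auto simp: dyadic_block_def)
  have tel: "D e = (\<Sum>k\<le>L. E k e)" if "e \<in> ?W" for e
  proof -
    have "(\<Sum>k\<le>L. E k e) = (\<Sum>k<L. E k e) + E L e"
      by (simp add: lessThan_Suc_atMost[symmetric])
    also have "(\<Sum>k<L. E k e) = (\<Sum>k<L. P k e - P (Suc k) e)"
      by (intro sum.cong) (auto simp: E_def)
    also have "\<dots> = P 0 e - P L e" by (rule sum_lessThan_telescope')
    finally show ?thesis using P0[OF that] by (simp add: E_def)
  qed
  have Esq: "(\<Sum>k\<le>L. \<Sum>e\<in>?W. (E k e)\<^sup>2) = (\<Sum>e\<in>?W. (D e)\<^sup>2)"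
  proof -
    define q where "q k = (\<Sum>e\<in>?W. (P k e)\<^sup>2)" for k
    have "(\<Sum>k\<le>L. \<Sum>e\<in>?W. (E k e)\<^sup>2) = (\<Sum>k<L. \<Sum>e\<in>?W. (E k e)\<^sup>2) + q L"
      by (simp add: lessThan_Suc_atMost[symmetric] E_def q_def)
    also have "(\<Sum>k<L. \<Sum>e\<in>?W. (E k e)\<^sup>2) = (\<Sum>k<L. q k - q (Suc k))"
    proof (rule sum.cong[OF refl])
      fix k assume "k \<in> {..<L}"
      then show "(\<Sum>e\<in>?W. (E k e)\<^sup>2) = q k - q (Suc k)"
        unfolding q_def P_def
        by (subst class_avg_pythagoras[OF W, symmetric]) (auto simp: E_def P_def intro: coarser)
    qed
    also have "\<dots> = q 0 - q L" by (rule sum_lessThan_telescope')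
    finally show ?thesis using P0 by (simp add: q_def)
  qed
  have V: "V \<ge> 0"
    using order.trans[OF _ row[of 0], of 0] by (simp add: total_variation_def sum_nonneg)
  have E1: "(\<Sum>e\<in>?W. \<bar>E k e\<bar>) / 2 ^ k \<le> (if k < L then 6 * ?N * V else ?N)" if "k \<le> L" for k
  proof (cases "k < L")
    case True
    have "(\<Sum>e\<in>?W. \<bar>E k e\<bar>) \<le> (\<Sum>e\<in>?W. \<bar>D e - P k e\<bar> + \<bar>D e - P (Suc k) e\<bar>)"
      using True by (intro sum_mono) (simp add: E_def)
    \<comment> \<open>Both averages are compared with \<open>D\<close> itself. The block side
      doubles from one to the other, so division by 2^k leaves 2 + 4 = 6.\<close>
    also have "\<dots> \<le> 2 * ?N * 2 ^ k * V + 2 * ?N * 2 ^ (Suc k) * V"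
      unfolding sum.distrib P_def W_def using True row col
      by (intro add_mono sum_abs_diff_class_avg_le) auto
    finally show ?thesis using True by (simp add: field_simps)
  next
    case False
    then have k: "k = L" using that by simp
    have "(\<Sum>e\<in>?W. \<bar>E k e\<bar>) \<le> (\<Sum>e\<in>?W. \<bar>D e\<bar>)"
      using False sum_abs_class_avg_le[OF W] by (simp add: E_def P_def)
    also have "\<dots> \<le> (\<Sum>e\<in>?W. 1)" using D by (intro sum_mono) auto
    finally show ?thesis using False by (simp add: k W_def field_simps)
  qed
  have level: "\<bar>\<Sum>e\<in>?W. Z e * E k e\<bar>
      \<le> h * (if k < L then 6 * ?N * V else ?N) + sqrt K * sqrt (\<Sum>e\<in>?W. (E k e)\<^sup>2)" if "k \<le> L" for k
  proof -
    have const: "E k e = E k e'" if "dyadic_block k e = dyadic_block k e'" for e e'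
      using that coarser[OF that] unfolding E_def P_def
      by (metis class_avg_cong that)
    have "\<bar>\<Sum>e\<in>?W. Z e * E k e\<bar>
      \<le> h * (\<Sum>e\<in>?W. \<bar>E k e\<bar>) / 2 ^ k + sqrt K * sqrt (\<Sum>e\<in>?W. (E k e)\<^sup>2)"
    proof (rule abs_sum_mult_blockwise_le[where \<kappa>="dyadic_block k"])
      show "real (card {e \<in> ?W. dyadic_block k e = b}) = (2 ^ k)\<^sup>2" if "b \<in> dyadic_block k ` ?W" for b
        using card_dyadic_block[OF \<open>k \<le> L\<close>, of b] that by (simp add: W_def)
      show "(\<Sum>b\<in>{b\<in>dyadic_block k ` ?W. h < \<bar>(\<Sum>e\<in>{e\<in>?W. dyadic_block k e = b}. Z e) / 2 ^ k\<bar>}.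
          ((\<Sum>e\<in>{e\<in>?W. dyadic_block k e = b}. Z e) / 2 ^ k)\<^sup>2) \<le> K"
        by (rule K[OF \<open>k \<le> L\<close>])
    qed (rule W h | erule const | simp)+
    moreover have "h * (\<Sum>e\<in>?W. \<bar>E k e\<bar>) / 2 ^ k \<le> h * (if k < L then 6 * ?N * V else ?N)"
      using mult_left_mono[OF E1[OF that] h] by simp
    ultimately show ?thesis by linarith
  qed
  have "(\<Sum>e\<in>?W. Z e * D e) = (\<Sum>e\<in>?W. \<Sum>k\<le>L. Z e * E k e)"
    by (intro sum.cong refl) (simp add: tel sum_distrib_left)
  also have "\<dots> = (\<Sum>k\<le>L. \<Sum>e\<in>?W. Z e * E k e)" by (rule sum.swap)
  also have "\<bar>\<dots>\<bar> \<le> (\<Sum>k\<le>L. \<bar>\<Sum>e\<in>?W. Z e * E k e\<bar>)" by (rule sum_abs)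
  also have "\<dots> \<le> (\<Sum>k\<le>L. h * (if k < L then 6 * ?N * V else ?N) + sqrt K * sqrt (\<Sum>e\<in>?W. (E k e)\<^sup>2))"
    using level by (intro sum_mono) auto
  also have "\<dots> = h * ?N * (6 * V * real L + 1) + sqrt K * (\<Sum>k\<le>L. sqrt (\<Sum>e\<in>?W. (E k e)\<^sup>2))"
    by (simp add: sum.distrib sum_distrib_left[symmetric] lessThan_Suc_atMost[symmetric] algebra_simps)
  finally have "\<bar>\<Sum>e\<in>?W. Z e * D e\<bar>
      \<le> h * ?N * (6 * V * real L + 1) + sqrt K * (\<Sum>k\<le>L. sqrt (\<Sum>e\<in>?W. (E k e)\<^sup>2))" .
  moreover have "sqrt K * (\<Sum>k\<le>L. sqrt (\<Sum>e\<in>?W. (E k e)\<^sup>2))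
      \<le> sqrt K * (sqrt (real (L + 1)) * sqrt (\<Sum>e\<in>?W. (D e)\<^sup>2))"
  proof (rule mult_left_mono)
    have "(\<Sum>k\<le>L. \<bar>1\<bar> * \<bar>sqrt (\<Sum>e\<in>?W. (E k e)\<^sup>2)\<bar>)
        \<le> L2_set (\<lambda>_. 1) {..L} * L2_set (\<lambda>k. sqrt (\<Sum>e\<in>?W. (E k e)\<^sup>2)) {..L}"
      by (rule L2_set_mult_ineq)
    then show "(\<Sum>k\<le>L. sqrt (\<Sum>e\<in>?W. (E k e)\<^sup>2)) \<le> sqrt (real (L + 1)) * sqrt (\<Sum>e\<in>?W. (D e)\<^sup>2)"
      by (simp add: L2_set_def sum_nonneg Esq)
    have "0 \<le> K" by (rule order.trans[OF _ K[of 0]]) (rule sum_nonneg, simp, simp)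
    then show "0 \<le> sqrt K" by simp
  qed
  ultimately show ?thesis by (simp add: real_sqrt_mult mult.assoc)
qed

section \<open>Ordered matrices and the noise\<close>

lemma exp_le_quadratic:
  fixes x :: real
  assumes "\<bar>x\<bar> \<le> 1"
  shows "exp x \<le> 1 + x + x\<^sup>2"
proof (cases "x \<ge> 0")
  case True
  then show ?thesis using exp_bound[of x] assms by simp
next
  case False
  define y where "y = - x"
  have y: "0 < y" "y \<le> 1" using False assms by (auto simp: y_def)
  have "1 + y + y\<^sup>2 / 2 \<le> exp y" using exp_lower_Taylor_quadratic[of y] y by simp
  moreover have pos: "0 < 1 + y + y\<^sup>2 / 2" using y by (simp add: add_pos_nonneg)
  ultimately have "exp (- y) \<le> 1 / (1 + y + y\<^sup>2 / 2)"
    by (simp add: exp_minus inverse_eq_divide frac_le)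
  also have "\<dots> \<le> 1 - y + y\<^sup>2"
  proof -
    have "(1 - y + y\<^sup>2) * (1 + y + y\<^sup>2 / 2) = 1 + y\<^sup>2 / 2 + y ^ 3 / 2 + y ^ 4 / 2"
      by (simp add: field_simps power2_eq_square power3_eq_cube power4_eq_xxxx)
    then have "1 \<le> (1 - y + y\<^sup>2) * (1 + y + y\<^sup>2 / 2)" using y by simp
    then show ?thesis using pos by (simp add: divide_le_eq)
  qed
  finally show ?thesis by (simp add: y_def)
qed

text \<open>A Bernstein-type bound: centring removes the linear term, and what remains in the
  exponent is the second moment. For the noise this is of order p, which a bound in terms of the
  range alone would miss.\<close>

lemma expectation_exp_le:
  fixes f :: "'a \<Rightarrow> real"
  assumes fin: "finite (set_pmf q)" and f: "\<And>x. x \<in> set_pmf q \<Longrightarrow> \<bar>f x\<bar> \<le> 1"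
    and mean: "measure_pmf.expectation q f = 0"
  shows "measure_pmf.expectation q (\<lambda>x. exp (f x)) \<le> exp (measure_pmf.expectation q (\<lambda>x. (f x)\<^sup>2))"
proof -
  have int: "integrable (measure_pmf q) g" for g :: "'a \<Rightarrow> real"
    using fin by (rule integrable_measure_pmf_finite)
  have "measure_pmf.expectation q (\<lambda>x. exp (f x)) \<le> measure_pmf.expectation q (\<lambda>x. 1 + f x + (f x)\<^sup>2)"
    using f by (intro integral_mono_AE int AE_pmfI exp_le_quadratic) auto
  also have "\<dots> = 1 + measure_pmf.expectation q (\<lambda>x. (f x)\<^sup>2)"
    using mean by (simp add: int)
  also have "\<dots> \<le> exp (measure_pmf.expectation q (\<lambda>x. (f x)\<^sup>2))" by (rule exp_ge_add_one_self)
  finally show ?thesis .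
qed

lemma prob_le_expectation:
  assumes "finite (set_pmf q)" "\<And>x. x \<in> set_pmf q \<Longrightarrow> 0 \<le> f x"
    and "\<And>x. x \<in> set_pmf q \<Longrightarrow> x \<in> B \<Longrightarrow> 1 \<le> f x"
  shows "measure_pmf.prob q B \<le> measure_pmf.expectation q f"
proof -
  have "measure_pmf.prob q B = measure_pmf.expectation q (indicator B)" by simp
  also have "\<dots> \<le> measure_pmf.expectation q f"
    using assms by (intro integral_mono_AE integrable_measure_pmf_finite AE_pmfI)
      (auto simp: indicator_def)
  finally show ?thesis .
qed

section \<open>Properties shared by tournament and graph matrices\<close>

definition reflection_sign :: "model \<Rightarrow> real" where
  "reflection_sign m = (case m of Tournament \<Rightarrow> -1 | Graph \<Rightarrow> 1)"

lemma abs_reflection_sign [simp]: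
  "\<bar>reflection_sign m\<bar> = 1" "(reflection_sign m)\<^sup>2 = 1"
  by (simp_all add: reflection_sign_def split: model.splits)

context
  fixes A :: matrix and m :: model and n :: nat
  assumes A: "A \<in> ordered_mats m n"
begin

lemma ordered_mats_cases:
  "m = Tournament \<Longrightarrow> A \<in> tournament_mats n" "m = Graph \<Longrightarrow> A \<in> graph_mats n"
  using A by (simp_all add: ordered_mats_def)

lemma ordered_mats_mats01: "A \<in> mats01 n"
  using ordered_mats_cases unfolding tournament_mats_def graph_mats_def by (cases m) blast+

lemma ordered_mats_outside: "i \<notin> {1..n} \<or> j \<notin> {1..n} \<Longrightarrow> A i j = 0"
  using ordered_mats_mats01 unfolding mats01_def mem_Collect_eq by blast

lemma ordered_mats_bounds: "0 \<le> A i j" "A i j \<le> 1"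
proof -
  have "0 \<le> A i j \<and> A i j \<le> 1" if "i \<in> {1..n}" "j \<in> {1..n}"
    using ordered_mats_mats01 that unfolding mats01_def mem_Collect_eq by blast
  then show "0 \<le> A i j" "A i j \<le> 1"
    using ordered_mats_outside[of i j] by (cases "i \<in> {1..n} \<and> j \<in> {1..n}"; force)+
qed

lemma ordered_mats_diag: "A i i = 0"
proof (cases "i \<in> {1..n}")
  case True
  then show ?thesis
    using ordered_mats_cases unfolding tournament_mats_def graph_mats_def by (cases m) blast+
qed (simp add: ordered_mats_outside)

text \<open>After subtraction of J/2 a tournament matrix is antisymmetric and a graph matrix
  symmetric. Outside the range and on the diagonal both sides vanish, so the identity holds for all
  indices, and one sign lets the later arguments treat both models at once.\<close>

lemma ordered_mats_reflect: "A j i - Jmat n j i / 2 = reflection_sign m * (A i j - Jmat n i j / 2)"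
proof (cases "i \<in> {1..n} \<and> j \<in> {1..n} \<and> i \<noteq> j")
  case True
  have "\<forall>i\<in>{1..n}. \<forall>j\<in>{1..n}. i \<noteq> j \<longrightarrow> A j i = 1 - A i j" if "m = Tournament"
    using ordered_mats_cases(1)[OF that] unfolding tournament_mats_def mem_Collect_eq by (elim conjE)
  moreover have "\<forall>i\<in>{1..n}. \<forall>j\<in>{1..n}. i \<noteq> j \<longrightarrow> A j i = A i j" if "m = Graph"
    using ordered_mats_cases(2)[OF that] unfolding graph_mats_def mem_Collect_eq by (elim conjE)
  ultimately have "m = Tournament \<Longrightarrow> A j i = 1 - A i j" "m = Graph \<Longrightarrow> A j i = A i j"
    using True by (meson, meson)
  then show ?thesis using True by (cases m) (simp_all add: Jmat_def reflection_sign_def)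
next
  case False
  then have "A i j = 0" "A j i = 0" "Jmat n i j = 0" "Jmat n j i = 0"
    using ordered_mats_outside[of i j] ordered_mats_outside[of j i] ordered_mats_diag[of i] by (auto simp: Jmat_def)
  then show ?thesis by simp
qed

lemma ordered_mats_row_mono:
  assumes "i \<in> {1..n}" "j \<in> {1..n}" "k \<in> {1..n}" "i \<noteq> j" "i \<noteq> k" "j < k"
  shows "reflection_sign m * A i j \<le> reflection_sign m * A i k"
proof (cases m)
  case Tournament
  have "\<forall>i\<in>{1..n}. \<forall>j\<in>{1..n}. \<forall>k\<in>{1..n}. i \<noteq> k \<and> i \<noteq> j \<and> k < j \<longrightarrow> A i j \<le> A i k"
    using ordered_mats_cases(1)[OF Tournament] unfolding tournament_mats_def mem_Collect_eq by (elim conjE)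
  then have "A i k \<le> A i j" using assms by meson
  then show ?thesis by (simp add: Tournament reflection_sign_def)
next
  case Graph
  have "\<forall>i\<in>{1..n}. \<forall>j\<in>{1..n}. \<forall>k\<in>{1..n}. i \<noteq> k \<and> i \<noteq> j \<and> j < k \<longrightarrow> A i j \<le> A i k"
    using ordered_mats_cases(2)[OF Graph] unfolding graph_mats_def mem_Collect_eq by (elim conjE)
  then have "A i j \<le> A i k" using assms by meson
  then show ?thesis by (simp add: Graph reflection_sign_def)
qed

lemma ordered_mats_transpose:
  assumes "i \<in> {1..n}" "j \<in> {1..n}" "i \<noteq> j"
  shows "A j i = 1 / 2 + reflection_sign m * (A i j - 1 / 2)"
  using ordered_mats_reflect[of j i] assms by (simp add: Jmat_def)

text \<open>Reflection multiplies by the same sign that orients the rows. The two signs cancel, so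
  columns increase in both models.\<close>

lemma ordered_mats_col_mono:
  assumes "i \<in> {1..n}" "j \<in> {1..n}" "k \<in> {1..n}" "i \<noteq> j" "i \<noteq> k" "j < k"
  shows "A j i \<le> A k i"
  using ordered_mats_row_mono[OF assms] ordered_mats_transpose[OF assms(1,2,4)] ordered_mats_transpose[OF assms(1,3,5)]
  by (simp only: right_diff_distrib)

lemma ordered_mats_upper_le_lower:
  assumes "i \<in> {1..n}" "j \<in> {1..n}" "i < j"
  shows "A i j \<le> A j i"
proof (cases m)
  case Tournament
  have "\<forall>i\<in>{1..n}. \<forall>j\<in>{1..n}. i < j \<longrightarrow> A i j \<le> 1 / 2"
    using ordered_mats_cases(1)[OF Tournament] unfolding tournament_mats_def mem_Collect_eq by (elim conjE)
  then have "A i j \<le> 1 / 2" using assms by blast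
  then show ?thesis using ordered_mats_transpose[of i j] assms by (simp add: Tournament reflection_sign_def)
next
  case Graph
  then show ?thesis using ordered_mats_transpose[of i j] assms by (simp add: reflection_sign_def)
qed

text \<open>Rows i and k have their diagonal zeros in different columns, so they are not comparable
  entry by entry. Exchanging columns i and k in the second row matches the two zeros and leaves
  \<open>A i k\<close> against \<open>A k i\<close>, an entry above the diagonal against its mirror
  image.\<close>

lemma row_sum_ordered_mats_mono: "mono_on {1..n} (row_sum n A)"
proof (rule mono_onI)
  fix i k assume ik: "i \<in> {1..n}" "k \<in> {1..n}" "i \<le> k"
  show "row_sum n A i \<le> row_sum n A k"
  proof (cases "i = k")
    case False
    then have lt: "i < k" using ik by simp
    have "(\<Sum>j\<in>{1..n}. A i j) \<le> (\<Sum>j\<in>{1..n}. A k (Transposition.transpose i k j))"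
    proof (rule sum_mono)
      fix j assume j: "j \<in> {1..n}"
      consider "j = i" | "j = k" | "j \<noteq> i" "j \<noteq> k" by blast
      then show "A i j \<le> A k (Transposition.transpose i k j)"
      proof cases
        case 3
        then show ?thesis using ordered_mats_col_mono[of j i k] ik j lt by simp
      qed (use ordered_mats_upper_le_lower[of i k] ik lt in \<open>auto simp: ordered_mats_diag\<close>)
    qed
    also have "\<dots> = (\<Sum>j\<in>{1..n}. A k j)"
      using sum.permute[OF permutes_swap_id[OF ik(1,2)], of "A k"] by (simp add: o_def)
    finally show ?thesis by (simp add: row_sum_def)
  qed simp
qed

end

section \<open>The observation model and its centred noise\<close>

locale observation =
  fixes m :: model and n :: nat and p :: real and \<theta>0 :: matrix and \<pi> :: "nat \<Rightarrow> nat"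
  assumes p: "0 \<le> p" "p \<le> 1"
    and \<theta>0: "\<theta>0 \<in> ordered_mats m n" and \<pi>: "\<pi> permutes {1..n}"
begin

definition \<theta> :: matrix where "\<theta> = relabel \<theta>0 \<pi>"

text \<open>A missing entry is recorded as 1/2, so the data minus J/2 has mean p (\<theta> - J/2).
  This is the centring, and it respects the reflection.\<close>

definition noise :: "sample \<Rightarrow> matrix" where
  "noise \<omega> i j = data_matrix m n \<omega> i j - Jmat n i j / 2 - p * (\<theta> i j - Jmat n i j / 2)"

lemmas \<theta>0_outside = ordered_mats_outside[OF \<theta>0]
  and \<theta>0_bounds = ordered_mats_bounds[OF \<theta>0]
  and \<theta>0_diag = ordered_mats_diag[OF \<theta>0]
  and \<theta>0_reflect = ordered_mats_reflect[OF \<theta>0]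

lemma \<pi>_mem: "\<pi> i \<in> {1..n} \<longleftrightarrow> i \<in> {1..n}"
  using permutes_in_image[OF \<pi>] .

lemma \<pi>_eq: "\<pi> i = \<pi> j \<longleftrightarrow> i = j"
  using permutes_inj[OF \<pi>] by (auto dest: injD)

lemma Jmat_relabel: "Jmat n (\<pi> i) (\<pi> j) = Jmat n i j"
  unfolding Jmat_def \<pi>_mem \<pi>_eq by simp

lemma \<theta>_bounds: "0 \<le> \<theta> i j" "\<theta> i j \<le> 1"
  by (simp_all add: \<theta>_def relabel_def \<theta>0_bounds)

lemma \<theta>_reflect: "\<theta> j i - Jmat n j i / 2 = reflection_sign m * (\<theta> i j - Jmat n i j / 2)"
  using \<theta>0_reflect[of "\<pi> j" "\<pi> i"] by (simp add: \<theta>_def relabel_def Jmat_relabel)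

lemma \<theta>_outside: "i \<notin> {1..n} \<or> j \<notin> {1..n} \<Longrightarrow> \<theta> i j = 0"
  using \<theta>0_outside[of "\<pi> i" "\<pi> j"] \<pi>_mem by (auto simp: \<theta>_def relabel_def)

lemma \<theta>_diag: "\<theta> i i = 0"
  by (simp add: \<theta>_def relabel_def \<theta>0_diag)

lemma noise_outside: "i \<notin> {1..n} \<or> j \<notin> {1..n} \<Longrightarrow> noise \<omega> i j = 0"
  by (auto simp: noise_def data_matrix_def Jmat_def \<theta>_outside)

lemma noise_diag: "noise \<omega> i i = 0"
  by (simp add: noise_def data_matrix_def Jmat_def \<theta>_diag)

lemma noise_reflect: "noise \<omega> j i = reflection_sign m * noise \<omega> i j"
proof -
  have "data_matrix m n \<omega> j i - Jmat n j i / 2 = reflection_sign m * (data_matrix m n \<omega> i j - Jmat n i j / 2)"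
    by (cases "i = j"; cases "i < j") (auto simp: data_matrix_def Jmat_def reflection_sign_def split: model.splits)
  then show ?thesis by (simp add: noise_def \<theta>_reflect[of j i] algebra_simps)
qed

text \<open>Noise above the diagonal as a function of one coordinate of the sample, the form in
  which independence can be applied.\<close>

definition entry_noise :: "nat \<times> nat \<Rightarrow> bool \<times> bool \<Rightarrow> real" where
  "entry_noise e x = (if snd x then of_bool (fst x) else 1 / 2) - 1 / 2 - p * (\<theta> (fst e) (snd e) - 1 / 2)"

abbreviation entry_pmf :: "nat \<times> nat \<Rightarrow> (bool \<times> bool) pmf" where
  "entry_pmf e \<equiv> pair_pmf (bernoulli_pmf (\<theta> (fst e) (snd e))) (bernoulli_pmf p)"

lemma noise_upper: "(i, j) \<in> upper_pairs n \<Longrightarrow> noise \<omega> i j = entry_noise (i, j) (\<omega> (i, j))"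
  by (auto simp: noise_def data_matrix_def Jmat_def upper_pairs_def upper_entry_def entry_noise_def
      split: prod.splits)

lemma finite_upper_pairs: "finite (upper_pairs n)"
  by (rule finite_subset[of _ "{1..n} \<times> {1..n}"]) (auto simp: upper_pairs_def)

lemma sample_pmf_eq: "sample_pmf n p \<theta> = Pi_pmf (upper_pairs n) (False, False) entry_pmf"
  by (simp add: sample_pmf_def case_prod_unfold)

lemma finite_set_sample_pmf: "finite (set_pmf (sample_pmf n p \<theta>))"
  unfolding sample_pmf_eq
  by (rule finite_subset[OF set_Pi_pmf_subset'[OF finite_upper_pairs] finite_PiE_dflt[OF finite_upper_pairs]]) simp

lemma expectation_entry:
  fixes g :: "bool \<times> bool \<Rightarrow> real"
  shows "measure_pmf.expectation (entry_pmf e) g =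
    p * (\<theta> (fst e) (snd e) * g (True, True) + (1 - \<theta> (fst e) (snd e)) * g (False, True))
    + (1 - p) * (\<theta> (fst e) (snd e) * g (True, False) + (1 - \<theta> (fst e) (snd e)) * g (False, False))"
proof -
  let ?B = "{(True, True), (False, True), (True, False), (False, False)}"
  have "x \<in> ?B" for x :: "bool \<times> bool"
    by (cases x; cases "fst x"; cases "snd x") auto
  then have "measure_pmf.expectation (entry_pmf e) g = (\<Sum>x\<in>?B. g x * pmf (entry_pmf e) x)"
    by (intro integral_measure_pmf_real) auto
  then show ?thesis
    using p \<theta>_bounds by (simp add: pmf_pair algebra_simps)
qed

lemma abs_entry_noise_le: "\<bar>entry_noise e x\<bar> \<le> 1"
proof -
  have "p * \<bar>\<theta> (fst e) (snd e) - 1 / 2\<bar> \<le> 1 * (1 / 2)"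
  proof (rule mult_mono)
    show "\<bar>\<theta> (fst e) (snd e) - 1 / 2\<bar> \<le> 1 / 2"
      unfolding abs_le_iff using \<theta>_bounds[of "fst e" "snd e"] by linarith
  qed (use p in auto)
  then have "\<bar>p * (\<theta> (fst e) (snd e) - 1 / 2)\<bar> \<le> 1 / 2"
    using p by (simp add: abs_mult)
  then show ?thesis by (auto simp: entry_noise_def)
qed

lemma expectation_exp_sum_le:
  fixes f :: "nat \<times> nat \<Rightarrow> bool \<times> bool \<Rightarrow> real"
  assumes "\<And>e x. e \<in> upper_pairs n \<Longrightarrow> \<bar>c e * f e x\<bar> \<le> 1"
    and "\<And>e. e \<in> upper_pairs n \<Longrightarrow> measure_pmf.expectation (entry_pmf e) (f e) = 0"
    and "\<And>e. e \<in> upper_pairs n \<Longrightarrow> measure_pmf.expectation (entry_pmf e) (\<lambda>x. (f e x)\<^sup>2) \<le> v"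
  shows "measure_pmf.expectation (sample_pmf n p \<theta>) (\<lambda>\<omega>. exp (\<Sum>e\<in>upper_pairs n. c e * f e (\<omega> e)))
    \<le> exp (v * (\<Sum>e\<in>upper_pairs n. (c e)\<^sup>2))"
proof -
  let ?U = "upper_pairs n"
  have "measure_pmf.expectation (sample_pmf n p \<theta>) (\<lambda>\<omega>. exp (\<Sum>e\<in>?U. c e * f e (\<omega> e)))
      = measure_pmf.expectation (sample_pmf n p \<theta>) (\<lambda>\<omega>. \<Prod>e\<in>?U. exp (c e * f e (\<omega> e)))"
    by (simp add: exp_sum finite_upper_pairs)
  also have "\<dots> = (\<Prod>e\<in>?U. measure_pmf.expectation (entry_pmf e) (\<lambda>x. exp (c e * f e x)))"
    unfolding sample_pmf_eq
    by (rule expectation_prod_Pi_pmf[OF finite_upper_pairs]) (auto intro: integrable_measure_pmf_finite)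
  also have "\<dots> \<le> (\<Prod>e\<in>?U. exp (v * (c e)\<^sup>2))"
  proof (rule prod_mono, intro conjI)
    fix e assume e: "e \<in> ?U"
    show "0 \<le> measure_pmf.expectation (entry_pmf e) (\<lambda>x. exp (c e * f e x))" by simp
    have "measure_pmf.expectation (entry_pmf e) (\<lambda>x. exp (c e * f e x))
        \<le> exp (measure_pmf.expectation (entry_pmf e) (\<lambda>x. (c e * f e x)\<^sup>2))"
      using assms(1,2)[OF e] by (intro expectation_exp_le) auto
    also have "\<dots> = exp ((c e)\<^sup>2 * measure_pmf.expectation (entry_pmf e) (\<lambda>x. (f e x)\<^sup>2))"
      by (simp add: power_mult_distrib)
    also have "\<dots> \<le> exp (v * (c e)\<^sup>2)"
      using mult_left_mono[OF assms(3)[OF e], of "(c e)\<^sup>2"] by (simp add: mult.commute)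
    finally show "measure_pmf.expectation (entry_pmf e) (\<lambda>x. exp (c e * f e x)) \<le> exp (v * (c e)\<^sup>2)" .
  qed
  also have "\<dots> = exp (v * (\<Sum>e\<in>?U. (c e)\<^sup>2))"
    by (simp add: exp_sum finite_upper_pairs sum_distrib_left)
  finally show ?thesis .
qed

lemma sum_offdiag_pairs:
  assumes "\<And>i. i \<in> {1..n} \<Longrightarrow> g i i = (0::real)"
  shows "(\<Sum>i\<in>{1..n}. \<Sum>j\<in>{1..n}. g i j) = (\<Sum>e\<in>upper_pairs n. g (fst e) (snd e) + g (snd e) (fst e))"
proof -
  let ?U = "upper_pairs n"
  let ?l = "prod.swap ` ?U"
  have "(\<Sum>i\<in>{1..n}. \<Sum>j\<in>{1..n}. g i j) = (\<Sum>e\<in>{1..n} \<times> {1..n}. g (fst e) (snd e))"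
    by (simp add: sum.cartesian_product case_prod_unfold)
  also have "\<dots> = (\<Sum>e\<in>?U \<union> ?l. g (fst e) (snd e))"
  proof (rule sum.mono_neutral_right)
    show "\<forall>e\<in>{1..n} \<times> {1..n} - (?U \<union> ?l). g (fst e) (snd e) = 0"
    proof
      fix e assume e: "e \<in> {1..n} \<times> {1..n} - (?U \<union> ?l)"
      obtain i j where ij: "e = (i, j)" by fastforce
      have "(j, i) \<notin> ?U" using e by (force simp: ij image_iff)
      then have "i = j" using e by (auto simp: ij upper_pairs_def)
      then show "g (fst e) (snd e) = 0" using assms e by (auto simp: ij)
    qed
  qed (auto simp: upper_pairs_def)
  also have "\<dots> = (\<Sum>e\<in>?U. g (fst e) (snd e)) + (\<Sum>e\<in>?l. g (fst e) (snd e))"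
    using finite_upper_pairs by (intro sum.union_disjoint) (auto simp: upper_pairs_def)
  also have "(\<Sum>e\<in>?l. g (fst e) (snd e)) = (\<Sum>e\<in>?U. g (snd e) (fst e))"
    by (subst sum.reindex) (auto simp: inj_on_def)
  finally show ?thesis by (simp add: sum.distrib)
qed

text \<open>Mirrored entries share one outcome, so a test matrix acts on each independent pair
  through \<open>A i j\<close> plus or minus \<open>A j i\<close>. The sum of absolute values covers
  both models, and it is this sum, not the single entries, that has to stay below 1.\<close>

lemma expectation_exp_noise_le:
  assumes A: "\<And>i j. i \<in> {1..n} \<Longrightarrow> j \<in> {1..n} \<Longrightarrow> i \<noteq> j \<Longrightarrow> \<bar>A i j\<bar> + \<bar>A j i\<bar> \<le> 1"
  shows "measure_pmf.expectation (sample_pmf n p \<theta>)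
      (\<lambda>\<omega>. exp (\<Sum>i\<in>{1..n}. \<Sum>j\<in>{1..n}. noise \<omega> i j * A i j))
    \<le> exp (p / 4 * (\<Sum>e\<in>upper_pairs n. (\<bar>A (fst e) (snd e)\<bar> + \<bar>A (snd e) (fst e)\<bar>)\<^sup>2))"
proof -
  let ?U = "upper_pairs n"
  let ?c = "\<lambda>e. A (fst e) (snd e) + reflection_sign m * A (snd e) (fst e)"
  have lin: "(\<Sum>i\<in>{1..n}. \<Sum>j\<in>{1..n}. noise \<omega> i j * A i j) = (\<Sum>e\<in>?U. ?c e * entry_noise e (\<omega> e))" for \<omega>
    by (subst sum_offdiag_pairs)
      (auto simp: noise_diag noise_upper noise_reflect[of _ "snd _" "fst _"] algebra_simps intro!: sum.cong)
  have c: "\<bar>?c e\<bar> \<le> \<bar>A (fst e) (snd e)\<bar> + \<bar>A (snd e) (fst e)\<bar>" for e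
    using abs_triangle_ineq[of "A (fst e) (snd e)" "reflection_sign m * A (snd e) (fst e)"]
    by (simp add: abs_mult)
  have "measure_pmf.expectation (sample_pmf n p \<theta>) (\<lambda>\<omega>. exp (\<Sum>e\<in>?U. ?c e * entry_noise e (\<omega> e)))
      \<le> exp (p / 4 * (\<Sum>e\<in>?U. (?c e)\<^sup>2))"
  proof (rule expectation_exp_sum_le)
    fix e assume e: "e \<in> ?U"
    have "\<bar>?c e\<bar> \<le> 1" using c[of e] A[of "fst e" "snd e"] e by (auto simp: upper_pairs_def)
    then show "\<bar>?c e * entry_noise e x\<bar> \<le> 1" for x
      using abs_entry_noise_le[of e x] by (simp add: abs_mult mult_le_one)
    show "measure_pmf.expectation (entry_pmf e) (entry_noise e) = 0"
      by (simp add: expectation_entry entry_noise_def field_simps)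
    define t where "t = \<theta> (fst e) (snd e) - 1 / 2"
    \<comment> \<open>Before centring the value is 1/2 in modulus with probability p and 0
      otherwise; centring subtracts the square of the mean p t.\<close>
    have "measure_pmf.expectation (entry_pmf e) (\<lambda>x. (entry_noise e x)\<^sup>2) = p / 4 - p\<^sup>2 * t\<^sup>2"
      unfolding expectation_entry entry_noise_def t_def by (simp add: power2_eq_square field_simps)
    then show "measure_pmf.expectation (entry_pmf e) (\<lambda>x. (entry_noise e x)\<^sup>2) \<le> p / 4" by simp
  qed
  also have "\<dots> \<le> exp (p / 4 * (\<Sum>e\<in>?U. (\<bar>A (fst e) (snd e)\<bar> + \<bar>A (snd e) (fst e)\<bar>)\<^sup>2))"
    using p c by (intro exp_le_cancel_iff[THEN iffD2] mult_left_mono sum_mono) (auto simp: abs_le_square_iff[symmetric])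
  finally show ?thesis by (simp only: lin)
qed

end

section \<open>Tail bounds\<close>

lemma prob_UN_le:
  assumes "finite I" "\<And>i. i \<in> I \<Longrightarrow> measure_pmf.prob q (B i) \<le> b i"
  shows "measure_pmf.prob q (\<Union>i\<in>I. B i) \<le> (\<Sum>i\<in>I. b i)"
proof -
  have "measure_pmf.prob q (\<Union>i\<in>I. B i) \<le> (\<Sum>i\<in>I. measure_pmf.prob q (B i))"
    using assms(1) by (intro measure_pmf.finite_measure_subadditive_finite) auto
  also have "\<dots> \<le> (\<Sum>i\<in>I. b i)" by (rule sum_mono) (rule assms(2))
  finally show ?thesis .
qed

lemma prob_exp_tail:
  fixes S :: "'a \<Rightarrow> real"
  assumes "finite (set_pmf q)" "measure_pmf.expectation q (\<lambda>x. exp (S x)) \<le> exp v"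
  shows "measure_pmf.prob q {x. S x > u} \<le> exp (v - u)"
proof -
  have "measure_pmf.prob q {x. S x > u} \<le> measure_pmf.expectation q (\<lambda>x. exp (S x) * exp (- u))"
    using assms(1) by (intro prob_le_expectation) (auto simp flip: exp_add)
  also have "\<dots> \<le> exp v * exp (- u)" using assms(2) by simp
  finally show ?thesis by (simp flip: exp_add)
qed

lemma prob_abs_exp_tail:
  fixes S :: "'a \<Rightarrow> real"
  assumes "finite (set_pmf q)" "measure_pmf.expectation q (\<lambda>x. exp (c * S x)) \<le> exp v"
    and "measure_pmf.expectation q (\<lambda>x. exp (- c * S x)) \<le> exp v" "c > 0"
  shows "measure_pmf.prob q {x. \<bar>S x\<bar> > u} \<le> 2 * exp (v - c * u)"
proof -
  have "{x. \<bar>S x\<bar> > u} = {x. c * S x > c * u} \<union> {x. - c * S x > c * u}"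
  proof (intro set_eqI)
    fix x
    have "- c * S x > c * u \<longleftrightarrow> c * (- S x) > c * u" by simp
    then show "x \<in> {x. \<bar>S x\<bar> > u} \<longleftrightarrow> x \<in> {x. c * S x > c * u} \<union> {x. - c * S x > c * u}"
      using \<open>c > 0\<close> by (simp only: mem_Collect_eq Un_iff mult_less_cancel_left_pos) linarith
  qed
  then have "measure_pmf.prob q {x. \<bar>S x\<bar> > u}
      \<le> measure_pmf.prob q {x. c * S x > c * u} + measure_pmf.prob q {x. - c * S x > c * u}"
    by (simp add: measure_Un_le)
  then show ?thesis
    using prob_exp_tail[OF assms(1,2), of "c * u"] prob_exp_tail[OF assms(1,3), of "c * u"] by linarith
qed

text \<open>Give a set R the weight n^(-card R). The weights of all subsets add up to (1 + 1/n)^n,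
  which is at most e, and every set counted here has weight at least n^(-s).\<close>

lemma card_small_subsets_le:
  assumes "n \<ge> 1"
  shows "real (card {R. R \<subseteq> {1..n} \<and> card R \<le> s}) \<le> 3 * real n ^ s"
proof -
  let ?S = "{R. R \<subseteq> {1..n} \<and> card R \<le> s}"
  have "real (card ?S) * (1 / real n) ^ s = (\<Sum>R\<in>?S. (1 / real n) ^ s)" by simp
  also have "\<dots> \<le> (\<Sum>R\<in>?S. (1 / real n) ^ card R)"
    using assms by (intro sum_mono power_decreasing) auto
  also have "\<dots> \<le> (\<Sum>R\<in>Pow {1..n}. (1 / real n) ^ card R)"
    by (intro sum_mono2) auto
  also have "\<dots> = (\<Prod>x\<in>{1..n}. 1 / real n + 1)"
    by (subst prod_add) simp_all
  also have "\<dots> = (1 + 1 / real n) ^ n" by (simp add: add.commute)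
  also have "\<dots> \<le> exp (1 / real n) ^ n"
    by (intro power_mono) (auto simp: exp_ge_add_one_self)
  also have "\<dots> = exp 1" using assms by (simp flip: exp_of_nat_mult)
  also have "\<dots> \<le> 3" by (rule exp_le)
  finally show ?thesis using assms by (simp add: field_simps power_divide)
qed

lemma real_choose_two: "real (n choose 2) = real n * (real n - 1) / 2"
proof (cases n)
  case (Suc k)
  have "even (n * (n - 1))" by (cases "even n") auto
  then show ?thesis by (simp add: choose_two real_of_nat_div Suc algebra_simps)
qed simp

lemma prod_sqrt_div:
  assumes "0 \<le> a" "0 < b"
  shows "sqrt (a / b) * sqrt (b * a) = a"
  using assms by (simp flip: real_sqrt_mult)

context observation
begin

text \<open>The version for test matrices that may charge both mirror images of a pair: the range of
  the entries is halved and the square of the sum costs a factor 2. Single rows use the sharper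
  bound above, because the constant of the row deviation is prescribed.\<close>

lemma expectation_exp_noise_le':
  assumes A: "\<And>i j. i \<in> {1..n} \<Longrightarrow> j \<in> {1..n} \<Longrightarrow> \<bar>A i j\<bar> \<le> 1 / 2"
  shows "measure_pmf.expectation (sample_pmf n p \<theta>)
      (\<lambda>\<omega>. exp (\<Sum>i\<in>{1..n}. \<Sum>j\<in>{1..n}. noise \<omega> i j * A i j))
    \<le> exp (p / 2 * (\<Sum>i\<in>{1..n}. \<Sum>j\<in>{1..n}. (A i j)\<^sup>2))"
proof -
  let ?U = "upper_pairs n"
  define g where "g i j = (if i = j then 0 else (A i j)\<^sup>2)" for i j
  have "\<bar>A i j\<bar> + \<bar>A j i\<bar> \<le> 1" if "i \<in> {1..n}" "j \<in> {1..n}" for i j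
    using A[of i j] A[of j i] that by linarith
  then have "measure_pmf.expectation (sample_pmf n p \<theta>)
      (\<lambda>\<omega>. exp (\<Sum>i\<in>{1..n}. \<Sum>j\<in>{1..n}. noise \<omega> i j * A i j))
    \<le> exp (p / 4 * (\<Sum>e\<in>?U. (\<bar>A (fst e) (snd e)\<bar> + \<bar>A (snd e) (fst e)\<bar>)\<^sup>2))"
    by (intro expectation_exp_noise_le)
  also have "\<dots> \<le> exp (p / 4 * (2 * (\<Sum>i\<in>{1..n}. \<Sum>j\<in>{1..n}. (A i j)\<^sup>2)))"
  proof (intro exp_le_cancel_iff[THEN iffD2] mult_left_mono)
    have "(\<Sum>e\<in>?U. (\<bar>A (fst e) (snd e)\<bar> + \<bar>A (snd e) (fst e)\<bar>)\<^sup>2)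
        \<le> (\<Sum>e\<in>?U. 2 * (g (fst e) (snd e) + g (snd e) (fst e)))"
    proof (rule sum_mono)
      fix e assume e: "e \<in> ?U"
      have "(\<bar>A (fst e) (snd e)\<bar> + \<bar>A (snd e) (fst e)\<bar>)\<^sup>2
          \<le> 2 * ((A (fst e) (snd e))\<^sup>2 + (A (snd e) (fst e))\<^sup>2)"
        using sum_squares_bound[of "\<bar>A (fst e) (snd e)\<bar>" "\<bar>A (snd e) (fst e)\<bar>"]
        by (simp add: power2_sum)
      then show "(\<bar>A (fst e) (snd e)\<bar> + \<bar>A (snd e) (fst e)\<bar>)\<^sup>2 \<le> 2 * (g (fst e) (snd e) + g (snd e) (fst e))"
        using e by (auto simp: g_def upper_pairs_def)
    qed
    also have "\<dots> = 2 * (\<Sum>i\<in>{1..n}. \<Sum>j\<in>{1..n}. g i j)"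
      by (subst sum_offdiag_pairs) (auto simp: g_def sum_distrib_left)
    also have "\<dots> \<le> 2 * (\<Sum>i\<in>{1..n}. \<Sum>j\<in>{1..n}. (A i j)\<^sup>2)"
      by (intro mult_left_mono sum_mono) (auto simp: g_def)
    finally show "(\<Sum>e\<in>?U. (\<bar>A (fst e) (snd e)\<bar> + \<bar>A (snd e) (fst e)\<bar>)\<^sup>2)
      \<le> 2 * (\<Sum>i\<in>{1..n}. \<Sum>j\<in>{1..n}. (A i j)\<^sup>2)" .
  qed (use p in auto)
  finally show ?thesis by simp
qed

lemma prob_row_noise:
  assumes n: "n \<ge> 2" and np: "2 * ln (real n) \<le> real n * p"
  shows "measure_pmf.prob (sample_pmf n p \<theta>)
      {\<omega>. \<exists>i\<in>{1..n}. \<bar>\<Sum>j\<in>{1..n}. noise \<omega> i j\<bar> > 2 * sqrt (real n * p * ln (real n))} \<le> 2 / real n"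
proof -
  define l where "l = ln (real n)"
  define u where "u = 2 * sqrt (real n * p * l)"
  \<comment> \<open>The assumption n p >= 2 log n says exactly that this tilt is at most 1. The
    exponent becomes (1/2 - 2 sqrt 2) log n, which is below -2 log n, enough for the union over n
    rows.\<close>
  define c where "c = sqrt (2 * l / (real n * p))"
  let ?q = "sample_pmf n p \<theta>"
  have l: "l > 0" using n by (simp add: l_def)
  then have np': "real n * p > 0" "2 * l \<le> real n * p" using np by (auto simp: l_def)
  have c: "0 < c" "c \<le> 1" using l np' by (simp_all add: c_def)
  have c2: "c\<^sup>2 = 2 * l / (real n * p)" using l np' by (simp add: c_def)
  have cu: "c * u = 2 * sqrt 2 * l"
  proof -
    have "c * u = 2 * sqrt 2 * (sqrt (l / (real n * p)) * sqrt (real n * p * l))"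
      by (simp add: c_def u_def real_sqrt_mult flip: times_divide_eq_right)
    then show ?thesis using prod_sqrt_div[of l "real n * p"] l np' by simp
  qed
  have one: "measure_pmf.prob ?q {\<omega>. \<bar>\<Sum>j\<in>{1..n}. noise \<omega> i j\<bar> > u} \<le> 2 / (real n)\<^sup>2"
    if i: "i \<in> {1..n}" for i
  proof -
    have mgf: "measure_pmf.expectation ?q (\<lambda>\<omega>. exp (d * (\<Sum>j\<in>{1..n}. noise \<omega> i j))) \<le> exp (l / 2)"
      if d: "\<bar>d\<bar> = c" for d
    proof -
      have d2: "d\<^sup>2 = c\<^sup>2" using d by (metis power2_abs)
      define A where "A i' j = (if i' = i then d else 0)" for i' j :: nat
      have "(\<Sum>i'\<in>{1..n}. \<Sum>j\<in>{1..n}. noise \<omega> i' j * A i' j) = d * (\<Sum>j\<in>{1..n}. noise \<omega> i j)" for \<omega>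
      proof -
        have "(\<Sum>i'\<in>{1..n}. \<Sum>j\<in>{1..n}. noise \<omega> i' j * A i' j)
            = (\<Sum>i'\<in>{1..n}. if i' = i then d * (\<Sum>j\<in>{1..n}. noise \<omega> i j) else 0)"
          by (intro sum.cong) (auto simp: A_def sum_distrib_left mult.commute)
        then show ?thesis using i by simp
      qed
      then have "measure_pmf.expectation ?q (\<lambda>\<omega>. exp (d * (\<Sum>j\<in>{1..n}. noise \<omega> i j)))
          \<le> exp (p / 4 * (\<Sum>e\<in>upper_pairs n. (\<bar>A (fst e) (snd e)\<bar> + \<bar>A (snd e) (fst e)\<bar>)\<^sup>2))"
        using expectation_exp_noise_le[of A] c d by (simp add: A_def)
      also have "(\<Sum>e\<in>upper_pairs n. (\<bar>A (fst e) (snd e)\<bar> + \<bar>A (snd e) (fst e)\<bar>)\<^sup>2)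
          = (\<Sum>i'\<in>{1..n}. \<Sum>j\<in>{1..n}. if i' = i \<and> j \<noteq> i then c\<^sup>2 else 0)"
        by (subst sum_offdiag_pairs) (auto simp: A_def upper_pairs_def d2 intro!: sum.cong)
      also have "\<dots> = (\<Sum>i'\<in>{1..n}. if i' = i then \<Sum>j\<in>{1..n}. if j \<noteq> i then c\<^sup>2 else 0 else 0)"
        by (intro sum.cong) auto
      also have "\<dots> = (\<Sum>j\<in>{1..n}. if j \<noteq> i then c\<^sup>2 else 0)" using i by simp
      also have "exp (p / 4 * \<dots>) \<le> exp (p / 4 * (\<Sum>j\<in>{1..n}. c\<^sup>2))"
        using p by (intro exp_le_cancel_iff[THEN iffD2] mult_left_mono sum_mono) auto
      also have "p / 4 * (\<Sum>j\<in>{1..n}. c\<^sup>2) = l / 2" using np' by (auto simp: c2)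
      finally show ?thesis .
    qed
    have "measure_pmf.prob ?q {\<omega>. \<bar>\<Sum>j\<in>{1..n}. noise \<omega> i j\<bar> > u} \<le> 2 * exp (l / 2 - c * u)"
      using mgf[of c] mgf[of "- c"] c by (intro prob_abs_exp_tail finite_set_sample_pmf) auto
    also have "\<dots> \<le> 2 * exp (- 2 * l)"
    proof -
      have "5 / 4 \<le> sqrt (2 :: real)" by (rule real_le_rsqrt) (simp add: power2_eq_square)
      then have "5 / 4 * l \<le> sqrt 2 * l" using l by (intro mult_right_mono) auto
      then show ?thesis by (simp add: cu)
    qed
    also have "\<dots> = 2 / (real n)\<^sup>2"
      using n by (simp add: l_def exp_minus exp_double inverse_eq_divide)
    finally show ?thesis .
  qed
  have "measure_pmf.prob ?q (\<Union>i\<in>{1..n}. {\<omega>. \<bar>\<Sum>j\<in>{1..n}. noise \<omega> i j\<bar> > u}) \<le> (\<Sum>i\<in>{1..n}. 2 / (real n)\<^sup>2)"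
    using one by (intro prob_UN_le) auto
  also have "\<dots> = 2 / real n" using n by (simp add: power2_eq_square)
  finally show ?thesis by (simp add: u_def l_def UN_iff Collect_bex_eq)
qed

lemma card_upper_pairs: "card (upper_pairs n) = n choose 2"
proof -
  have "real (card (upper_pairs n)) * 2 = (\<Sum>i\<in>{1..n}. \<Sum>j\<in>{1..n}. if i = j then 0 else 1)"
  proof (subst sum_offdiag_pairs)
    have "(\<Sum>e\<in>upper_pairs n. (if fst e = snd e then 0 else 1) + (if snd e = fst e then 0 else 1))
      = (\<Sum>e\<in>upper_pairs n. 2 :: real)"
      by (rule sum.cong) (auto simp: upper_pairs_def)
    then show "real (card (upper_pairs n)) * 2
      = (\<Sum>e\<in>upper_pairs n. (if fst e = snd e then 0 else 1) + (if snd e = fst e then 0 else 1))" by simp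
  qed simp
  also have "\<dots> = (\<Sum>i\<in>{1..n}. real n - 1)"
  proof (rule sum.cong[OF refl])
    fix i assume i: "i \<in> {1..n}"
    have "(\<Sum>j\<in>{1..n}. if i = j then 0 else 1) = (\<Sum>j\<in>{1..n} - {i}. 1 :: real)"
      by (intro sum.mono_neutral_cong_right) auto
    then show "(\<Sum>j\<in>{1..n}. if i = j then 0 else 1) = real n - 1" using i by (simp add: of_nat_diff)
  qed
  also have "\<dots> = real n * (real n - 1)" by simp
  finally have "real (card (upper_pairs n)) = real (n choose 2)"
    by (simp add: real_choose_two)
  then show ?thesis by simp
qed

text \<open>A Chernoff bound for the number of observed pairs, whose indicators have variance at
  most p. As N is at least n^2 / 4, a deviation 3 sqrt(p N log n) of the count becomes 6 sqrt(p log
  n) / n after division by N; the tilt is at most 1 because p N is at least log n.\<close>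

lemma prob_p_hat:
  assumes n: "n \<ge> 2" and np: "2 * ln (real n) \<le> real n * p"
  shows "measure_pmf.prob (sample_pmf n p \<theta>)
      {\<omega>. \<bar>p_hat n \<omega> - p\<bar> > 6 * sqrt (p * ln (real n)) / real n} \<le> 2 / real n"
proof -
  define l where "l = ln (real n)"
  define N where "N = real (n choose 2)"
  define c where "c = sqrt (l / (p * N))"
  let ?q = "sample_pmf n p \<theta>" and ?U = "upper_pairs n"
  define f :: "nat \<times> nat \<Rightarrow> bool \<times> bool \<Rightarrow> real" where "f e x = of_bool (snd x) - p" for e x
  have l: "l > 0" using n by (simp add: l_def)
  then have np': "real n * p > 0" "2 * l \<le> real n * p" using np by (auto simp: l_def)
  then have p0: "p > 0" using p by (simp add: zero_less_mult_iff)
  have N_eq: "N = real n * (real n - 1) / 2" by (simp add: N_def real_choose_two)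
  have N: "N > 0" using n by (simp add: N_eq)
  have N4: "(real n)\<^sup>2 / 4 \<le> N"
    using n mult_left_mono[of 2 "real n" "real n"] by (simp add: N_eq power2_eq_square field_simps)
  have pN: "l \<le> p * N"
  proof -
    have "l * 1 \<le> real n * p / 2 * (real n - 1)"
      using np' n l by (intro mult_mono) auto
    then show ?thesis by (simp add: N_eq mult_ac)
  qed
  have c: "0 < c" "c \<le> 1" using l pN N p0 by (simp_all add: c_def)
  have mgf: "measure_pmf.expectation ?q (\<lambda>\<omega>. exp (d * (\<Sum>e\<in>?U. f e (\<omega> e)))) \<le> exp l" if d: "\<bar>d\<bar> = c" for d
  proof -
    have d2: "d\<^sup>2 = c\<^sup>2" using d by (metis power2_abs)
    have "measure_pmf.expectation ?q (\<lambda>\<omega>. exp (\<Sum>e\<in>?U. d * f e (\<omega> e))) \<le> exp (p * (\<Sum>e\<in>?U. d\<^sup>2))"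
    proof (rule expectation_exp_sum_le)
      show "\<bar>d * f e x\<bar> \<le> 1" for e x
        using d c p by (auto simp: abs_mult f_def intro!: mult_le_one)
      show "measure_pmf.expectation (entry_pmf e) (f e) = 0" for e
        by (simp add: expectation_entry f_def algebra_simps)
      have "measure_pmf.expectation (entry_pmf e) (\<lambda>x. (f e x)\<^sup>2) = p - p\<^sup>2" for e
        unfolding expectation_entry f_def by (simp add: power2_eq_square algebra_simps)
      then show "measure_pmf.expectation (entry_pmf e) (\<lambda>x. (f e x)\<^sup>2) \<le> p" for e by simp
    qed
    also have "p * (\<Sum>e\<in>?U. d\<^sup>2) = l"
      using l p0 N by (simp add: d2 card_upper_pairs c_def flip: N_def)
    finally show ?thesis by (simp add: sum_distrib_left)
  qed
  have "{\<omega>. \<bar>p_hat n \<omega> - p\<bar> > 6 * sqrt (p * l) / real n}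
      \<subseteq> {\<omega>. \<bar>\<Sum>e\<in>?U. f e (\<omega> e)\<bar> > 3 * sqrt (p * N * l)}"
  proof safe
    fix \<omega> assume *: "\<bar>p_hat n \<omega> - p\<bar> > 6 * sqrt (p * l) / real n"
    have "(\<Sum>e\<in>?U. f e (\<omega> e)) = real (card {e \<in> ?U. snd (\<omega> e)}) - p * N"
      using finite_upper_pairs
      by (simp add: f_def sum_subtractf card_upper_pairs N_def mult.commute of_bool_def flip: sum.inter_filter)
    also have "\<dots> = N * (p_hat n \<omega> - p)"
      using N by (simp add: p_hat_def N_def[symmetric] field_simps)
    finally have eq: "\<bar>\<Sum>e\<in>?U. f e (\<omega> e)\<bar> = N * \<bar>p_hat n \<omega> - p\<bar>" using N by (simp add: abs_mult)
    have "real n / 2 \<le> sqrt N" using N4 by (intro real_le_rsqrt) (simp add: power_divide)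
    then have "sqrt N * (real n / 2) \<le> sqrt N * sqrt N" using N by (intro mult_left_mono) auto
    moreover have "sqrt N * sqrt N = N" using N by simp
    ultimately have "sqrt N * real n \<le> 2 * N" by linarith
    then have "3 * sqrt (p * l) * (sqrt N * real n) \<le> 3 * sqrt (p * l) * (2 * N)"
      using p0 l by (intro mult_left_mono) auto
    then have "3 * sqrt (p * N * l) \<le> N * (6 * sqrt (p * l) / real n)"
      using n by (simp add: real_sqrt_mult field_simps)
    also have "\<dots> < N * \<bar>p_hat n \<omega> - p\<bar>" using * N by (rule mult_strict_left_mono)
    finally show "3 * sqrt (p * N * l) < \<bar>\<Sum>e\<in>?U. f e (\<omega> e)\<bar>" by (simp add: eq)
  qed
  then have "measure_pmf.prob ?q {\<omega>. \<bar>p_hat n \<omega> - p\<bar> > 6 * sqrt (p * l) / real n}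
      \<le> measure_pmf.prob ?q {\<omega>. \<bar>\<Sum>e\<in>?U. f e (\<omega> e)\<bar> > 3 * sqrt (p * N * l)}"
    by (intro measure_pmf.finite_measure_mono) auto
  also have "\<dots> \<le> 2 * exp (l - c * (3 * sqrt (p * N * l)))"
    using mgf[of c] mgf[of "- c"] c by (intro prob_abs_exp_tail finite_set_sample_pmf) auto
  also have "\<dots> = 2 * exp (- 2 * l)"
    using prod_sqrt_div[of l "p * N"] l p0 N by (simp add: c_def)
  also have "\<dots> = 2 / (real n)\<^sup>2"
    using n by (simp add: l_def exp_minus exp_double inverse_eq_divide)
  also have "\<dots> \<le> 2 / real n" using n by (simp add: power2_eq_square field_simps)
  finally show ?thesis by (simp add: l_def)
qed

text \<open>The maximum separates two regimes. While p s is below log n, the tilt sits at its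
  admissible maximum 1/2 and the tail is of exponential type; for larger s the variance of order p
  s^2 takes over and the tail is Gaussian.\<close>

lemma prob_submatrix_noise:
  assumes n: "n \<ge> 2" and s: "s \<ge> 1"
  shows "measure_pmf.prob (sample_pmf n p \<theta>)
      {\<omega>. \<exists>R T. R \<subseteq> {1..n} \<and> card R \<le> s \<and> T \<subseteq> {1..n} \<and> card T \<le> s \<and>
        \<bar>\<Sum>i\<in>R. \<Sum>j\<in>T. noise \<omega> i j\<bar>
          > real s * (12 * sqrt (max (ln (real n)) (p * real s) * ln (real n)))}
    \<le> 18 / real n ^ 3"
proof -
  define l where "l = ln (real n)"
  define M where "M = max l (p * real s)"
  define u where "u = real s * (12 * sqrt (M * l))"
  define c where "c = sqrt (l / M) / 2"
  let ?q = "sample_pmf n p \<theta>" and ?S = "{R. R \<subseteq> {1..n} \<and> card R \<le> s}"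
  have l: "l > 0" using n by (simp add: l_def)
  have M: "M > 0" "l \<le> M" "p * real s \<le> M" using l by (auto simp: M_def)
  have c: "0 < c" "c \<le> 1 / 2" using l M by (simp_all add: c_def)
  have c2: "c\<^sup>2 = l / M / 4" using l M by (simp add: c_def power_divide)
  have cu: "c * u = 6 * real s * l"
  proof -
    have "c * u = 6 * real s * (sqrt (l / M) * sqrt (M * l))" by (simp add: c_def u_def)
    then show ?thesis using prod_sqrt_div[of l M] l M by simp
  qed
  have S: "finite ?S" by (rule finite_subset[of _ "Pow {1..n}"]) auto
  have one: "measure_pmf.prob ?q {\<omega>. \<bar>\<Sum>i\<in>fst z. \<Sum>j\<in>snd z. noise \<omega> i j\<bar> > u} \<le> 2 * exp (- (5 * real s * l))"
    if z: "z \<in> ?S \<times> ?S" for z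
  proof -
    define R where "R = fst z"
    define T where "T = snd z"
    have RT: "R \<subseteq> {1..n}" "T \<subseteq> {1..n}" "card R \<le> s" "card T \<le> s" using z by (auto simp: R_def T_def)
    have mgf: "measure_pmf.expectation ?q (\<lambda>\<omega>. exp (d * (\<Sum>i\<in>R. \<Sum>j\<in>T. noise \<omega> i j))) \<le> exp (real s * l / 8)"
      if d: "\<bar>d\<bar> = c" for d
    proof -
      have restrict: "(\<Sum>i\<in>{1..n}. \<Sum>j\<in>{1..n}. if i \<in> R \<and> j \<in> T then g i j else 0) = (\<Sum>i\<in>R. \<Sum>j\<in>T. g i j)"
        for g :: "nat \<Rightarrow> nat \<Rightarrow> real"
      proof -
        have "(\<Sum>i\<in>{1..n}. \<Sum>j\<in>{1..n}. if i \<in> R \<and> j \<in> T then g i j else 0)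
          = (\<Sum>i\<in>{1..n}. if i \<in> R then \<Sum>j\<in>{1..n}. if j \<in> T then g i j else 0 else 0)"
          by (intro sum.cong) auto
        also have "\<dots> = (\<Sum>i\<in>{1..n} \<inter> R. \<Sum>j\<in>{1..n} \<inter> T. g i j)"
          by (simp only: sum.inter_restrict[OF finite_atLeastAtMost])
        finally show ?thesis using RT by (simp add: Int_absorb1)
      qed
      have d2: "d\<^sup>2 = c\<^sup>2" using d by (metis power2_abs)
      define A where "A i j = (if i \<in> R \<and> j \<in> T then d else 0)" for i j
      have "(\<Sum>i\<in>{1..n}. \<Sum>j\<in>{1..n}. noise \<omega> i j * A i j)
          = (\<Sum>i\<in>{1..n}. \<Sum>j\<in>{1..n}. if i \<in> R \<and> j \<in> T then d * noise \<omega> i j else 0)" for \<omega>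
        by (intro sum.cong) (auto simp: A_def)
      then have lin: "(\<Sum>i\<in>{1..n}. \<Sum>j\<in>{1..n}. noise \<omega> i j * A i j) = d * (\<Sum>i\<in>R. \<Sum>j\<in>T. noise \<omega> i j)" for \<omega>
        by (simp only: restrict sum_distrib_left)
      have "(\<Sum>i\<in>{1..n}. \<Sum>j\<in>{1..n}. (A i j)\<^sup>2)
          = (\<Sum>i\<in>{1..n}. \<Sum>j\<in>{1..n}. if i \<in> R \<and> j \<in> T then c\<^sup>2 else 0)"
        by (intro sum.cong) (auto simp: A_def d2)
      also have "\<dots> = (\<Sum>i\<in>R. \<Sum>j\<in>T. c\<^sup>2)" by (rule restrict)
      also have "\<dots> = real (card R) * real (card T) * c\<^sup>2" by simp
      finally have sq: "(\<Sum>i\<in>{1..n}. \<Sum>j\<in>{1..n}. (A i j)\<^sup>2) = real (card R) * real (card T) * c\<^sup>2" .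
      have "measure_pmf.expectation ?q (\<lambda>\<omega>. exp (d * (\<Sum>i\<in>R. \<Sum>j\<in>T. noise \<omega> i j)))
          \<le> exp (p / 2 * (real (card R) * real (card T) * c\<^sup>2))"
        using expectation_exp_noise_le'[of A] c d unfolding lin sq by (simp add: A_def)
      also have "p / 2 * (real (card R) * real (card T) * c\<^sup>2) \<le> p / 2 * (real s * real s * c\<^sup>2)"
        using RT p by (intro mult_left_mono mult_right_mono mult_mono) auto
      also have "\<dots> = real s * l / 8 * (p * real s / M)" by (simp add: c2)
      also have "\<dots> \<le> real s * l / 8 * 1" using M l by (intro mult_left_mono) auto
      finally show ?thesis by simp
    qed
    have "measure_pmf.prob ?q {\<omega>. \<bar>\<Sum>i\<in>R. \<Sum>j\<in>T. noise \<omega> i j\<bar> > u} \<le> 2 * exp (real s * l / 8 - c * u)"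
      using mgf[of c] mgf[of "- c"] c by (intro prob_abs_exp_tail finite_set_sample_pmf) auto
    also have "\<dots> \<le> 2 * exp (- (5 * real s * l))" using l by (simp add: cu)
    finally show ?thesis by (simp add: R_def T_def)
  qed
  have "measure_pmf.prob ?q (\<Union>z\<in>?S \<times> ?S. {\<omega>. \<bar>\<Sum>i\<in>fst z. \<Sum>j\<in>snd z. noise \<omega> i j\<bar> > u})
      \<le> (\<Sum>z\<in>?S \<times> ?S. 2 * exp (- (5 * real s * l)))"
    using one S by (intro prob_UN_le) auto
  also have "\<dots> = real (card ?S) * real (card ?S) * (2 * exp (- (5 * real s * l)))" by simp
  also have "\<dots> \<le> (3 * real n ^ s) * (3 * real n ^ s) * (2 * exp (- (5 * real s * l)))"
    using card_small_subsets_le[of n s] n by (intro mult_right_mono mult_mono) auto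
  \<comment> \<open>The choices of the row set and of the column set use up 2 s log n of the
    exponent 5 s log n.\<close>
  also have "\<dots> = 18 * exp (- (3 * real s * l))"
  proof -
    have "real n ^ s = exp (real s * l)" using n by (simp add: l_def exp_of_nat_mult)
    then show ?thesis by (simp flip: exp_add)
  qed
  also have "\<dots> \<le> 18 * exp (- (3 * l))" using s l by simp
  also have "\<dots> = 18 / real n ^ 3"
    using n by (simp add: l_def exp_minus inverse_eq_divide exp_of_nat_mult[of 3, simplified])
  finally have "measure_pmf.prob ?q (\<Union>z\<in>?S \<times> ?S. {\<omega>. \<bar>\<Sum>i\<in>fst z. \<Sum>j\<in>snd z. noise \<omega> i j\<bar> > u}) \<le> 18 / real n ^ 3" .
  also have "(\<Union>z\<in>?S \<times> ?S. {\<omega>. \<bar>\<Sum>i\<in>fst z. \<Sum>j\<in>snd z. noise \<omega> i j\<bar> > u})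
    = {\<omega>. \<exists>R T. R \<subseteq> {1..n} \<and> card R \<le> s \<and> T \<subseteq> {1..n} \<and> card T \<le> s \<and>
        \<bar>\<Sum>i\<in>R. \<Sum>j\<in>T. noise \<omega> i j\<bar> > u}"
    by (intro set_eqI) (simp add: Bex_def conj_assoc)
  finally show ?thesis by (simp only: u_def M_def l_def)
qed

end

section \<open>Block sums of the permuted noise and their exponential weights\<close>

context observation
begin

definition permuted_noise :: "sample \<Rightarrow> (nat \<Rightarrow> nat) \<Rightarrow> nat \<times> nat \<Rightarrow> real" where
  "permuted_noise \<omega> \<sigma> e = noise \<omega> (\<sigma> (fst e)) (\<sigma> (snd e))"

text \<open>For n < 2^L the indices 1..n sit inside, with padding at 0 and above n where the noise
  vanishes. Every dyadic block then has the full side 2^k.\<close>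

definition dyadic_square :: "nat \<Rightarrow> (nat \<times> nat) set" where
  "dyadic_square L = {..<2 ^ L} \<times> {..<2 ^ L}"

definition block_noise :: "sample \<Rightarrow> (nat \<Rightarrow> nat) \<Rightarrow> nat \<Rightarrow> nat \<Rightarrow> nat \<times> nat \<Rightarrow> real" where
  "block_noise \<omega> \<sigma> L k b =
    (\<Sum>e\<in>{e\<in>dyadic_square L. dyadic_block k e = b}. permuted_noise \<omega> \<sigma> e) / 2 ^ k"

text \<open>Possible rounded values of a block sum. The upper end keeps the tilt v / (24 p 2^k) of a
  single entry at most 1/2; the lower end makes each nonzero value so expensive that summing over
  all of them is harmless. Integers suffice because rounding costs only a constant factor, and there
  are only O(n) of them.\<close>

definition weights :: "nat \<Rightarrow> real set" where
  "weights k = {v \<in> \<int>. v = 0 \<or> 12 * ln (real n) \<le> \<bar>v\<bar> \<and> \<bar>v\<bar> \<le> 12 * p * 2 ^ k}"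

text \<open>
  Multiplied out, this is a sum over all assignments of a rounded value to every block, and one of the
  summands matches the actual block sums. As its expectation is bounded, Markov's inequality leaves enough
  room for the union over the permutations.
\<close>

definition block_weight_prod :: "sample \<Rightarrow> (nat \<Rightarrow> nat) \<Rightarrow> nat \<Rightarrow> nat \<Rightarrow> real" where
  "block_weight_prod \<omega> \<sigma> L k = (\<Prod>b\<in>dyadic_block k ` dyadic_square L.
     \<Sum>v\<in>weights k. exp (v * block_noise \<omega> \<sigma> L k b / (24 * p) - v\<^sup>2 / (48 * p)))"

lemma finite_dyadic_square: "finite (dyadic_square L)"
  by (simp add: dyadic_square_def)

lemma permuted_noise_outside:
  assumes "\<sigma> permutes {1..n}" "e \<notin> {1..n} \<times> {1..n}"
  shows "permuted_noise \<omega> \<sigma> e = 0"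
  unfolding permuted_noise_def
  using assms permutes_in_image[OF assms(1)] by (intro noise_outside) (auto simp: mem_Times_iff)

lemma sum_dyadic_square_eq:
  assumes "n < 2 ^ L" "\<And>e. e \<notin> {1..n} \<times> {1..n} \<Longrightarrow> g e = 0"
  shows "(\<Sum>e\<in>dyadic_square L. g e) = (\<Sum>i\<in>{1..n}. \<Sum>j\<in>{1..n}. g (i, j))"
proof -
  have "(\<Sum>e\<in>dyadic_square L. g e) = (\<Sum>e\<in>{1..n} \<times> {1..n}. g e)"
    using assms by (intro sum.mono_neutral_right) (auto simp: dyadic_square_def)
  then show ?thesis by (simp add: sum.cartesian_product)
qed

text \<open>For a fixed \<sigma> the permutation can be moved to the test matrix as
  \<open>inv \<sigma>\<close>; the bound depends only on the sum of squares, which relabelling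
  preserves.\<close>

lemma expectation_exp_permuted_noise_le:
  assumes L: "n < 2 ^ L" and \<sigma>: "\<sigma> permutes {1..n}"
    and a: "\<And>e. e \<in> dyadic_square L \<Longrightarrow> \<bar>a e\<bar> \<le> 1 / 2"
  shows "measure_pmf.expectation (sample_pmf n p \<theta>)
      (\<lambda>\<omega>. exp (\<Sum>e\<in>dyadic_square L. permuted_noise \<omega> \<sigma> e * a e))
    \<le> exp (p / 2 * (\<Sum>e\<in>dyadic_square L. (a e)\<^sup>2))"
proof -
  define A where "A i j = a (inv \<sigma> i, inv \<sigma> j)" for i j
  have inv: "inv \<sigma> (\<sigma> i) = i" for i using permutes_inverses(2)[OF \<sigma>] .
  have perm: "(\<Sum>i\<in>{1..n}. \<Sum>j\<in>{1..n}. g i j) = (\<Sum>i\<in>{1..n}. \<Sum>j\<in>{1..n}. g (\<sigma> i) (\<sigma> j))"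
    for g :: "nat \<Rightarrow> nat \<Rightarrow> real"
    by (subst sum.permute[OF \<sigma>], subst (2) sum.permute[OF \<sigma>]) (simp add: o_def)
  have lin: "(\<Sum>e\<in>dyadic_square L. permuted_noise \<omega> \<sigma> e * a e)
      = (\<Sum>i\<in>{1..n}. \<Sum>j\<in>{1..n}. noise \<omega> i j * A i j)" for \<omega>
  proof -
    have "(\<Sum>e\<in>dyadic_square L. permuted_noise \<omega> \<sigma> e * a e)
        = (\<Sum>i\<in>{1..n}. \<Sum>j\<in>{1..n}. permuted_noise \<omega> \<sigma> (i, j) * a (i, j))"
      by (rule sum_dyadic_square_eq[OF L]) (rule mult_eq_0_iff[THEN iffD2, OF disjI1], rule permuted_noise_outside[OF \<sigma>])
    also have "\<dots> = (\<Sum>i\<in>{1..n}. \<Sum>j\<in>{1..n}. noise \<omega> (\<sigma> i) (\<sigma> j) * A (\<sigma> i) (\<sigma> j))"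
      by (simp add: permuted_noise_def A_def inv)
    also have "\<dots> = (\<Sum>i\<in>{1..n}. \<Sum>j\<in>{1..n}. noise \<omega> i j * A i j)"
      by (rule perm[symmetric])
    finally show ?thesis .
  qed
  have "(\<Sum>i\<in>{1..n}. \<Sum>j\<in>{1..n}. (A i j)\<^sup>2) = (\<Sum>i\<in>{1..n}. \<Sum>j\<in>{1..n}. (a (i, j))\<^sup>2)"
    by (subst perm) (simp add: A_def inv)
  also have "\<dots> = (\<Sum>e\<in>{1..n} \<times> {1..n}. (a e)\<^sup>2)" by (simp add: sum.cartesian_product)
  also have "\<dots> \<le> (\<Sum>e\<in>dyadic_square L. (a e)\<^sup>2)"
    using L by (intro sum_mono2) (auto simp: dyadic_square_def)
  finally have sq: "(\<Sum>i\<in>{1..n}. \<Sum>j\<in>{1..n}. (A i j)\<^sup>2) \<le> (\<Sum>e\<in>dyadic_square L. (a e)\<^sup>2)" .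
  have "measure_pmf.expectation (sample_pmf n p \<theta>)
      (\<lambda>\<omega>. exp (\<Sum>e\<in>dyadic_square L. permuted_noise \<omega> \<sigma> e * a e))
      \<le> exp (p / 2 * (\<Sum>i\<in>{1..n}. \<Sum>j\<in>{1..n}. (A i j)\<^sup>2))"
    unfolding lin
  proof (rule expectation_exp_noise_le')
    fix i j assume "i \<in> {1..n}" "j \<in> {1..n}"
    then have "inv \<sigma> i \<in> {1..n}" "inv \<sigma> j \<in> {1..n}"
      using permutes_in_image[OF permutes_inv[OF \<sigma>]] by blast+
    then show "\<bar>A i j\<bar> \<le> 1 / 2" unfolding A_def using L by (intro a) (auto simp: dyadic_square_def)
  qed
  also have "\<dots> \<le> exp (p / 2 * (\<Sum>e\<in>dyadic_square L. (a e)\<^sup>2))"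
    using sq p by (simp add: mult_left_mono)
  finally show ?thesis .
qed

lemma weights_bounds:
  assumes k: "2 ^ k \<le> 2 * real n" and n: "n \<ge> 1"
  shows "finite (weights k)" "real (card (weights k)) \<le> 49 * real n"
proof -
  have "weights k \<subseteq> of_int ` {- int (24 * n)..int (24 * n)}"
  proof
    fix v assume v: "v \<in> weights k"
    then obtain z where z: "v = of_int z" by (auto simp: weights_def elim: Ints_cases)
    have "\<bar>v\<bar> \<le> 24 * real n"
    proof (cases "v = 0")
      case False
      then have "\<bar>v\<bar> \<le> 12 * (p * 2 ^ k)" using v by (simp add: weights_def)
      also have "\<dots> \<le> 12 * (1 * (2 * real n))"
        using p k by (intro mult_left_mono mult_mono) auto
      finally show ?thesis by simp
    qed simp
    then have "\<bar>z\<bar> \<le> int (24 * n)" unfolding z by linarith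
    then show "v \<in> of_int ` {- int (24 * n)..int (24 * n)}"
      using z by (intro image_eqI[of _ _ z]) auto
  qed
  then show "finite (weights k)" by (rule finite_subset) simp
  have "card (weights k) \<le> card (of_int ` {- int (24 * n)..int (24 * n)} :: real set)"
    using \<open>weights k \<subseteq> _\<close> by (intro card_mono) auto
  also have "\<dots> \<le> card {- int (24 * n)..int (24 * n)}" by (rule card_image_le) simp
  also have "\<dots> \<le> 49 * n" using n by simp
  finally show "real (card (weights k)) \<le> 49 * real n" by (simp flip: of_nat_le_iff)
qed

lemma ln_ge_2: "2 \<le> ln (real n)" if "n \<ge> 9"
proof -
  have "exp (2 :: real) = exp 1 * exp 1" by (simp flip: exp_add)
  also have "\<dots> \<le> 3 * 3" using exp_le by (intro mult_mono) auto
  finally have "exp 2 \<le> real n" using that by simp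
  then show ?thesis using that by (subst ln_ge_iff) auto
qed

text \<open>Multiplying out gives one exponential of a linear functional of the noise per assignment
  \<open>g\<close> of values to blocks, so the exponential moment bound applies to all blocks
  jointly. The resulting bounds factor over the blocks again, and each factor is 1 + O(n^(-4)),
  against O(n^2) blocks.\<close>

lemma expectation_block_weight_prod_le:
  assumes n: "n \<ge> 14" and p0: "p > 0" and L: "n < 2 ^ L" "2 ^ L \<le> 2 * n" and k: "k \<le> L"
    and \<sigma>: "\<sigma> permutes {1..n}"
  shows "measure_pmf.expectation (sample_pmf n p \<theta>) (\<lambda>\<omega>. block_weight_prod \<omega> \<sigma> L k) \<le> 3"
proof -
  let ?q = "sample_pmf n p \<theta>" and ?W = "dyadic_square L" and ?V = "weights k"
  let ?B = "dyadic_block k ` ?W"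
  let ?cls = "\<lambda>b. {e\<in>?W. dyadic_block k e = b}"
  define l where "l = ln (real n)"
  have l: "l \<ge> 2" using ln_ge_2 n by (simp add: l_def)
  have int: "integrable (measure_pmf ?q) f" for f :: "sample \<Rightarrow> real"
    by (rule integrable_measure_pmf_finite[OF finite_set_sample_pmf])
  have "(2::nat) ^ k \<le> 2 ^ L" using k by (intro power_increasing) auto
  then have k2: "(2::nat) ^ k \<le> 2 * n" using L by linarith
  then have k2': "2 ^ k \<le> 2 * real n" by (metis of_nat_le_iff of_nat_mult of_nat_numeral of_nat_power)
  have V': "finite ?V" "real (card ?V) \<le> 49 * real n" using weights_bounds[OF k2'] n by auto
  have B: "finite ?B" using finite_dyadic_square by simp
  have mgf: "measure_pmf.expectation ?q
      (\<lambda>\<omega>. exp (\<Sum>b\<in>?B. g b * block_noise \<omega> \<sigma> L k b / (24 * p) - (g b)\<^sup>2 / (48 * p)))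
    \<le> (\<Prod>b\<in>?B. exp (- (23 / 1152 * (g b)\<^sup>2 / p)))" if g: "g \<in> PiE ?B (\<lambda>_. ?V)" for g
  proof -
    define a where "a e = g (dyadic_block k e) / (24 * p * 2 ^ k)" for e
    have a: "\<bar>a e\<bar> \<le> 1 / 2" if "e \<in> ?W" for e
    proof -
      have "\<bar>g (dyadic_block k e)\<bar> \<le> 12 * p * 2 ^ k"
        using PiE_mem[OF g, of "dyadic_block k e"] that p0 by (auto simp: weights_def)
      then show ?thesis using p0 by (simp add: a_def abs_divide abs_mult field_simps)
    qed
    have lin: "(\<Sum>b\<in>?B. g b * block_noise \<omega> \<sigma> L k b / (24 * p)) = (\<Sum>e\<in>?W. permuted_noise \<omega> \<sigma> e * a e)" for \<omega>
    proof -
      have "(\<Sum>e\<in>?W. permuted_noise \<omega> \<sigma> e * a e) = (\<Sum>b\<in>?B. \<Sum>e\<in>?cls b. permuted_noise \<omega> \<sigma> e * a e)"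
        by (rule sum.image_gen[OF finite_dyadic_square])
      also have "\<dots> = (\<Sum>b\<in>?B. g b * block_noise \<omega> \<sigma> L k b / (24 * p))"
      proof (rule sum.cong[OF refl])
        fix b
        have "(\<Sum>e\<in>?cls b. permuted_noise \<omega> \<sigma> e * a e)
            = (\<Sum>e\<in>?cls b. permuted_noise \<omega> \<sigma> e) * (g b / (24 * p * 2 ^ k))"
          by (subst sum_distrib_right) (auto simp: a_def intro: sum.cong)
        then show "(\<Sum>e\<in>?cls b. permuted_noise \<omega> \<sigma> e * a e) = g b * block_noise \<omega> \<sigma> L k b / (24 * p)"
          by (simp add: block_noise_def mult_ac)
      qed
      finally show ?thesis by simp
    qed
    have sq: "(\<Sum>e\<in>?W. (a e)\<^sup>2) = (\<Sum>b\<in>?B. (g b)\<^sup>2) / (576 * p\<^sup>2)"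
    proof -
      have "(\<Sum>e\<in>?W. (a e)\<^sup>2) = (\<Sum>b\<in>?B. \<Sum>e\<in>?cls b. (a e)\<^sup>2)"
        by (rule sum.image_gen[OF finite_dyadic_square])
      also have "\<dots> = (\<Sum>b\<in>?B. (g b)\<^sup>2 / (576 * p\<^sup>2))"
      proof (rule sum.cong[OF refl])
        fix b assume b: "b \<in> ?B"
        have "(\<Sum>e\<in>?cls b. (a e)\<^sup>2) = (\<Sum>e\<in>?cls b. (g b / (24 * p * 2 ^ k))\<^sup>2)"
          by (intro sum.cong) (auto simp: a_def)
        also have "\<dots> = (2 ^ k)\<^sup>2 * (g b / (24 * p * 2 ^ k))\<^sup>2"
          using card_dyadic_block[OF k, of b] b by (simp add: dyadic_square_def)
        finally show "(\<Sum>e\<in>?cls b. (a e)\<^sup>2) = (g b)\<^sup>2 / (576 * p\<^sup>2)"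
          using p0 by (simp add: power_divide power_mult_distrib)
      qed
      finally show ?thesis by (simp add: sum_divide_distrib)
    qed
    have "measure_pmf.expectation ?q
        (\<lambda>\<omega>. exp (\<Sum>b\<in>?B. g b * block_noise \<omega> \<sigma> L k b / (24 * p) - (g b)\<^sup>2 / (48 * p)))
      = measure_pmf.expectation ?q (\<lambda>\<omega>. exp (\<Sum>e\<in>?W. permuted_noise \<omega> \<sigma> e * a e)
          * exp (- (\<Sum>b\<in>?B. (g b)\<^sup>2 / (48 * p))))"
      by (simp add: sum_subtractf lin flip: exp_add)
    also have "\<dots> \<le> exp (p / 2 * ((\<Sum>b\<in>?B. (g b)\<^sup>2) / (576 * p\<^sup>2))) * exp (- (\<Sum>b\<in>?B. (g b)\<^sup>2 / (48 * p)))"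
      using expectation_exp_permuted_noise_le[OF L(1) \<sigma>, of a] a by (simp add: sq)
    \<comment> \<open>The variance term is the sum of g^2 / (1152 p), since 1152 = 2 * 24^2, while
      the subtracted penalty is 24/1152 of the sum of g^2 / p. The net coefficient is
      -23/1152.\<close>
    also have "\<dots> = exp (- (23 / 1152 * (\<Sum>b\<in>?B. (g b)\<^sup>2) / p))"
      using p0 by (simp add: power2_eq_square field_simps flip: exp_add sum_divide_distrib)
    also have "\<dots> = (\<Prod>b\<in>?B. exp (- (23 / 1152 * (g b)\<^sup>2 / p)))"
      using B by (simp add: sum_negf sum_divide_distrib sum_distrib_left flip: exp_sum)
    finally show ?thesis .
  qed
  have "measure_pmf.expectation ?q (\<lambda>\<omega>. block_weight_prod \<omega> \<sigma> L k)
      = measure_pmf.expectation ?q (\<lambda>\<omega>. \<Sum>g\<in>PiE ?B (\<lambda>_. ?V).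
          exp (\<Sum>b\<in>?B. g b * block_noise \<omega> \<sigma> L k b / (24 * p) - (g b)\<^sup>2 / (48 * p)))"
    unfolding block_weight_prod_def using B V' by (simp add: prod_sum_PiE exp_sum)
  also have "\<dots> = (\<Sum>g\<in>PiE ?B (\<lambda>_. ?V). measure_pmf.expectation ?q (\<lambda>\<omega>.
          exp (\<Sum>b\<in>?B. g b * block_noise \<omega> \<sigma> L k b / (24 * p) - (g b)\<^sup>2 / (48 * p))))"
    by (rule Bochner_Integration.integral_sum) (rule int)
  also have "\<dots> \<le> (\<Sum>g\<in>PiE ?B (\<lambda>_. ?V). \<Prod>b\<in>?B. exp (- (23 / 1152 * (g b)\<^sup>2 / p)))"
    by (rule sum_mono) (rule mgf)
  also have "\<dots> = (\<Prod>b\<in>?B. \<Sum>v\<in>?V. exp (- (23 / 1152 * v\<^sup>2 / p)))"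
    by (rule prod_sum_PiE[symmetric]) (use B V' in auto)
  also have "\<dots> \<le> (\<Prod>b\<in>?B. exp (49 / real n ^ 4))"
  proof (rule prod_mono, intro conjI)
    fix b
    show "0 \<le> (\<Sum>v\<in>?V. exp (- (23 / 1152 * v\<^sup>2 / p)))" by (simp add: sum_nonneg)
    have "(\<Sum>v\<in>?V. exp (- (23 / 1152 * v\<^sup>2 / p))) \<le> (\<Sum>v\<in>insert 0 ?V. exp (- (23 / 1152 * v\<^sup>2 / p)))"
      using V' by (intro sum_mono2) auto
    also have "\<dots> = 1 + (\<Sum>v\<in>?V - {0}. exp (- (23 / 1152 * v\<^sup>2 / p)))"
      using V' by (subst sum.insert_remove) auto
    also have "(\<Sum>v\<in>?V - {0}. exp (- (23 / 1152 * v\<^sup>2 / p))) \<le> (\<Sum>v\<in>?V - {0}. exp (- (5 * l)))"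
    proof (rule sum_mono)
      fix v assume "v \<in> ?V - {0}"
      then have "12 * l \<le> \<bar>v\<bar>" by (auto simp: weights_def l_def)
      then have "(12 * l)\<^sup>2 \<le> \<bar>v\<bar>\<^sup>2" using l by (intro power_mono) auto
      then have "144 * l\<^sup>2 \<le> v\<^sup>2" by (simp add: power_mult_distrib)
      also have "v\<^sup>2 \<le> v\<^sup>2 / p" using p p0 by (simp add: le_divide_eq mult_left_le)
      finally have "144 * l\<^sup>2 \<le> v\<^sup>2 / p" .
      moreover have "2 * l \<le> l\<^sup>2" using l by (simp add: power2_eq_square)
      \<comment> \<open>The lower end 12 log n of the nonzero weights is used here: 144 l^2 is at
        least 288 l, and 23/1152 * 288 = 23/4 exceeds 5.\<close>
      ultimately have "5 * l \<le> 23 / 1152 * (v\<^sup>2 / p)" using l by linarith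
      then show "exp (- (23 / 1152 * v\<^sup>2 / p)) \<le> exp (- (5 * l))" by simp
    qed
    also have "\<dots> \<le> 49 * real n * exp (- (5 * l))"
    proof -
      have "real (card (?V - {0})) \<le> 49 * real n"
        using V' card_mono[of ?V "?V - {0}"] by (simp add: order.trans[OF _ V'(2)])
      then show ?thesis by simp
    qed
    also have "\<dots> = 49 / real n ^ 4"
    proof -
      have "exp (5 * l) = real n ^ 5" using n by (simp add: l_def exp_of_nat_mult[of 5, simplified])
      then show ?thesis using n by (simp add: exp_minus inverse_eq_divide field_simps eval_nat_numeral)
    qed
    finally show "(\<Sum>v\<in>?V. exp (- (23 / 1152 * v\<^sup>2 / p))) \<le> exp (49 / real n ^ 4)"
      using exp_ge_add_one_self[of "49 / real n ^ 4"] by linarith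
  qed
  also have "\<dots> = exp (49 / real n ^ 4 * real (card ?B))"
    by (simp only: prod_constant exp_of_nat_mult[symmetric] mult.commute)
  also have "\<dots> \<le> exp 1"
  proof -
    have "card ?B \<le> card ?W" by (rule card_image_le[OF finite_dyadic_square])
    also have "\<dots> = 2 ^ L * 2 ^ L" by (simp add: dyadic_square_def)
    also have "\<dots> \<le> (2 * n) * (2 * n)" using L by (intro mult_mono) auto
    finally have "real (card ?B) \<le> 4 * (real n)\<^sup>2"
      by (simp add: power2_eq_square flip: of_nat_mult)
    then have "49 / real n ^ 4 * real (card ?B) \<le> 49 / real n ^ 4 * (4 * (real n)\<^sup>2)"
      by (intro mult_left_mono) auto
    also have "\<dots> = 196 / (real n)\<^sup>2" using n by (simp add: field_simps eval_nat_numeral)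
    \<comment> \<open>The origin of the requirement n >= 14: 49 * 4 = 196 = 14^2.\<close>
    also have "\<dots> \<le> 1"
      using n power_mono[of 14 "real n" 2] by (simp add: divide_le_eq)
    finally show ?thesis by simp
  qed
  also have "\<dots> \<le> 3" by (rule exp_le)
  finally show ?thesis .
qed

text \<open>Of the level n^(n+3) in Markov's inequality, n^n pays for the n! permutations and n^3 is
  left as decay.\<close>

lemma prob_block_weight_prod:
  assumes n: "n \<ge> 14" and p0: "p > 0" and L: "n < 2 ^ L" "2 ^ L \<le> 2 * n" and k: "k \<le> L"
  shows "measure_pmf.prob (sample_pmf n p \<theta>)
    {\<omega>. \<exists>\<sigma>. \<sigma> permutes {1..n} \<and> block_weight_prod \<omega> \<sigma> L k > real n ^ (n + 3)} \<le> 3 / real n ^ 3"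
proof -
  let ?q = "sample_pmf n p \<theta>" and ?P = "{\<sigma>. \<sigma> permutes {1..n}}"
  have nonneg: "0 \<le> block_weight_prod \<omega> \<sigma> L k" for \<omega> \<sigma>
    by (auto simp: block_weight_prod_def intro!: prod_nonneg sum_nonneg)
  have one: "measure_pmf.prob ?q {\<omega>. block_weight_prod \<omega> \<sigma> L k > real n ^ (n + 3)} \<le> 3 / real n ^ (n + 3)"
    if "\<sigma> \<in> ?P" for \<sigma>
  proof -
    have "measure_pmf.prob ?q {\<omega>. block_weight_prod \<omega> \<sigma> L k > real n ^ (n + 3)}
        \<le> measure_pmf.expectation ?q (\<lambda>\<omega>. block_weight_prod \<omega> \<sigma> L k / real n ^ (n + 3))"
      using nonneg n by (intro prob_le_expectation finite_set_sample_pmf) (auto simp: le_divide_eq)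
    also have "\<dots> \<le> 3 / real n ^ (n + 3)"
      using expectation_block_weight_prod_le[OF assms] that by (simp add: divide_right_mono)
    finally show ?thesis .
  qed
  have "measure_pmf.prob ?q (\<Union>\<sigma>\<in>?P. {\<omega>. block_weight_prod \<omega> \<sigma> L k > real n ^ (n + 3)})
      \<le> (\<Sum>\<sigma>\<in>?P. 3 / real n ^ (n + 3))"
    using one by (intro prob_UN_le finite_permutations) auto
  also have "\<dots> = real (fact n) * (3 / real n ^ (n + 3))"
    using card_permutations[of "{1..n}" n] by simp
  also have "\<dots> \<le> real n ^ n * (3 / real n ^ (n + 3))"
    using fact_le_power[of n, where 'a=real] by (intro mult_right_mono) simp_all
  also have "\<dots> = 3 / real n ^ 3" using n by (simp add: power_add)
  also have "(\<Union>\<sigma>\<in>?P. {\<omega>. block_weight_prod \<omega> \<sigma> L k > real n ^ (n + 3)})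
      = {\<omega>. \<exists>\<sigma>. \<sigma> permutes {1..n} \<and> block_weight_prod \<omega> \<sigma> L k > real n ^ (n + 3)}"
    by blast
  finally show ?thesis .
qed

end

section \<open>The noise against differences of ordered matrices, uniformly in the permutation\<close>

lemma sum_Un_le:
  fixes t :: "'a \<Rightarrow> real"
  assumes "finite A" "finite B" "\<And>x. 0 \<le> t x"
  shows "sum t (A \<union> B) \<le> sum t A + sum t B"
  using sum.union_inter[OF assms(1,2), of t] sum_nonneg[of "A \<inter> B" t] assms(3) by simp

text \<open>Six unit contributions: the four increments at which the function enters the range,
  reaches \<open>i\<close>, leaves \<open>i\<close> and leaves the range, and the two monotone
  stretches on either side of \<open>i\<close>. In the applications \<open>i\<close> is the diagonal
  position, where the zero breaks monotonicity.\<close>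

lemma total_variation_monotone_off_point:
  fixes f :: "nat \<Rightarrow> real" and c :: real
  assumes bounds: "\<And>x. 0 \<le> f x \<and> f x \<le> 1" and outside: "\<And>x. x \<notin> {1..n} \<Longrightarrow> f x = 0"
    and i: "i \<in> {1..n}" and c: "\<bar>c\<bar> = 1"
    and mono: "\<And>j k. j \<in> {1..n} \<Longrightarrow> k \<in> {1..n} \<Longrightarrow> i \<noteq> j \<Longrightarrow> i \<noteq> k \<Longrightarrow> j < k \<Longrightarrow> c * f j \<le> c * f k"
  shows "total_variation N f \<le> 6"
proof -
  define t where "t l = \<bar>f (Suc l) - f l\<bar>" for l
  have t: "0 \<le> t l" "t l \<le> 1" for l
    using bounds[of l] bounds[of "Suc l"] by (auto simp: t_def)
  have seg: "sum t {a..<b} \<le> 1" if "{a..b} \<subseteq> {1..n} - {i}" for a b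
  proof (cases "a \<le> b")
    case True
    have "t l = c * f (Suc l) - c * f l" if l: "l \<in> {a..<b}" for l
    proof -
      have "l \<in> {1..n} - {i}" "Suc l \<in> {1..n} - {i}" using subsetD[OF \<open>{a..b} \<subseteq> _\<close>, of l] subsetD[OF \<open>{a..b} \<subseteq> _\<close>, of "Suc l"] l by auto
      then have "0 \<le> c * (f (Suc l) - f l)" using mono[of l "Suc l"] by (simp add: right_diff_distrib)
      then have "c * (f (Suc l) - f l) = \<bar>c\<bar> * t l" unfolding t_def by (simp flip: abs_mult)
      then show ?thesis using c by (simp add: right_diff_distrib)
    qed
    then have "sum t {a..<b} = (\<Sum>l\<in>{a..<b}. c * f (Suc l) - c * f l)" by (intro sum.cong) auto
    also have "\<dots> = c * f b - c * f a" by (rule sum_Suc_diff'[OF True])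
    also have "\<dots> \<le> \<bar>c\<bar> * \<bar>f b - f a\<bar>" by (simp flip: abs_mult right_diff_distrib)
    also have "\<dots> \<le> 1" using c bounds[of a] bounds[of b] by auto
    finally show ?thesis .
  qed simp
  \<comment> \<open>An increment is indexed by its left end, so index 0 is the step from 0 to 1 and
    index n the step from n to n + 1.\<close>
  let ?S = "{0, i - 1, i, n}"
  have "total_variation N f = sum t {..<N}" by (simp add: total_variation_def t_def)
  also have "\<dots> \<le> sum t ({..<N} \<union> {..n})" using t by (intro sum_mono2) auto
  also have "\<dots> = sum t {..n}"
    using outside by (intro sum.mono_neutral_right) (auto simp: t_def)
  also have "\<dots> \<le> sum t (?S \<union> ({1..<i - 1} \<union> {i + 1..<n}))"
    using t i by (intro sum_mono2) auto
  also have "\<dots> \<le> sum t ?S + sum t ({1..<i - 1} \<union> {i + 1..<n})" using t by (intro sum_Un_le) auto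
  also have "\<dots> \<le> sum t ?S + (sum t {1..<i - 1} + sum t {i + 1..<n})"
    using t by (intro add_left_mono sum_Un_le) auto
  also have "\<dots> \<le> 4 + (1 + 1)"
  proof (intro add_mono)
    have "sum t ?S \<le> (\<Sum>l\<in>?S. 1)" using t by (intro sum_mono) auto
    also have "\<dots> \<le> 4" by (simp add: card_insert_if)
    finally show "sum t ?S \<le> 4" .
    show "sum t {1..<i - 1} \<le> 1"
    proof (cases "i = 1")
      case False
      then show ?thesis using i by (intro seg) auto
    qed simp
    show "sum t {i + 1..<n} \<le> 1" using i by (intro seg) auto
  qed
  finally show ?thesis by simp
qed

lemma total_variation_ordered_mats:
  assumes A: "A \<in> ordered_mats m n"
  shows "total_variation N (\<lambda>j. A i j) \<le> 6" "total_variation N (\<lambda>j. A j i) \<le> 6"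
proof -
  note bounds = ordered_mats_bounds[OF A] and outside = ordered_mats_outside[OF A]
  have "total_variation N (\<lambda>j. A i j) \<le> 6 \<and> total_variation N (\<lambda>j. A j i) \<le> 6"
  proof (cases "i \<in> {1..n}")
    case True
    show ?thesis
    proof
      show "total_variation N (\<lambda>j. A i j) \<le> 6"
      proof (rule total_variation_monotone_off_point[OF _ _ True abs_reflection_sign(1)])
        show "reflection_sign m * A i j \<le> reflection_sign m * A i k"
          if "j \<in> {1..n}" "k \<in> {1..n}" "i \<noteq> j" "i \<noteq> k" "j < k" for j k
          using ordered_mats_row_mono[OF A True that] .
      qed (use bounds outside in blast)+
      show "total_variation N (\<lambda>j. A j i) \<le> 6"
      proof (rule total_variation_monotone_off_point[OF _ _ True, of _ 1])
        show "1 * A j i \<le> 1 * A k i"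
          if "j \<in> {1..n}" "k \<in> {1..n}" "i \<noteq> j" "i \<noteq> k" "j < k" for j k
          using ordered_mats_col_mono[OF A True that] by simp
      qed (use bounds outside in auto)
    qed
  next
    case False
    then show ?thesis using outside by (simp add: total_variation_def)
  qed
  then show "total_variation N (\<lambda>j. A i j) \<le> 6" "total_variation N (\<lambda>j. A j i) \<le> 6" by auto
qed

lemma total_variation_diff_le:
  "total_variation N (\<lambda>j. f j - g j) \<le> total_variation N f + total_variation N g"
  unfolding total_variation_def sum.distrib[symmetric] by (intro sum_mono) linarith

section \<open>Large block sums for all permutations at once\<close>

context observation
begin

text \<open>
  This only counts rows and columns of the submatrix, so for a small block it is stronger than a union
  bound over all permutations. It keeps the exponential tilts of the large blocks in the admissible range.
\<close>

definition small_submatrices :: "sample \<Rightarrow> nat \<Rightarrow> bool" where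
  "small_submatrices \<omega> s \<longleftrightarrow> (\<forall>R T. R \<subseteq> {1..n} \<and> card R \<le> s \<and> T \<subseteq> {1..n} \<and> card T \<le> s \<longrightarrow>
     \<bar>\<Sum>i\<in>R. \<Sum>j\<in>T. noise \<omega> i j\<bar> \<le> real s * (12 * sqrt (max (ln (real n)) (p * real s) * ln (real n))))"

text \<open>Within the range 1..n a dyadic block is a product of two index sets of at most 2^k
  elements, and \<sigma> carries these to sets of rows and columns of the same sizes. One event on
  submatrices therefore covers every permutation.\<close>

lemma abs_block_noise_le:
  assumes E1: "small_submatrices \<omega> (2 ^ k)" and \<sigma>: "\<sigma> permutes {1..n}"
    and L: "n < 2 ^ L"
  shows "\<bar>block_noise \<omega> \<sigma> L k b\<bar> \<le> 12 * sqrt (max (ln (real n)) (p * 2 ^ k) * ln (real n))"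
proof -
  define s :: nat where "s = 2 ^ k"
  have s: "s > 0" by (simp add: s_def)
  obtain a c where b: "b = (a, c)" by fastforce
  define I where "I x = {i \<in> {1..n}. i div s = x}" for x
  have card_I: "card (I x) \<le> s" for x
  proof -
    have "x * s \<le> i \<and> i < x * s + s" if "i div s = x" for i
      using div_mult_mod_eq[of i s] mod_less_divisor[OF s, of i] that by auto
    then have "I x \<subseteq> {x * s..<x * s + s}" by (auto simp: I_def)
    then show ?thesis using card_mono[of "{x * s..<x * s + s}" "I x"] by simp
  qed
  have image: "\<sigma> ` I x \<subseteq> {1..n}" "card (\<sigma> ` I x) \<le> s" for x
  proof -
    show "\<sigma> ` I x \<subseteq> {1..n}" using permutes_image[OF \<sigma>] by (auto simp: I_def)
    show "card (\<sigma> ` I x) \<le> s" by (rule order.trans[OF card_image_le card_I]) (simp add: I_def)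
  qed
  have "(\<Sum>e\<in>{e\<in>dyadic_square L. dyadic_block k e = b}. permuted_noise \<omega> \<sigma> e)
      = (\<Sum>e\<in>I a \<times> I c. permuted_noise \<omega> \<sigma> e)"
  proof (rule sum.mono_neutral_right)
    show "I a \<times> I c \<subseteq> {e\<in>dyadic_square L. dyadic_block k e = b}"
      using L by (auto simp: I_def dyadic_square_def dyadic_block_def b s_def)
    show "\<forall>e\<in>{e\<in>dyadic_square L. dyadic_block k e = b} - I a \<times> I c. permuted_noise \<omega> \<sigma> e = 0"
    proof
      fix e assume e: "e \<in> {e\<in>dyadic_square L. dyadic_block k e = b} - I a \<times> I c"
      then have "e \<notin> {1..n} \<times> {1..n}"
        by (cases e) (auto simp: I_def dyadic_block_def b s_def)
      then show "permuted_noise \<omega> \<sigma> e = 0" by (rule permuted_noise_outside[OF \<sigma>])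
    qed
  qed (simp add: finite_dyadic_square)
  also have "\<dots> = (\<Sum>i\<in>I a. \<Sum>j\<in>I c. noise \<omega> (\<sigma> i) (\<sigma> j))"
    by (simp add: sum.cartesian_product permuted_noise_def case_prod_unfold)
  also have "\<dots> = (\<Sum>i\<in>\<sigma> ` I a. \<Sum>j\<in>\<sigma> ` I c. noise \<omega> i j)"
    using permutes_inj_on[OF \<sigma>] by (simp add: sum.reindex)
  finally have eq: "\<bar>block_noise \<omega> \<sigma> L k b\<bar> = \<bar>\<Sum>i\<in>\<sigma> ` I a. \<Sum>j\<in>\<sigma> ` I c. noise \<omega> i j\<bar> / s"
    by (simp add: block_noise_def abs_divide s_def)
  have "\<bar>\<Sum>i\<in>\<sigma> ` I a. \<Sum>j\<in>\<sigma> ` I c. noise \<omega> i j\<bar>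
      \<le> real s * (12 * sqrt (max (ln (real n)) (p * real s) * ln (real n)))"
    using E1 image[of a] image[of c] unfolding small_submatrices_def s_def[symmetric] by blast
  then show ?thesis unfolding eq using s by (simp add: divide_le_eq mult.commute s_def)
qed

text \<open>The summand of the multiplied-out product that assigns to each large block its rounded
  sum, and 0 to all others, is alone at least exp of the sum of v^2 / (48 p). The bound on the whole
  product thus bounds this sum by (n + 3) log n.\<close>

lemma sum_large_block_noise_le:
  assumes n: "n \<ge> 14" and p0: "p > 0" and L: "n < 2 ^ L" "2 ^ L \<le> 2 * n" and k: "k \<le> L"
    and \<sigma>: "\<sigma> permutes {1..n}"
    and E1: "small_submatrices \<omega> (2 ^ k)"
    and E2: "block_weight_prod \<omega> \<sigma> L k \<le> real n ^ (n + 3)"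
  shows "(\<Sum>b\<in>{b\<in>dyadic_block k ` dyadic_square L. \<bar>block_noise \<omega> \<sigma> L k b\<bar> > 12 * ln (real n) + 1}.
      (block_noise \<omega> \<sigma> L k b)\<^sup>2) \<le> 384 * p * real n * ln (real n)"
proof -
  define l where "l = ln (real n)"
  define B where "B = dyadic_block k ` dyadic_square L"
  define x where "x b = block_noise \<omega> \<sigma> L k b" for b
  define big where "big b \<longleftrightarrow> \<bar>x b\<bar> > 12 * l + 1" for b
  \<comment> \<open>Rounding towards zero keeps v^2 <= v x. The extra 1 in the threshold for large
    blocks ensures that the rounded value is still at least 12 log n.\<close>
  define v where "v b = (if big b then sgn (x b) * of_int \<lfloor>\<bar>x b\<bar>\<rfloor> else 0)" for b
  have l: "l \<ge> 2" using ln_ge_2 n by (simp add: l_def)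
  have B: "finite B" by (simp add: B_def finite_dyadic_square)
  have "(2::nat) ^ k \<le> 2 ^ L" using k by (intro power_increasing) auto
  then have k2: "(2::nat) ^ k \<le> 2 * n" using L by linarith
  then have k2': "2 ^ k \<le> 2 * real n" by (metis of_nat_le_iff of_nat_mult of_nat_numeral of_nat_power)
  have V: "finite (weights k)" using weights_bounds[OF k2'] n by simp
  have floor: "12 * l \<le> of_int \<lfloor>\<bar>x b\<bar>\<rfloor>" "of_int \<lfloor>\<bar>x b\<bar>\<rfloor> \<le> \<bar>x b\<bar>" "\<bar>x b\<bar> \<le> 2 * of_int \<lfloor>\<bar>x b\<bar>\<rfloor>"
    if "big b" for b
    using that l by (auto simp: big_def) linarith+
  have absv: "\<bar>v b\<bar> = of_int \<lfloor>\<bar>x b\<bar>\<rfloor>" if "big b" for b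
    using that floor(1)[OF that] l by (auto simp: v_def abs_mult big_def sgn_if)
  have vx: "v b * x b = \<bar>v b\<bar> * \<bar>x b\<bar>" if "big b" for b
    using absv[OF that] that by (simp add: v_def) (simp add: sgn_if)
  have mem: "v b \<in> weights k" for b
  proof (cases "big b")
    case True
    have "\<bar>x b\<bar> \<le> 12 * sqrt (max l (p * 2 ^ k) * l)"
      unfolding x_def l_def by (rule abs_block_noise_le[OF E1 \<sigma> L(1)])
    moreover have "sqrt (max l (p * 2 ^ k) * l) \<le> max l (p * 2 ^ k)"
    proof (rule real_le_lsqrt)
      show "max l (p * 2 ^ k) * l \<le> (max l (p * 2 ^ k))\<^sup>2"
        unfolding power2_eq_square using l by (intro mult_left_mono) auto
    qed (use l in auto)
    ultimately have "\<bar>x b\<bar> \<le> 12 * max l (p * 2 ^ k)" by linarith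
    \<comment> \<open>A large block exceeds 12 log n, so the maximum must be p 2^k. This puts the
      rounded value below the upper end of \<open>weights\<close>.\<close>
    then have "\<bar>x b\<bar> \<le> 12 * p * 2 ^ k" using True l by (auto simp: big_def max_def split: if_splits)
    then have "\<bar>v b\<bar> \<le> 12 * p * 2 ^ k" using absv[OF True] floor(2)[OF True] by linarith
    moreover have "12 * l \<le> \<bar>v b\<bar>" using absv[OF True] floor(1)[OF True] by simp
    moreover have "v b \<in> \<int>" using True by (auto simp: v_def sgn_if)
    ultimately show ?thesis by (simp add: weights_def l_def)
  qed (simp add: v_def weights_def)
  have "exp (\<Sum>b\<in>B. (v b)\<^sup>2 / (48 * p)) = (\<Prod>b\<in>B. exp ((v b)\<^sup>2 / (48 * p)))"
    by (simp add: exp_sum B)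
  also have "\<dots> \<le> (\<Prod>b\<in>B. \<Sum>w\<in>weights k. exp (w * x b / (24 * p) - w\<^sup>2 / (48 * p)))"
  proof (rule prod_mono, intro conjI)
    fix b
    have "(v b)\<^sup>2 \<le> v b * x b"
    proof (cases "big b")
      case True
      have "(v b)\<^sup>2 = \<bar>v b\<bar> * \<bar>v b\<bar>" by (simp add: power2_eq_square)
      also have "\<dots> \<le> \<bar>v b\<bar> * \<bar>x b\<bar>"
        using absv[OF True] floor(2)[OF True] by (intro mult_left_mono) auto
      finally show ?thesis using vx[OF True] by simp
    qed (simp add: v_def)
    then have "(v b)\<^sup>2 / (24 * p) \<le> v b * x b / (24 * p)" using p0 by (intro divide_right_mono) auto
    \<comment> \<open>Since v x is at least v^2, half of the linear term pays for the penalty and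
      the other half remains.\<close>
    moreover have "(v b)\<^sup>2 / (24 * p) = (v b)\<^sup>2 / (48 * p) + (v b)\<^sup>2 / (48 * p)" using p0 by (simp add: field_simps)
    ultimately have "exp ((v b)\<^sup>2 / (48 * p)) \<le> exp (v b * x b / (24 * p) - (v b)\<^sup>2 / (48 * p))"
      unfolding exp_le_cancel_iff by linarith
    also have "\<dots> \<le> (\<Sum>w\<in>weights k. exp (w * x b / (24 * p) - w\<^sup>2 / (48 * p)))"
      using member_le_sum[OF mem[of b], of "\<lambda>w. exp (w * x b / (24 * p) - w\<^sup>2 / (48 * p))"] V by simp
    finally show "exp ((v b)\<^sup>2 / (48 * p)) \<le> (\<Sum>w\<in>weights k. exp (w * x b / (24 * p) - w\<^sup>2 / (48 * p)))" .
  qed simp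
  also have "\<dots> \<le> real n ^ (n + 3)"
    using E2 by (simp add: block_weight_prod_def B_def x_def)
  also have "\<dots> = exp (real (n + 3) * l)" using n by (simp add: l_def exp_of_nat_mult del: of_nat_add)
  finally have "(\<Sum>b\<in>B. (v b)\<^sup>2 / (48 * p)) \<le> real (n + 3) * l" by simp
  then have sumv: "(\<Sum>b\<in>B. (v b)\<^sup>2) \<le> 48 * p * (real (n + 3) * l)"
    using p0 by (simp add: divide_le_eq mult.commute flip: sum_divide_distrib)
  have "(\<Sum>b\<in>{b\<in>B. big b}. (x b)\<^sup>2) \<le> (\<Sum>b\<in>{b\<in>B. big b}. 4 * (v b)\<^sup>2)"
  proof (rule sum_mono)
    fix b assume "b \<in> {b\<in>B. big b}"
    then have "\<bar>x b\<bar> \<le> 2 * \<bar>v b\<bar>" using floor(3)[of b] absv[of b] by auto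
    then have "\<bar>x b\<bar>\<^sup>2 \<le> (2 * \<bar>v b\<bar>)\<^sup>2" by (intro power_mono) auto
    then show "(x b)\<^sup>2 \<le> 4 * (v b)\<^sup>2" by (simp add: power_mult_distrib)
  qed
  also have "\<dots> \<le> (\<Sum>b\<in>B. 4 * (v b)\<^sup>2)" using B by (intro sum_mono2) auto
  also have "\<dots> \<le> 4 * (48 * p * (real (n + 3) * l))" unfolding sum_distrib_left[symmetric] using sumv by linarith
  \<comment> \<open>The constant 384 is 4 * 48 * 2: the factor 4 from undoing the rounding, 48 from
    the penalty, 2 from n + 3 <= 2 n.\<close>
  also have "\<dots> \<le> 4 * (48 * p * (real (2 * n) * l))"
    using n l p0 by (intro mult_left_mono mult_right_mono) auto
  finally show ?thesis by (simp add: B_def big_def x_def l_def mult_ac)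
qed

text \<open>\<open>B\<close> is any ordered matrix and may depend on the sample, so the estimate
  applies to the projection itself. Each of the two ordered matrices has row and column variation at
  most 6, whence V = 12 and the coefficient 72.\<close>

theorem abs_permuted_noise_inner_le:
  assumes n: "n \<ge> 14" and p0: "p > 0" and L: "n < 2 ^ L" "2 ^ L \<le> 2 * n"
    and \<sigma>: "\<sigma> permutes {1..n}" and B: "B \<in> ordered_mats m n"
    and E1: "\<And>k. k \<le> L \<Longrightarrow> small_submatrices \<omega> (2 ^ k)"
    and E2: "\<And>k. k \<le> L \<Longrightarrow> block_weight_prod \<omega> \<sigma> L k \<le> real n ^ (n + 3)"
  shows "\<bar>\<Sum>i\<in>{1..n}. \<Sum>j\<in>{1..n}. noise \<omega> (\<sigma> i) (\<sigma> j) * (B i j - \<theta>0 i j)\<bar>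
    \<le> (12 * ln (real n) + 1) * 2 ^ L * (72 * real L + 1)
      + sqrt (384 * p * real n * ln (real n) * real (L + 1))
        * sqrt (\<Sum>i\<in>{1..n}. \<Sum>j\<in>{1..n}. (B i j - \<theta>0 i j)\<^sup>2)"
proof -
  define D where "D e = B (fst e) (snd e) - \<theta>0 (fst e) (snd e)" for e
  have D0: "D e = 0" if "e \<notin> {1..n} \<times> {1..n}" for e
    using ordered_mats_outside[OF B] \<theta>0_outside that by (cases e) (auto simp: D_def)
  have "\<bar>\<Sum>e\<in>dyadic_square L. permuted_noise \<omega> \<sigma> e * D e\<bar>
    \<le> (12 * ln (real n) + 1) * 2 ^ L * (6 * 12 * real L + 1)
      + sqrt (384 * p * real n * ln (real n) * real (L + 1)) * sqrt (\<Sum>e\<in>dyadic_square L. (D e)\<^sup>2)"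
    unfolding dyadic_square_def
  proof (rule multiscale_bound)
    show "total_variation (2 ^ L) (\<lambda>j. D (i, j)) \<le> 12" for i
      unfolding D_def fst_conv snd_conv
      using total_variation_diff_le[of "2 ^ L" "\<lambda>j. B i j" "\<lambda>j. \<theta>0 i j"]
        total_variation_ordered_mats(1)[OF B, of "2 ^ L" i] total_variation_ordered_mats(1)[OF \<theta>0, of "2 ^ L" i]
      by linarith
    show "total_variation (2 ^ L) (\<lambda>i. D (i, j)) \<le> 12" for j
      unfolding D_def fst_conv snd_conv
      using total_variation_diff_le[of "2 ^ L" "\<lambda>i. B i j" "\<lambda>i. \<theta>0 i j"]
        total_variation_ordered_mats(2)[OF B, of "2 ^ L" j] total_variation_ordered_mats(2)[OF \<theta>0, of "2 ^ L" j]
      by linarith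
    show "\<bar>D e\<bar> \<le> 1" for e
      using ordered_mats_bounds[OF B, of "fst e" "snd e"] \<theta>0_bounds[of "fst e" "snd e"] by (simp add: D_def abs_le_iff)
    show "0 \<le> 12 * ln (real n) + 1" using n by simp
    show "(\<Sum>b\<in>{b\<in>dyadic_block k ` ({..<2 ^ L} \<times> {..<2 ^ L}).
          12 * ln (real n) + 1 < \<bar>(\<Sum>e\<in>{e\<in>{..<2 ^ L} \<times> {..<2 ^ L}. dyadic_block k e = b}. permuted_noise \<omega> \<sigma> e) / 2 ^ k\<bar>}.
        ((\<Sum>e\<in>{e\<in>{..<2 ^ L} \<times> {..<2 ^ L}. dyadic_block k e = b}. permuted_noise \<omega> \<sigma> e) / 2 ^ k)\<^sup>2)
      \<le> 384 * p * real n * ln (real n)" if "k \<le> L" for k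
      using sum_large_block_noise_le[OF n p0 L that \<sigma> E1[OF that] E2[OF that]]
      by (simp only: block_noise_def dyadic_square_def)
  qed
  moreover have "(\<Sum>e\<in>dyadic_square L. permuted_noise \<omega> \<sigma> e * D e)
      = (\<Sum>i\<in>{1..n}. \<Sum>j\<in>{1..n}. noise \<omega> (\<sigma> i) (\<sigma> j) * (B i j - \<theta>0 i j))"
    using D0 by (subst sum_dyadic_square_eq[OF L(1)]) (simp_all add: permuted_noise_def D_def)
  moreover have "(\<Sum>e\<in>dyadic_square L. (D e)\<^sup>2) = (\<Sum>i\<in>{1..n}. \<Sum>j\<in>{1..n}. (B i j - \<theta>0 i j)\<^sup>2)"
    using D0 by (subst sum_dyadic_square_eq[OF L(1)]) (simp_all add: D_def)
  ultimately show ?thesis by simp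
qed

end

section \<open>The projection\<close>

lemma frob_norm_square: "(frob_norm n A)\<^sup>2 = (\<Sum>i\<in>{1..n}. \<Sum>j\<in>{1..n}. (A i j)\<^sup>2)"
  by (simp add: frob_norm_def sum_nonneg)

lemma frob_norm_nonneg: "0 \<le> frob_norm n A"
  by (simp add: frob_norm_def sum_nonneg)

lemma abs_frob_inner_le:
  "\<bar>\<Sum>i\<in>{1..n}. \<Sum>j\<in>{1..n}. A i j * B i j\<bar> \<le> frob_norm n A * frob_norm n B"
proof -
  let ?S = "{1..n} \<times> {1..n}"
  have norm: "frob_norm n M = L2_set (\<lambda>(i, j). M i j) ?S" for M :: matrix
    by (simp add: frob_norm_def L2_set_def sum.cartesian_product case_prod_unfold)
  have "\<bar>\<Sum>i\<in>{1..n}. \<Sum>j\<in>{1..n}. A i j * B i j\<bar> = \<bar>\<Sum>(i, j)\<in>?S. A i j * B i j\<bar>"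
    by (simp add: sum.cartesian_product)
  also have "\<dots> \<le> (\<Sum>e\<in>?S. \<bar>(case e of (i, j) \<Rightarrow> A i j)\<bar> * \<bar>(case e of (i, j) \<Rightarrow> B i j)\<bar>)"
    by (rule order.trans[OF sum_abs]) (simp add: abs_mult case_prod_unfold)
  also have "\<dots> \<le> frob_norm n A * frob_norm n B"
    unfolding norm by (rule L2_set_mult_ineq)
  finally show ?thesis .
qed

lemma frob_norm_eq_sqrt:
  "frob_norm n (\<lambda>i j. A i j - B i j) = sqrt (\<Sum>i\<in>{1..n}. \<Sum>j\<in>{1..n}. (A i j - B i j)\<^sup>2)"
  by (simp add: frob_norm_def)

text \<open>The choice made by \<open>ARG_MIN\<close> is meaningful once a minimiser exists. By the
  parallelogram identity a minimising sequence in a convex set is Cauchy entry by entry, and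
  closedness puts its limit into the set.\<close>

lemma is_arg_min_frob_proj:
  fixes S :: "matrix set"
  assumes ne: "S \<noteq> {}" and outside: "\<And>B i j. B \<in> S \<Longrightarrow> i \<notin> {1..n} \<or> j \<notin> {1..n} \<Longrightarrow> B i j = 0"
    and convex: "\<And>B C t. B \<in> S \<Longrightarrow> C \<in> S \<Longrightarrow> 0 \<le> t \<Longrightarrow> t \<le> 1 \<Longrightarrow> (\<lambda>i j. (1 - t) * B i j + t * C i j) \<in> S"
    and closed: "\<And>f g. (\<And>k. f k \<in> S) \<Longrightarrow> (\<And>i j. (\<lambda>k. f k i j) \<longlonglongrightarrow> g i j) \<Longrightarrow> g \<in> S"
  shows "is_arg_min (\<lambda>B. frob_norm n (\<lambda>i j. A i j - B i j)) (\<lambda>B. B \<in> S) (frob_proj n S A)"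
proof -
  define q where "q B = (\<Sum>i\<in>{1..n}. \<Sum>j\<in>{1..n}. (A i j - B i j)\<^sup>2)" for B :: matrix
  define \<delta> where "\<delta> = Inf (q ` S)"
  have bdd: "bdd_below (q ` S)" by (rule bdd_belowI[of _ 0]) (auto simp: q_def sum_nonneg)
  have \<delta>: "\<delta> \<le> q B" if "B \<in> S" for B unfolding \<delta>_def using bdd that by (intro cInf_lower) auto
  have "\<exists>B\<in>S. q B < \<delta> + 1 / real (Suc k)" for k
    using cInf_lessD[of "q ` S" "\<delta> + 1 / real (Suc k)"] ne by (auto simp: \<delta>_def)
  then obtain f where f: "\<And>k. f k \<in> S" "\<And>k. q (f k) < \<delta> + 1 / real (Suc k)" by metis
  have parallelogram: "(\<Sum>i\<in>{1..n}. \<Sum>j\<in>{1..n}. (B i j - C i j)\<^sup>2) \<le> 2 * (q B - \<delta>) + 2 * (q C - \<delta>)"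
    if "B \<in> S" "C \<in> S" for B C
  proof -
    define M where "M i j = (1 - 1 / 2) * B i j + 1 / 2 * C i j" for i j
    have "M \<in> S" unfolding M_def using convex[OF that, of "1 / 2"] by simp
    then have "\<delta> \<le> q M" by (rule \<delta>)
    then have "2 * q B + 2 * q C - 4 * q M \<le> 2 * (q B - \<delta>) + 2 * (q C - \<delta>)" by simp
    moreover have "(\<Sum>i\<in>{1..n}. \<Sum>j\<in>{1..n}. (B i j - C i j)\<^sup>2) = 2 * q B + 2 * q C - 4 * q M"
    proof -
      have "(B i j - C i j)\<^sup>2 = 2 * (A i j - B i j)\<^sup>2 + 2 * (A i j - C i j)\<^sup>2 - 4 * (A i j - M i j)\<^sup>2" for i j
        by (simp add: M_def power2_eq_square field_simps)
      then show ?thesis by (simp add: q_def sum.distrib sum_subtractf sum_distrib_left)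
    qed
    ultimately show ?thesis by (simp only:)
  qed
  have fk: "q (f k) - \<delta> < 1 / real (Suc k)" for k
    using f(2)[of k] by (simp add: diff_less_eq add.commute)
  have "Cauchy (\<lambda>k. f k i j)" for i j
  proof (cases "i \<in> {1..n} \<and> j \<in> {1..n}")
    case True
    show ?thesis
    proof (rule metric_CauchyI)
      fix e :: real assume e: "e > 0"
      obtain M where M: "4 / e\<^sup>2 < real M" using reals_Archimedean2 by blast
      have "dist (f k i j) (f l i j) < e" if kl: "k \<ge> M" "l \<ge> M" for k l
      proof -
        have "(f k i j - f l i j)\<^sup>2 \<le> (\<Sum>j\<in>{1..n}. (f k i j - f l i j)\<^sup>2)"
          using True by (intro member_le_sum) auto
        also have "\<dots> \<le> (\<Sum>i\<in>{1..n}. \<Sum>j\<in>{1..n}. (f k i j - f l i j)\<^sup>2)"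
          using True by (intro member_le_sum[of i _ "\<lambda>i. \<Sum>j\<in>{1..n}. (f k i j - f l i j)\<^sup>2"]) (auto simp: sum_nonneg)
        also have "\<dots> \<le> 2 * (q (f k) - \<delta>) + 2 * (q (f l) - \<delta>)" by (rule parallelogram) (rule f)+
        also have "\<dots> < 2 * (1 / real (Suc k)) + 2 * (1 / real (Suc l))"
          by (intro add_strict_mono mult_strict_left_mono fk) auto
        also have "\<dots> \<le> 2 * (1 / real (Suc M)) + 2 * (1 / real (Suc M))"
          using kl by (intro add_mono mult_left_mono divide_left_mono) auto
        also have "\<dots> < e\<^sup>2"
        proof -
          have "4 < e\<^sup>2 * real (Suc M)"
          proof -
            have "4 < real M * e\<^sup>2" using M e by (simp add: divide_less_eq)
            also have "\<dots> \<le> real (Suc M) * e\<^sup>2" by (intro mult_right_mono) auto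
            finally show ?thesis by (simp only: mult.commute)
          qed
          then show ?thesis by (simp add: divide_less_eq)
        qed
        finally have "\<bar>f k i j - f l i j\<bar>\<^sup>2 < e\<^sup>2" by (simp only: power2_abs)
        then have "\<bar>f k i j - f l i j\<bar> < e" using e by (rule power2_less_imp_less[OF _ less_imp_le])
        then show ?thesis by (simp add: dist_real_def)
      qed
      then show "\<exists>M. \<forall>k\<ge>M. \<forall>l\<ge>M. dist (f k i j) (f l i j) < e" by blast
    qed
  next
    case False
    \<comment> \<open>The norm does not see these entries; they converge because all members of the
      set vanish there.\<close>
    then have "f k i j = 0" for k using outside[OF f(1)] by blast
    then show ?thesis by (simp add: convergent_Cauchy convergent_const)
  qed
  then have "\<exists>x. (\<lambda>k. f k i j) \<longlonglongrightarrow> x" for i j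
    using Cauchy_convergent convergent_def by blast
  then obtain g where g: "\<And>i j. (\<lambda>k. f k i j) \<longlonglongrightarrow> g i j" by metis
  have gS: "g \<in> S" using closed[OF f(1) g] .
  have "(\<lambda>k. q (f k)) \<longlonglongrightarrow> q g"
    unfolding q_def by (intro tendsto_intros g)
  moreover have "(\<lambda>k. \<delta> + 1 / real (Suc k)) \<longlonglongrightarrow> \<delta> + 0"
    by (intro tendsto_intros LIMSEQ_Suc[OF lim_1_over_n])
  ultimately have "q g \<le> \<delta> + 0"
    using f(2) by (intro LIMSEQ_le) (auto intro: less_imp_le)
  then have "is_arg_min (\<lambda>B. frob_norm n (\<lambda>i j. A i j - B i j)) (\<lambda>B. B \<in> S) g"
    using \<delta> gS unfolding is_arg_min_def frob_norm_eq_sqrt by (force simp: q_def not_less)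
  then show ?thesis unfolding frob_proj_def arg_min_def
    by (rule someI[of "is_arg_min (\<lambda>B. frob_norm n (\<lambda>i j. A i j - B i j)) (\<lambda>B. B \<in> S)"])
qed

text \<open>First-order optimality along the segment towards \<open>B\<close>: a positive inner
  product would make a short step decrease the distance.\<close>

lemma arg_min_variational:
  fixes S :: "matrix set"
  assumes P: "is_arg_min (\<lambda>B. frob_norm n (\<lambda>i j. A i j - B i j)) (\<lambda>B. B \<in> S) P" and B: "B \<in> S"
    and convex: "\<And>B C t. B \<in> S \<Longrightarrow> C \<in> S \<Longrightarrow> 0 \<le> t \<Longrightarrow> t \<le> 1 \<Longrightarrow> (\<lambda>i j. (1 - t) * B i j + t * C i j) \<in> S"
  shows "(\<Sum>i\<in>{1..n}. \<Sum>j\<in>{1..n}. (A i j - P i j) * (B i j - P i j)) \<le> 0"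
proof (rule ccontr)
  define c where "c = (\<Sum>i\<in>{1..n}. \<Sum>j\<in>{1..n}. (A i j - P i j) * (B i j - P i j))"
  define d where "d = (\<Sum>i\<in>{1..n}. \<Sum>j\<in>{1..n}. (B i j - P i j)\<^sup>2)"
  assume "\<not> c \<le> 0"
  then have c: "c > 0" by simp
  have d: "d \<ge> 0" by (simp add: d_def sum_nonneg)
  \<comment> \<open>The step must satisfy t d < 2 c; the denominator d + 1 also covers d =
    0.\<close>
  define t where "t = min 1 (c / (d + 1))"
  have t: "0 < t" "t \<le> 1" using c d by (auto simp: t_def)
  have PS: "P \<in> S" using P by (simp add: is_arg_min_def)
  define M where "M i j = (1 - t) * P i j + t * B i j" for i j
  have "M \<in> S" unfolding M_def using convex[OF PS B, of t] t by simp
  then have "(\<Sum>i\<in>{1..n}. \<Sum>j\<in>{1..n}. (A i j - P i j)\<^sup>2) \<le> (\<Sum>i\<in>{1..n}. \<Sum>j\<in>{1..n}. (A i j - M i j)\<^sup>2)"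
    using P by (auto simp: is_arg_min_def frob_norm_eq_sqrt not_less)
  also have "\<dots> = (\<Sum>i\<in>{1..n}. \<Sum>j\<in>{1..n}. (A i j - P i j)\<^sup>2) - 2 * t * c + t\<^sup>2 * d"
  proof -
    have "(A i j - M i j)\<^sup>2 = (A i j - P i j)\<^sup>2 - 2 * t * ((A i j - P i j) * (B i j - P i j)) + t\<^sup>2 * (B i j - P i j)\<^sup>2" for i j
      by (simp add: M_def power2_eq_square algebra_simps)
    then show ?thesis by (simp add: c_def d_def sum.distrib sum_subtractf sum_distrib_left)
  qed
  finally have "2 * c * t \<le> t * d * t" by (simp add: power2_eq_square mult_ac)
  then have "2 * c \<le> t * d" using t by (simp add: mult.commute)
  also have "\<dots> \<le> c / (d + 1) * d" using d by (intro mult_right_mono) (auto simp: t_def)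
  also have "\<dots> \<le> c" using c d by (simp add: divide_le_eq mult_left_mono)
  finally show False using c by simp
qed

text \<open>A description common to both models in which every condition is a linear equation or a
  weak linear inequality, so convexity and closedness need only one proof each. In the tournament
  case \<open>upper\<close> and the reflection together give the bound 1/2 above the
  diagonal.\<close>

lemma ordered_matsI:
  assumes bounds: "\<And>i j. 0 \<le> A i j \<and> A i j \<le> 1"
    and outside: "\<And>i j. i \<notin> {1..n} \<or> j \<notin> {1..n} \<Longrightarrow> A i j = 0"
    and diag: "\<And>i. A i i = 0"
    and reflect: "\<And>i j. A j i - Jmat n j i / 2 = reflection_sign m * (A i j - Jmat n i j / 2)"
    and row_mono: "\<And>i j k. i \<in> {1..n} \<Longrightarrow> j \<in> {1..n} \<Longrightarrow> k \<in> {1..n} \<Longrightarrow> i \<noteq> j \<Longrightarrow> i \<noteq> k \<Longrightarrow> j < k \<Longrightarrow>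
      reflection_sign m * A i j \<le> reflection_sign m * A i k"
    and upper: "\<And>i j. i \<in> {1..n} \<Longrightarrow> j \<in> {1..n} \<Longrightarrow> i < j \<Longrightarrow> A i j \<le> A j i"
  shows "A \<in> ordered_mats m n"
proof -
  have mats: "A \<in> mats01 n" unfolding mats01_def using bounds outside by blast
  show ?thesis
  proof (cases m)
    case Tournament
    have sym: "A j i = 1 - A i j" if "i \<in> {1..n}" "j \<in> {1..n}" "i \<noteq> j" for i j
      using reflect[of j i] that by (simp add: Tournament Jmat_def reflection_sign_def)
    have mono: "A i j \<le> A i k"
      if "i \<in> {1..n}" "j \<in> {1..n}" "k \<in> {1..n}" "i \<noteq> k" "i \<noteq> j" "k < j" for i j k
      using row_mono[of i k j] that by (simp add: Tournament reflection_sign_def)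
    have half: "A i j \<le> 1 / 2" if "i \<in> {1..n}" "j \<in> {1..n}" "i < j" for i j
      using upper[OF that] sym[of i j] that by simp
    have "A \<in> tournament_mats n"
      unfolding tournament_mats_def mem_Collect_eq
      by (intro conjI ballI impI mats diag) (erule conjE | assumption | rule sym mono half)+
    then show ?thesis by (simp add: Tournament ordered_mats_def)
  next
    case Graph
    have sym: "A j i = A i j" if "i \<in> {1..n}" "j \<in> {1..n}" "i \<noteq> j" for i j
      using reflect[of j i] that by (simp add: Graph Jmat_def reflection_sign_def)
    have mono: "A i j \<le> A i k"
      if "i \<in> {1..n}" "j \<in> {1..n}" "k \<in> {1..n}" "i \<noteq> k" "i \<noteq> j" "j < k" for i j k
      using row_mono[of i j k] that by (simp add: Graph reflection_sign_def)
    have "A \<in> graph_mats n"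
      unfolding graph_mats_def mem_Collect_eq
      by (intro conjI ballI impI mats diag) (erule conjE | assumption | rule sym mono)+
    then show ?thesis by (simp add: Graph ordered_mats_def)
  qed
qed

lemma ordered_mats_convex:
  assumes A: "A \<in> ordered_mats m n" and B: "B \<in> ordered_mats m n" and t: "0 \<le> t" "t \<le> 1"
  shows "(\<lambda>i j. (1 - t) * A i j + t * B i j) \<in> ordered_mats m n"
proof (rule ordered_matsI)
  have le: "(1 - t) * a + t * b \<le> (1 - t) * a' + t * b'" if "a \<le> a'" "b \<le> b'" for a b a' b' :: real
    using that t by (intro add_mono mult_left_mono) auto
  show "0 \<le> (1 - t) * A i j + t * B i j \<and> (1 - t) * A i j + t * B i j \<le> 1" for i j
    using le[OF ordered_mats_bounds(1)[OF A, of i j] ordered_mats_bounds(1)[OF B, of i j]]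
      le[OF ordered_mats_bounds(2)[OF A, of i j] ordered_mats_bounds(2)[OF B, of i j]] by simp
  show "(1 - t) * A i j + t * B i j = 0" if "i \<notin> {1..n} \<or> j \<notin> {1..n}" for i j
    using ordered_mats_outside[OF A that] ordered_mats_outside[OF B that] by simp
  show "(1 - t) * A i i + t * B i i = 0" for i
    by (simp add: ordered_mats_diag[OF A] ordered_mats_diag[OF B])
  show "(1 - t) * A j i + t * B j i - Jmat n j i / 2
      = reflection_sign m * ((1 - t) * A i j + t * B i j - Jmat n i j / 2)" for i j
  proof -
    have "(1 - t) * A j i + t * B j i - Jmat n j i / 2
        = (1 - t) * (A j i - Jmat n j i / 2) + t * (B j i - Jmat n j i / 2)"
      by (simp add: field_simps)
    also have "\<dots> = (1 - t) * (reflection_sign m * (A i j - Jmat n i j / 2))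
        + t * (reflection_sign m * (B i j - Jmat n i j / 2))"
      by (simp only: ordered_mats_reflect[OF A, of j i] ordered_mats_reflect[OF B, of j i])
    also have "\<dots> = reflection_sign m * ((1 - t) * A i j + t * B i j - Jmat n i j / 2)"
      by (simp add: field_simps)
    finally show ?thesis .
  qed
  show "reflection_sign m * ((1 - t) * A i j + t * B i j) \<le> reflection_sign m * ((1 - t) * A i k + t * B i k)"
    if "i \<in> {1..n}" "j \<in> {1..n}" "k \<in> {1..n}" "i \<noteq> j" "i \<noteq> k" "j < k" for i j k
    using le[OF ordered_mats_row_mono[OF A that] ordered_mats_row_mono[OF B that]]
    by (simp add: algebra_simps)
  show "(1 - t) * A i j + t * B i j \<le> (1 - t) * A j i + t * B j i"
    if "i \<in> {1..n}" "j \<in> {1..n}" "i < j" for i j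
    by (rule le[OF ordered_mats_upper_le_lower[OF A that] ordered_mats_upper_le_lower[OF B that]])
qed

lemma ordered_mats_closed:
  assumes f: "\<And>k. f k \<in> ordered_mats m n" and g: "\<And>i j. (\<lambda>k. f k i j) \<longlonglongrightarrow> g i j"
  shows "g \<in> ordered_mats m n"
proof (rule ordered_matsI)
  have le: "a \<le> b" if "u \<longlonglongrightarrow> a" "v \<longlonglongrightarrow> b" "\<And>k. u k \<le> v k" for u v :: "nat \<Rightarrow> real" and a b
    using that by (intro LIMSEQ_le) auto
  show "0 \<le> g i j \<and> g i j \<le> 1" for i j
    using ordered_mats_bounds[OF f] by (intro conjI le[OF tendsto_const g] le[OF g tendsto_const]) auto
  show "g i j = 0" if "i \<notin> {1..n} \<or> j \<notin> {1..n}" for i j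
    using LIMSEQ_unique[OF g[of i j], of 0] ordered_mats_outside[OF f that] by simp
  show "g i i = 0" for i
    using LIMSEQ_unique[OF g[of i i], of 0] ordered_mats_diag[OF f] by simp
  show "g j i - Jmat n j i / 2 = reflection_sign m * (g i j - Jmat n i j / 2)" for i j
  proof (rule LIMSEQ_unique)
    show "(\<lambda>k. f k j i - Jmat n j i / 2) \<longlonglongrightarrow> g j i - Jmat n j i / 2" by (intro tendsto_intros g)
    show "(\<lambda>k. f k j i - Jmat n j i / 2) \<longlonglongrightarrow> reflection_sign m * (g i j - Jmat n i j / 2)"
    proof -
      have eq: "f k j i - Jmat n j i / 2 = reflection_sign m * (f k i j - Jmat n i j / 2)" for k
        by (rule ordered_mats_reflect[OF f])
      show ?thesis unfolding eq by (intro tendsto_intros g)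
    qed
  qed
  show "reflection_sign m * g i j \<le> reflection_sign m * g i k"
    if "i \<in> {1..n}" "j \<in> {1..n}" "k \<in> {1..n}" "i \<noteq> j" "i \<noteq> k" "j < k" for i j k
    by (rule le[OF tendsto_mult[OF tendsto_const g] tendsto_mult[OF tendsto_const g]])
      (rule ordered_mats_row_mono[OF f that])
  show "g i j \<le> g j i" if "i \<in> {1..n}" "j \<in> {1..n}" "i < j" for i j
    by (rule le[OF g g]) (rule ordered_mats_upper_le_lower[OF f that])
qed

lemma frob_proj_ordered_mats:
  assumes C: "C \<in> ordered_mats m n"
  shows "frob_proj n (ordered_mats m n) A \<in> ordered_mats m n"
    and "(\<Sum>i\<in>{1..n}. \<Sum>j\<in>{1..n}. (A i j - frob_proj n (ordered_mats m n) A i j)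
           * (C i j - frob_proj n (ordered_mats m n) A i j)) \<le> 0"
proof -
  have *: "is_arg_min (\<lambda>B. frob_norm n (\<lambda>i j. A i j - B i j)) (\<lambda>B. B \<in> ordered_mats m n)
      (frob_proj n (ordered_mats m n) A)"
  proof (rule is_arg_min_frob_proj)
    show "ordered_mats m n \<noteq> {}" using C by blast
  qed (rule ordered_mats_outside ordered_mats_convex ordered_mats_closed; assumption)+
  then show "frob_proj n (ordered_mats m n) A \<in> ordered_mats m n" by (simp add: is_arg_min_def)
  show "(\<Sum>i\<in>{1..n}. \<Sum>j\<in>{1..n}. (A i j - frob_proj n (ordered_mats m n) A i j)
           * (C i j - frob_proj n (ordered_mats m n) A i j)) \<le> 0"
    by (rule arg_min_variational[OF * C]) (rule ordered_mats_convex)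
qed

section \<open>Sorting the row sums\<close>

text \<open>Needed for the uniform choice among sorting permutations to be a genuine distribution. A
  stable sort of the index list yields one; list positions start at 0, hence the shift by
  one.\<close>

lemma sorting_perms_nonempty: "sorting_perms n y \<noteq> {}"
proof -
  define r where "r = row_sum n y"
  define xs where "xs = sort_key r [1..<Suc n]"
  have xs: "set xs = {1..n}" "distinct xs" "length xs = n" "sorted (map r xs)"
    by (auto simp: xs_def)
  define \<sigma> where "\<sigma> i = (if i \<in> {1..n} then xs ! (i - 1) else i)" for i
  have "\<sigma> permutes {1..n}"
  proof (rule bij_imp_permutes)
    have "bij_betw (\<lambda>i. i - 1) {1..n} {..<n}"
      by (rule bij_betwI[of _ _ _ Suc]) auto
    then have "bij_betw ((!) xs \<circ> (\<lambda>i. i - 1)) {1..n} (set xs)"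
      by (rule bij_betw_trans) (rule bij_betw_nth, use xs in auto)
    then show "bij_betw \<sigma> {1..n} {1..n}"
      by (subst bij_betw_cong[of _ _ "(!) xs \<circ> (\<lambda>i. i - 1)"]) (auto simp: \<sigma>_def xs(1))
  qed (auto simp: \<sigma>_def)
  moreover have "mono_on {1..n} (\<lambda>i. r (\<sigma> i))"
  proof (rule mono_onI)
    fix i j assume ij: "i \<in> {1..n}" "j \<in> {1..n}" "i \<le> j"
    have "map r xs ! (i - 1) \<le> map r xs ! (j - 1)"
      using ij xs by (intro sorted_nth_mono) auto
    then show "r (\<sigma> i) \<le> r (\<sigma> j)" using ij xs by (simp add: \<sigma>_def)
  qed
  ultimately show ?thesis by (auto simp: sorting_perms_def r_def)
qed

lemma finite_sorting_perms: "finite (sorting_perms n y)"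
  by (rule finite_subset[OF _ finite_permutations[of "{1..n}"]]) (auto simp: sorting_perms_def)

text \<open>Pigeonhole: the two images have i and n + 1 - i elements inside a set of n.\<close>

lemma permutes_initial_final_meet:
  fixes n :: nat
  assumes "\<sigma> permutes {1..n}" "\<tau> permutes {1..n}" "i \<in> {1..n}"
  obtains k l where "k \<in> {1..i}" "l \<in> {i..n}" "\<tau> k = \<sigma> l"
proof -
  have "\<tau> ` {1..i} \<inter> \<sigma> ` {i..n} \<noteq> {}"
  proof
    assume disj: "\<tau> ` {1..i} \<inter> \<sigma> ` {i..n} = {}"
    have "card (\<tau> ` {1..i} \<union> \<sigma> ` {i..n}) = card (\<tau> ` {1..i}) + card (\<sigma> ` {i..n})"
      using disj by (intro card_Un_disjoint) auto
    also have "\<dots> = i + (Suc n - i)"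
      using permutes_inj_on[OF assms(1)] permutes_inj_on[OF assms(2)] by (simp add: card_image)
    also have "\<dots> = Suc n" using assms(3) by simp
    finally have "card (\<tau> ` {1..i} \<union> \<sigma> ` {i..n}) = Suc n" .
    moreover have "\<tau> ` {1..i} \<union> \<sigma> ` {i..n} \<subseteq> {1..n}"
      using permutes_in_image[OF assms(1)] permutes_in_image[OF assms(2)] assms(3) by fastforce
    then have "card (\<tau> ` {1..i} \<union> \<sigma> ` {i..n}) \<le> card {1..n}" by (intro card_mono) auto
    ultimately show False by simp
  qed
  then show ?thesis using that by blast
qed

text \<open>Sorting is 1-Lipschitz in the supremum norm, whichever way ties are broken.\<close>

lemma sorted_perms_close:
  fixes r R :: "nat \<Rightarrow> real"
  assumes \<sigma>: "\<sigma> permutes {1..n}" "mono_on {1..n} (\<lambda>i. r (\<sigma> i))"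
    and \<tau>: "\<tau> permutes {1..n}" "mono_on {1..n} (\<lambda>i. R (\<tau> i))"
    and close: "\<And>i. i \<in> {1..n} \<Longrightarrow> \<bar>r i - c - R i\<bar> \<le> t" and i: "i \<in> {1..n}"
  shows "\<bar>R (\<sigma> i) - R (\<tau> i)\<bar> \<le> 2 * t"
proof -
  have mem: "\<sigma> j \<in> {1..n}" "\<tau> j \<in> {1..n}" if "j \<in> {1..n}" for j
    using permutes_in_image[OF \<sigma>(1)] permutes_in_image[OF \<tau>(1)] that by blast+
  have close': "r (\<sigma> j) - c \<le> R (\<sigma> j) + t" "R (\<sigma> j) \<le> r (\<sigma> j) - c + t" if "j \<in> {1..n}" for j
    using close[OF mem(1)[OF that]] unfolding abs_le_iff by linarith+
  \<comment> \<open>The common row lies at or after position i for \<sigma> and at or before it for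
    \<tau>. Passing through it compares \<open>R (\<sigma> i)\<close> with
    \<open>R (\<tau> i)\<close> at the cost of two exchanges of \<open>r\<close> and
    \<open>R\<close>; the reverse inequality exchanges the roles of the permutations.\<close>
  obtain k l where kl: "k \<in> {1..i}" "l \<in> {i..n}" "\<tau> k = \<sigma> l"
    by (rule permutes_initial_final_meet[OF \<sigma>(1) \<tau>(1) i])
  have "r (\<sigma> i) \<le> r (\<sigma> l)" using kl i by (intro mono_onD[OF \<sigma>(2)]) auto
  moreover have "R (\<tau> k) \<le> R (\<tau> i)" using kl i by (intro mono_onD[OF \<tau>(2)]) auto
  ultimately have 1: "R (\<sigma> i) \<le> R (\<tau> i) + 2 * t"
    using close'[OF i] close'[of l] kl i by auto
  obtain k l where kl: "k \<in> {1..i}" "l \<in> {i..n}" "\<sigma> k = \<tau> l"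
    by (rule permutes_initial_final_meet[OF \<tau>(1) \<sigma>(1) i])
  have "r (\<sigma> k) \<le> r (\<sigma> i)" using kl i by (intro mono_onD[OF \<sigma>(2)]) auto
  moreover have "R (\<tau> i) \<le> R (\<tau> l)" using kl i by (intro mono_onD[OF \<tau>(2)]) auto
  ultimately have 2: "R (\<tau> i) \<le> R (\<sigma> i) + 2 * t"
    using close'[OF i] close'[of k] kl i by auto
  show ?thesis using 1 2 by (simp add: abs_le_iff)
qed

section \<open>The cost of the estimated order\<close>

context observation
begin

text \<open>The missing entries shift all row sums by the same amount, which does not affect their
  order.\<close>

lemma row_sum_data_matrix:
  assumes i: "i \<in> {1..n}"
  shows "row_sum n (data_matrix m n \<omega>) i = (1 - p) * (real n - 1) / 2 + row_sum n (\<lambda>a b. p * \<theta> a b) i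
    + (\<Sum>j\<in>{1..n}. noise \<omega> i j)"
proof -
  have J: "(\<Sum>j\<in>{1..n}. Jmat n i j) = real n - 1"
  proof -
    have "(\<Sum>j\<in>{1..n}. Jmat n i j) = (\<Sum>j\<in>{1..n} - {i}. 1)"
      using i by (intro sum.mono_neutral_cong_right) (auto simp: Jmat_def)
    then show ?thesis using i by (simp add: of_nat_diff)
  qed
  have "data_matrix m n \<omega> i j = (1 - p) / 2 * Jmat n i j + p * \<theta> i j + noise \<omega> i j" for j
    by (simp add: noise_def field_simps)
  then have "row_sum n (data_matrix m n \<omega>) i
      = (1 - p) / 2 * (\<Sum>j\<in>{1..n}. Jmat n i j) + row_sum n (\<lambda>a b. p * \<theta> a b) i + (\<Sum>j\<in>{1..n}. noise \<omega> i j)"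
    by (simp only: row_sum_def sum.distrib sum_distrib_left)
  then show ?thesis by (simp only: J)
qed

lemma row_sum_\<theta>: "row_sum n (\<lambda>a b. p * \<theta> a b) i = p * row_sum n \<theta>0 (\<pi> i)"
  using sum.permute[OF \<pi>, of "\<theta>0 (\<pi> i)"]
  by (simp add: row_sum_def \<theta>_def relabel_def o_def flip: sum_distrib_left)

definition small_rows :: "sample \<Rightarrow> bool" where
  "small_rows \<omega> \<longleftrightarrow>
    (\<forall>i\<in>{1..n}. \<bar>\<Sum>j\<in>{1..n}. noise \<omega> i j\<bar> \<le> 2 * sqrt (real n * p * ln (real n)))"

text \<open>\<open>inv \<pi>\<close> sorts the true row sums. Hence the rows
  \<open>\<sigma> i\<close> and \<open>inv \<pi> i\<close> have true sums within twice the row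
  deviation, which is exactly the radius in \<open>Q\<close>, and \<open>\<sigma> i\<close> competes
  in the maximum belonging to the row \<open>inv \<pi> i\<close>.\<close>

lemma sum_sorted_rows_le_Q:
  assumes rows: "small_rows \<omega>" and \<sigma>: "\<sigma> \<in> sorting_perms n (data_matrix m n \<omega>)"
  shows "p\<^sup>2 * (\<Sum>i\<in>{1..n}. \<Sum>k\<in>{1..n}. (\<theta> (inv \<pi> i) k - \<theta> (\<sigma> i) k)\<^sup>2) \<le> Q n p \<theta>"
proof -
  let ?R = "row_sum n (\<lambda>a b. p * \<theta> a b)" and ?\<tau> = "inv \<pi>"
  define S where "S i = (\<lambda>j. \<Sum>k\<in>{1..n}. (p * \<theta> i k - p * \<theta> j k)\<^sup>2) `
    {j \<in> {1..n}. \<bar>?R j - ?R i\<bar> \<le> 4 * sqrt (real n * p * ln (real n))}" for i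
  have \<sigma>': "\<sigma> permutes {1..n}" "mono_on {1..n} (\<lambda>i. row_sum n (data_matrix m n \<omega>) (\<sigma> i))"
    using \<sigma> by (auto simp: sorting_perms_def)
  have \<tau>: "?\<tau> permutes {1..n}" by (rule permutes_inv[OF \<pi>])
  have mono: "mono_on {1..n} (\<lambda>i. ?R (?\<tau> i))"
  proof (rule mono_onI)
    fix i j assume "i \<in> {1..n}" "j \<in> {1..n}" "i \<le> j"
    then show "?R (?\<tau> i) \<le> ?R (?\<tau> j)"
      using mono_onD[OF row_sum_ordered_mats_mono[OF \<theta>0]] p
      by (simp add: row_sum_\<theta> permutes_inverses(1)[OF \<pi>] mult_left_mono)
  qed
  have close: "\<bar>row_sum n (data_matrix m n \<omega>) i - (1 - p) * (real n - 1) / 2 - ?R i\<bar>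
      \<le> 2 * sqrt (real n * p * ln (real n))" if "i \<in> {1..n}" for i
  proof -
    have "row_sum n (data_matrix m n \<omega>) i - (1 - p) * (real n - 1) / 2 - ?R i = (\<Sum>j\<in>{1..n}. noise \<omega> i j)"
      unfolding row_sum_data_matrix[OF that] by simp
    then show ?thesis using rows that unfolding small_rows_def by (simp only:)
  qed
  have le: "(\<Sum>k\<in>{1..n}. (p * \<theta> (?\<tau> i) k - p * \<theta> (\<sigma> i) k)\<^sup>2) \<le> Max (S (?\<tau> i))" if i: "i \<in> {1..n}" for i
  proof (rule Max_ge)
    show "finite (S (?\<tau> i))" by (simp add: S_def)
    have "\<bar>?R (\<sigma> i) - ?R (?\<tau> i)\<bar> \<le> 2 * (2 * sqrt (real n * p * ln (real n)))"
      by (rule sorted_perms_close[OF \<sigma>' \<tau> mono close i])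
    moreover have "\<sigma> i \<in> {1..n}" using permutes_in_image[OF \<sigma>'(1)] i by blast
    ultimately show "(\<Sum>k\<in>{1..n}. (p * \<theta> (?\<tau> i) k - p * \<theta> (\<sigma> i) k)\<^sup>2) \<in> S (?\<tau> i)"
      unfolding S_def by (intro imageI) simp
  qed
  have "p\<^sup>2 * (\<Sum>i\<in>{1..n}. \<Sum>k\<in>{1..n}. (\<theta> (?\<tau> i) k - \<theta> (\<sigma> i) k)\<^sup>2)
      = (\<Sum>i\<in>{1..n}. \<Sum>k\<in>{1..n}. (p * \<theta> (?\<tau> i) k - p * \<theta> (\<sigma> i) k)\<^sup>2)"
    by (simp add: sum_distrib_left flip: power_mult_distrib right_diff_distrib)
  also have "\<dots> \<le> (\<Sum>i\<in>{1..n}. Max (S (?\<tau> i)))" by (rule sum_mono) (rule le)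
  also have "\<dots> = (\<Sum>i\<in>{1..n}. Max (S i))"
    using sum.permute[OF \<tau>, of "\<lambda>i. Max (S i)"] by (simp add: o_def)
  also have "\<dots> = Q n p \<theta>" by (simp add: Q_def S_def)
  finally show ?thesis .
qed

lemma \<theta>0_eq: "\<theta>0 i j = \<theta> (inv \<pi> i) (inv \<pi> j)"
  by (simp add: \<theta>_def relabel_def permutes_inverses(1)[OF \<pi>])

text \<open>Rows are exchanged first, then columns, through the intermediate matrix
  \<open>\<theta> (inv \<pi> i) (\<sigma> j)\<close>. Reflection turns the column part into a row
  part except on entries touching the diagonal; there are two of these for each column, each costing
  at most 1, which is the origin of the term of order n.\<close>

lemma sum_relabel_diff_le:
  assumes \<sigma>: "\<sigma> permutes {1..n}"
  shows "(\<Sum>i\<in>{1..n}. \<Sum>j\<in>{1..n}. (\<theta> (\<sigma> i) (\<sigma> j) - \<theta>0 i j)\<^sup>2)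
    \<le> 4 * (\<Sum>i\<in>{1..n}. \<Sum>k\<in>{1..n}. (\<theta> (inv \<pi> i) k - \<theta> (\<sigma> i) k)\<^sup>2) + 4 * real n"
proof -
  let ?\<tau> = "inv \<pi>"
  define T where "T = (\<Sum>i\<in>{1..n}. \<Sum>k\<in>{1..n}. (\<theta> (?\<tau> i) k - \<theta> (\<sigma> i) k)\<^sup>2)"
  have \<tau>: "?\<tau> permutes {1..n}" by (rule permutes_inv[OF \<pi>])
  have mem: "\<sigma> j \<in> {1..n}" "?\<tau> j \<in> {1..n}" if "j \<in> {1..n}" for j
    using permutes_in_image[OF \<sigma>] permutes_in_image[OF \<tau>] that by blast+
  have first: "(\<Sum>i\<in>{1..n}. \<Sum>j\<in>{1..n}. (\<theta> (\<sigma> i) (\<sigma> j) - \<theta> (?\<tau> i) (\<sigma> j))\<^sup>2) = T"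
    unfolding T_def
  proof (rule sum.cong[OF refl])
    fix i
    show "(\<Sum>j\<in>{1..n}. (\<theta> (\<sigma> i) (\<sigma> j) - \<theta> (?\<tau> i) (\<sigma> j))\<^sup>2) = (\<Sum>k\<in>{1..n}. (\<theta> (?\<tau> i) k - \<theta> (\<sigma> i) k)\<^sup>2)"
      using sum.permute[OF \<sigma>, of "\<lambda>k. (\<theta> (?\<tau> i) k - \<theta> (\<sigma> i) k)\<^sup>2"] by (simp add: o_def power2_commute)
  qed
  have entry: "(\<theta> a b - \<theta> a c)\<^sup>2 \<le> (\<theta> b a - \<theta> c a)\<^sup>2 + (of_bool (a = b) + of_bool (a = c))"
    if "a \<in> {1..n}" "b \<in> {1..n}" "c \<in> {1..n}" for a b c
  proof (cases "a = b \<or> a = c")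
    case True
    have "\<bar>\<theta> a b - \<theta> a c\<bar> \<le> 1"
      using \<theta>_bounds[of a b] \<theta>_bounds[of a c] by (simp add: abs_le_iff)
    then have "(\<theta> a b - \<theta> a c)\<^sup>2 \<le> 1" by (simp add: abs_square_le_1)
    also have "1 \<le> (of_bool (a = b) + of_bool (a = c) :: real)" using True by auto
    finally show ?thesis by (simp add: add_increasing)
  next
    case False
    then have "\<theta> b a - \<theta> c a = reflection_sign m * (\<theta> a b - \<theta> a c)"
      using \<theta>_reflect[of b a] \<theta>_reflect[of c a] that by (simp add: Jmat_def algebra_simps)
    then show ?thesis using False by (simp add: power_mult_distrib)
  qed
  have "(\<Sum>i\<in>{1..n}. \<Sum>j\<in>{1..n}. (\<theta> (?\<tau> i) (\<sigma> j) - \<theta> (?\<tau> i) (?\<tau> j))\<^sup>2)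
      \<le> (\<Sum>i\<in>{1..n}. \<Sum>j\<in>{1..n}. (\<theta> (\<sigma> j) (?\<tau> i) - \<theta> (?\<tau> j) (?\<tau> i))\<^sup>2
          + (of_bool (?\<tau> i = \<sigma> j) + of_bool (?\<tau> i = ?\<tau> j)))"
    by (intro sum_mono entry mem)
  also have "\<dots> = (\<Sum>i\<in>{1..n}. \<Sum>j\<in>{1..n}. (\<theta> (\<sigma> j) i - \<theta> (?\<tau> j) i)\<^sup>2
          + (of_bool (i = \<sigma> j) + of_bool (i = ?\<tau> j)))"
    using sum.permute[OF \<tau>, of "\<lambda>i. \<Sum>j\<in>{1..n}. (\<theta> (\<sigma> j) i - \<theta> (?\<tau> j) i)\<^sup>2
          + (of_bool (i = \<sigma> j) + of_bool (i = ?\<tau> j))"] by (simp add: o_def)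
  also have "\<dots> = (\<Sum>j\<in>{1..n}. \<Sum>i\<in>{1..n}. (\<theta> (\<sigma> j) i - \<theta> (?\<tau> j) i)\<^sup>2
          + (of_bool (i = \<sigma> j) + of_bool (i = ?\<tau> j)))"
    by (rule sum.swap)
  also have "\<dots> = T + (\<Sum>j\<in>{1..n}. (\<Sum>i\<in>{1..n}. of_bool (i = \<sigma> j)) + (\<Sum>i\<in>{1..n}. of_bool (i = ?\<tau> j)))"
    by (simp add: T_def sum.distrib power2_commute)
  also have "(\<Sum>j\<in>{1..n}. (\<Sum>i\<in>{1..n}. of_bool (i = \<sigma> j)) + (\<Sum>i\<in>{1..n}. of_bool (i = ?\<tau> j)) :: real)
      = (\<Sum>j\<in>{1..n}. 2)"
    using mem by (intro sum.cong) (auto simp: of_bool_def)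
  finally have second: "(\<Sum>i\<in>{1..n}. \<Sum>j\<in>{1..n}. (\<theta> (?\<tau> i) (\<sigma> j) - \<theta> (?\<tau> i) (?\<tau> j))\<^sup>2) \<le> T + 2 * real n"
    by simp
  have "(\<Sum>i\<in>{1..n}. \<Sum>j\<in>{1..n}. (\<theta> (\<sigma> i) (\<sigma> j) - \<theta>0 i j)\<^sup>2)
      \<le> (\<Sum>i\<in>{1..n}. \<Sum>j\<in>{1..n}. 2 * (\<theta> (\<sigma> i) (\<sigma> j) - \<theta> (?\<tau> i) (\<sigma> j))\<^sup>2
          + 2 * (\<theta> (?\<tau> i) (\<sigma> j) - \<theta> (?\<tau> i) (?\<tau> j))\<^sup>2)"
  proof (intro sum_mono)
    fix i j
    have "(x + y)\<^sup>2 \<le> 2 * x\<^sup>2 + 2 * y\<^sup>2" for x y :: real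
      using sum_squares_bound[of x y] by (simp add: power2_sum)
    from this[of "\<theta> (\<sigma> i) (\<sigma> j) - \<theta> (?\<tau> i) (\<sigma> j)" "\<theta> (?\<tau> i) (\<sigma> j) - \<theta> (?\<tau> i) (?\<tau> j)"]
    show "(\<theta> (\<sigma> i) (\<sigma> j) - \<theta>0 i j)\<^sup>2 \<le> 2 * (\<theta> (\<sigma> i) (\<sigma> j) - \<theta> (?\<tau> i) (\<sigma> j))\<^sup>2
        + 2 * (\<theta> (?\<tau> i) (\<sigma> j) - \<theta> (?\<tau> i) (?\<tau> j))\<^sup>2"
      by (simp add: \<theta>0_eq)
  qed
  also have "\<dots> = 2 * T + 2 * (\<Sum>i\<in>{1..n}. \<Sum>j\<in>{1..n}. (\<theta> (?\<tau> i) (\<sigma> j) - \<theta> (?\<tau> i) (?\<tau> j))\<^sup>2)"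
    using first by (simp add: sum.distrib flip: sum_distrib_left)
  also have "\<dots> \<le> 4 * T + 4 * real n" using second by simp
  finally show ?thesis by (simp add: T_def)
qed

end

section \<open>The risk bound\<close>

text \<open>Young's inequality absorbs half of the square on the right.\<close>

lemma quadratic_le:
  fixes x a b :: real
  assumes "x\<^sup>2 \<le> a * x + b"
  shows "x\<^sup>2 \<le> a\<^sup>2 + 2 * b"
  using assms sum_squares_bound[of a x] by simp

lemma square_sum3_le: "(x + y + z)\<^sup>2 \<le> 3 * (x\<^sup>2 + y\<^sup>2 + z\<^sup>2)" for x y z :: real
proof -
  have "3 * (x\<^sup>2 + y\<^sup>2 + z\<^sup>2) - (x + y + z)\<^sup>2 = (x - y)\<^sup>2 + (y - z)\<^sup>2 + (x - z)\<^sup>2"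
    by (simp add: power2_eq_square algebra_simps)
  then show ?thesis by (smt (verit) zero_le_power2)
qed

context observation
begin

text \<open>A single event serving all scales and all permutations, so that on it the permutation
  may be the one computed from the data.\<close>

definition typical :: "nat \<Rightarrow> sample \<Rightarrow> bool" where
  "typical L \<omega> \<longleftrightarrow> small_rows \<omega> \<and> \<bar>p_hat n \<omega> - p\<bar> \<le> 6 * sqrt (p * ln (real n)) / real n
    \<and> (\<forall>k\<le>L. small_submatrices \<omega> (2 ^ k))
    \<and> (\<forall>k\<le>L. \<forall>\<sigma>. \<sigma> permutes {1..n} \<longrightarrow> block_weight_prod \<omega> \<sigma> L k \<le> real n ^ (n + 3))"

lemma prob_not_typical:
  assumes n: "n \<ge> 14" and np: "2 * ln (real n) \<le> real n * p" and L: "n < 2 ^ L" "2 ^ L \<le> 2 * n"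
  shows "measure_pmf.prob (sample_pmf n p \<theta>) {\<omega>. \<not> typical L \<omega>} \<le> 50 / real n"
proof -
  let ?q = "sample_pmf n p \<theta>"
  have "0 < real n * p" using np ln_ge_2 n by linarith
  then have p0: "p > 0" using p by (simp add: zero_less_mult_iff)
  define A where "A = {\<omega>. \<exists>i\<in>{1..n}. \<bar>\<Sum>j\<in>{1..n}. noise \<omega> i j\<bar> > 2 * sqrt (real n * p * ln (real n))}"
  define B where "B = {\<omega>. \<bar>p_hat n \<omega> - p\<bar> > 6 * sqrt (p * ln (real n)) / real n}"
  define C where "C k = {\<omega>. \<not> small_submatrices \<omega> (2 ^ k)}" for k
  define D where "D k = {\<omega>. \<exists>\<sigma>. \<sigma> permutes {1..n} \<and> block_weight_prod \<omega> \<sigma> L k > real n ^ (n + 3)}" for k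
  have A: "measure_pmf.prob ?q A \<le> 2 / real n"
    unfolding A_def using n np by (intro prob_row_noise) auto
  have B: "measure_pmf.prob ?q B \<le> 2 / real n"
    unfolding B_def using n np by (intro prob_p_hat) auto
  have C: "measure_pmf.prob ?q (C k) \<le> 18 / real n ^ 3" for k
  proof -
    have "C k = {\<omega>. \<exists>R T. R \<subseteq> {1..n} \<and> card R \<le> 2 ^ k \<and> T \<subseteq> {1..n} \<and> card T \<le> 2 ^ k \<and>
        \<bar>\<Sum>i\<in>R. \<Sum>j\<in>T. noise \<omega> i j\<bar>
          > real (2 ^ k) * (12 * sqrt (max (ln (real n)) (p * real (2 ^ k)) * ln (real n)))}"
      unfolding C_def small_submatrices_def not_all not_imp not_le by blast
    then show ?thesis using prob_submatrix_noise[of "2 ^ k"] n by simp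
  qed
  have D: "measure_pmf.prob ?q (D k) \<le> 3 / real n ^ 3" if "k \<le> L" for k
    unfolding D_def by (rule prob_block_weight_prod[OF n p0 L that])
  have "{\<omega>. \<not> typical L \<omega>} \<subseteq> (A \<union> B) \<union> (\<Union>k\<in>{..L}. C k \<union> D k)"
    unfolding typical_def small_rows_def A_def B_def C_def D_def by (auto simp: not_le)
  then have "measure_pmf.prob ?q {\<omega>. \<not> typical L \<omega>} \<le> measure_pmf.prob ?q ((A \<union> B) \<union> (\<Union>k\<in>{..L}. C k \<union> D k))"
    by (intro measure_pmf.finite_measure_mono) auto
  also have "\<dots> \<le> measure_pmf.prob ?q A + measure_pmf.prob ?q B + measure_pmf.prob ?q (\<Union>k\<in>{..L}. C k \<union> D k)"
    using measure_Un_le[of "A \<union> B" ?q "\<Union>k\<in>{..L}. C k \<union> D k"] measure_Un_le[of A ?q B] by simp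
  also have "\<dots> \<le> 2 / real n + 2 / real n + (\<Sum>k\<in>{..L}. 18 / real n ^ 3 + 3 / real n ^ 3)"
  proof (intro add_mono A B prob_UN_le)
    fix k assume "k \<in> {..L}"
    then show "measure_pmf.prob ?q (C k \<union> D k) \<le> 18 / real n ^ 3 + 3 / real n ^ 3"
      using measure_Un_le[of "C k" ?q "D k"] C[of k] D[of k] by simp
  qed simp
  also have "\<dots> = 4 / real n + real (L + 1) * 21 / real n ^ 3" by (simp add: add_divide_distrib)
  also have "\<dots> \<le> 4 / real n + real (2 * n) * 21 / real n ^ 3"
  proof -
    have "L < 2 ^ L" by (rule less_exp)
    then have "real (L + 1) \<le> real (2 * n)" using L by linarith
    then show ?thesis by (intro add_left_mono divide_right_mono mult_right_mono) auto
  qed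
  also have "\<dots> = 4 / real n + 42 / (real n)\<^sup>2"
    using n by (simp add: power2_eq_square power3_eq_cube)
  also have "\<dots> \<le> 50 / real n"
    using n by (simp add: power2_eq_square field_simps)
  finally show ?thesis .
qed

text \<open>Optimality of the projection gives a quadratic inequality for its distance
  \<open>d\<close> to \<open>\<theta>0\<close>, with separate contributions from the wrong order,
  from the error of \<open>p_hat\<close> and from the noise. The noise is what produces n (log n)^2
  / p: two logarithms come from the threshold and the number of scales in \<beta>, and likewise from
  the entropy and the number of scales in the square of \<alpha>.\<close>

lemma estimate_error_le:
  assumes n: "n \<ge> 72" and np: "2 * ln (real n) \<le> real n * p" and L: "n < 2 ^ L" "2 ^ L \<le> 2 * n"
    and good: "typical L \<omega>" and \<sigma>: "\<sigma> \<in> sorting_perms n (data_matrix m n \<omega>)"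
  shows "(frob_norm n (\<lambda>i j. estimate m n \<omega> \<sigma> i j - \<theta> i j))\<^sup>2
    \<le> 80000 * (real n * (ln (real n))\<^sup>2 / p) + 32 * (Q n p \<theta> / p\<^sup>2)"
proof -
  define l where "l = ln (real n)"
  define ph where "ph = p_hat n \<omega>"
  have l: "l \<ge> 2" using ln_ge_2 n by (simp add: l_def)
  have np': "2 * l \<le> real n * p" using np by (simp add: l_def)
  then have "0 < real n * p" using l by linarith
  then have p0: "p > 0" using p by (simp add: zero_less_mult_iff)
  have perm: "\<sigma> permutes {1..n}" using \<sigma> by (simp add: sorting_perms_def)
  have ph_close: "\<bar>ph - p\<bar> \<le> 6 * sqrt (p * l) / real n"
    using good by (simp add: typical_def ph_def l_def)
  have ph_close2: "(ph - p)\<^sup>2 \<le> 36 * p * l / (real n)\<^sup>2"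
  proof -
    have "\<bar>ph - p\<bar>\<^sup>2 \<le> (6 * sqrt (p * l) / real n)\<^sup>2" using ph_close by (intro power_mono) auto
    then show ?thesis using p0 l by (simp add: power_divide power_mult_distrib mult.assoc)
  qed
  have ph_ge: "p / 2 \<le> ph"
  proof -
    have "36 * p * l / (real n)\<^sup>2 \<le> (p / 2)\<^sup>2"
    proof -
      \<comment> \<open>The requirement n >= 72 comes from here: it brings the deviation of
        \<open>p_hat\<close> below p/2.\<close>
      have "72 * (2 * l) \<le> real n * (real n * p)" using n np' l by (intro mult_mono[of 72]) auto
      then have "144 * l * p \<le> real n * (real n * p) * p" using p0 by (intro mult_right_mono) auto
      then show ?thesis using n by (simp add: power2_eq_square field_simps)
    qed
    then have "\<bar>ph - p\<bar>\<^sup>2 \<le> (p / 2)\<^sup>2" using ph_close2 by simp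
    then have "\<bar>ph - p\<bar> \<le> p / 2" using p0 by (rule power2_le_imp_le[OF _ less_imp_le[OF half_gt_zero]])
    then show ?thesis by linarith
  qed
  then have ph0: "ph > 0" using p0 by linarith
  have ph_n: "1 / real n \<le> ph"
  proof -
    \<comment> \<open>This rules out the default J/2, so the estimate is the relabelled
      projection.\<close>
    have "1 \<le> real n * (p / 2)" using np' l by simp
    then have "1 / real n \<le> p / 2" using n by (simp add: divide_le_eq mult.commute)
    then show ?thesis using ph_ge by linarith
  qed
  have inv_ph: "1 / ph \<le> 2 / p" using ph_ge p0 by (simp add: field_simps)
  define z where "z i j = (data_matrix m n \<omega> i j - Jmat n i j / 2) / ph + Jmat n i j / 2" for i j
  define B where "B = frob_proj n (ordered_mats m n) (relabel z \<sigma>)"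
  have B: "B \<in> ordered_mats m n" unfolding B_def by (rule frob_proj_ordered_mats(1)[OF \<theta>0])
  have est: "estimate m n \<omega> \<sigma> = relabel B (inv \<sigma>)"
    using ph_n by (simp add: estimate_def ph_def[symmetric] B_def z_def[abs_def])
  define D where "D i j = B i j - \<theta>0 i j" for i j
  define E where "E i j = \<theta> (\<sigma> i) (\<sigma> j) - \<theta>0 i j" for i j
  define F where "F i j = \<theta> (\<sigma> i) (\<sigma> j) - Jmat n (\<sigma> i) (\<sigma> j) / 2" for i j
  define d where "d = frob_norm n D"
  define q where "q = frob_norm n E"
  define t where "t = \<bar>p / ph - 1\<bar>"
  define \<alpha> where "\<alpha> = sqrt (384 * p * real n * l * real (L + 1))"
  define \<beta> where "\<beta> = (12 * l + 1) * 2 ^ L * (72 * real L + 1)"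
  have d0: "0 \<le> d" and q0: "0 \<le> q" by (simp_all add: d_def q_def frob_norm_nonneg)
  have L_le: "real (L + 1) \<le> 3 * l"
  proof -
    have "2 ^ L \<le> 2 * real n" using L(2) by (metis of_nat_le_iff of_nat_mult of_nat_numeral of_nat_power)
    then have "ln (2 ^ L) \<le> ln (2 * real n)" using n by (intro ln_mono) auto
    then have "real L * ln 2 \<le> ln 2 + l" using n by (simp add: ln_realpow ln_mult l_def)
    moreover have "real L - 1 \<le> 3 / 2 * ((real L - 1) * ln 2)" if "real L \<ge> 1"
    proof -
      have "3 / 2 * ((real L - 1) * (2 / 3)) \<le> 3 / 2 * ((real L - 1) * ln 2)"
        using that ln2_ge_two_thirds by (intro mult_left_mono) auto
      then show ?thesis by simp
    qed
    ultimately have "real L - 1 \<le> 3 / 2 * l"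
      using l by (cases "real L \<ge> 1") (auto simp: left_diff_distrib)
    then show ?thesis using l by simp
  qed
  have d2: "d\<^sup>2 \<le> (q + real n * t + \<alpha> / ph) * d + \<beta> / ph"
  proof -
    \<comment> \<open>Dividing by \<open>ph\<close> in place of \<open>p\<close> multiplies the
      centred signal by p / ph, which leaves the multiple p / ph - 1 of \<open>F\<close> as an extra
      error.\<close>
    have split: "relabel z \<sigma> i j - \<theta>0 i j
        = E i j + (p / ph - 1) * F i j + noise \<omega> (\<sigma> i) (\<sigma> j) / ph" for i j
      using ph0 by (simp add: relabel_def z_def E_def F_def noise_def field_simps)
    have "(\<Sum>i\<in>{1..n}. \<Sum>j\<in>{1..n}. (relabel z \<sigma> i j - B i j) * (\<theta>0 i j - B i j)) \<le> 0"
      unfolding B_def by (rule frob_proj_ordered_mats(2)[OF \<theta>0])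
    moreover have "(relabel z \<sigma> i j - B i j) * (\<theta>0 i j - B i j)
        = (D i j)\<^sup>2 - (E i j * D i j + (p / ph - 1) * (F i j * D i j) + 1 / ph * (noise \<omega> (\<sigma> i) (\<sigma> j) * D i j))" for i j
    proof -
      have "(relabel z \<sigma> i j - B i j) * (\<theta>0 i j - B i j) = (D i j)\<^sup>2 - (relabel z \<sigma> i j - \<theta>0 i j) * D i j"
        by (simp add: D_def power2_eq_square algebra_simps)
      then show ?thesis unfolding split by (simp add: algebra_simps)
    qed
    ultimately have "d\<^sup>2 \<le> (\<Sum>i\<in>{1..n}. \<Sum>j\<in>{1..n}. E i j * D i j)
        + (p / ph - 1) * (\<Sum>i\<in>{1..n}. \<Sum>j\<in>{1..n}. F i j * D i j)
        + 1 / ph * (\<Sum>i\<in>{1..n}. \<Sum>j\<in>{1..n}. noise \<omega> (\<sigma> i) (\<sigma> j) * D i j)"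
      unfolding d_def frob_norm_square
      by (simp only: sum_subtractf sum.distrib sum_distrib_left[symmetric])
    moreover have "(\<Sum>i\<in>{1..n}. \<Sum>j\<in>{1..n}. E i j * D i j) \<le> q * d"
      using abs_frob_inner_le[of E D n] by (simp add: q_def d_def)
    moreover have "(p / ph - 1) * (\<Sum>i\<in>{1..n}. \<Sum>j\<in>{1..n}. F i j * D i j) \<le> t * (real n * d)"
    proof -
      have "frob_norm n F \<le> real n"
      proof (rule power2_le_imp_le)
        have "(F i j)\<^sup>2 \<le> 1" for i j
          using \<theta>_bounds[of "\<sigma> i" "\<sigma> j"] by (auto simp: F_def Jmat_def abs_square_le_1 abs_le_iff)
        then have "(frob_norm n F)\<^sup>2 \<le> (\<Sum>i\<in>{1..n}. \<Sum>j\<in>{1..n}. 1)"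
          unfolding frob_norm_square by (intro sum_mono)
        then show "(frob_norm n F)\<^sup>2 \<le> (real n)\<^sup>2" by (simp add: power2_eq_square)
      qed simp
      then have "frob_norm n F * d \<le> real n * d" using d0 by (rule mult_right_mono)
      then have "\<bar>\<Sum>i\<in>{1..n}. \<Sum>j\<in>{1..n}. F i j * D i j\<bar> \<le> real n * d"
        using abs_frob_inner_le[of F D n] unfolding d_def by linarith
      then have "t * \<bar>\<Sum>i\<in>{1..n}. \<Sum>j\<in>{1..n}. F i j * D i j\<bar> \<le> t * (real n * d)"
        by (intro mult_left_mono) (auto simp: t_def)
      moreover have "(p / ph - 1) * (\<Sum>i\<in>{1..n}. \<Sum>j\<in>{1..n}. F i j * D i j)
          \<le> t * \<bar>\<Sum>i\<in>{1..n}. \<Sum>j\<in>{1..n}. F i j * D i j\<bar>"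
        unfolding t_def abs_mult[symmetric] by (rule abs_ge_self)
      ultimately show ?thesis by linarith
    qed
    moreover have "1 / ph * (\<Sum>i\<in>{1..n}. \<Sum>j\<in>{1..n}. noise \<omega> (\<sigma> i) (\<sigma> j) * D i j) \<le> 1 / ph * (\<beta> + \<alpha> * d)"
    proof (rule mult_left_mono)
      have "\<bar>\<Sum>i\<in>{1..n}. \<Sum>j\<in>{1..n}. noise \<omega> (\<sigma> i) (\<sigma> j) * (B i j - \<theta>0 i j)\<bar>
          \<le> \<beta> + \<alpha> * sqrt (\<Sum>i\<in>{1..n}. \<Sum>j\<in>{1..n}. (B i j - \<theta>0 i j)\<^sup>2)"
        unfolding \<alpha>_def \<beta>_def l_def
        using n good perm by (intro abs_permuted_noise_inner_le p0 L B) (auto simp: typical_def)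
      moreover have "sqrt (\<Sum>i\<in>{1..n}. \<Sum>j\<in>{1..n}. (B i j - \<theta>0 i j)\<^sup>2) = d"
        by (simp only: d_def frob_norm_def D_def)
      ultimately have "\<bar>\<Sum>i\<in>{1..n}. \<Sum>j\<in>{1..n}. noise \<omega> (\<sigma> i) (\<sigma> j) * D i j\<bar> \<le> \<beta> + \<alpha> * d"
        by (simp only: D_def)
      then show "(\<Sum>i\<in>{1..n}. \<Sum>j\<in>{1..n}. noise \<omega> (\<sigma> i) (\<sigma> j) * D i j) \<le> \<beta> + \<alpha> * d" by linarith
    qed (use ph0 in simp)
    ultimately have "d\<^sup>2 \<le> q * d + t * (real n * d) + 1 / ph * (\<beta> + \<alpha> * d)" by linarith
    also have "\<dots> = (q + real n * t + \<alpha> / ph) * d + \<beta> / ph"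
      by (simp add: algebra_simps add_divide_distrib)
    finally show ?thesis .
  qed
  define X where "X = real n * l\<^sup>2 / p"
  have nX: "real n * l \<le> real n * l\<^sup>2"
    using l by (intro mult_left_mono self_le_power) auto
  have t_bound: "(real n * t)\<^sup>2 \<le> 144 * X"
  proof -
    have "t = \<bar>ph - p\<bar> * (1 / ph)" using ph0 by (simp add: t_def field_simps abs_divide abs_minus_commute)
    also have "\<dots> \<le> \<bar>ph - p\<bar> * (2 / p)" using inv_ph by (intro mult_left_mono) auto
    finally have "t\<^sup>2 \<le> (\<bar>ph - p\<bar> * (2 / p))\<^sup>2" by (intro power_mono) (auto simp: t_def)
    also have "\<dots> = (ph - p)\<^sup>2 * (4 / p\<^sup>2)" by (simp add: power_mult_distrib power_divide)
    also have "\<dots> \<le> 36 * p * l / (real n)\<^sup>2 * (4 / p\<^sup>2)" using ph_close2 by (intro mult_right_mono) auto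
    finally have "(real n)\<^sup>2 * t\<^sup>2 \<le> (real n)\<^sup>2 * (36 * p * l / (real n)\<^sup>2 * (4 / p\<^sup>2))"
      by (intro mult_left_mono) auto
    also have "\<dots> = 144 * l / p" using n p0 by (simp add: power2_eq_square)
    also have "\<dots> \<le> 144 * (real n * l) / p" using n l p0 by (intro divide_right_mono mult_left_mono) auto
    also have "\<dots> \<le> 144 * X" using nX p0 by (simp add: X_def divide_right_mono)
    finally show ?thesis by (simp add: power_mult_distrib)
  qed
  have \<alpha>_bound: "(\<alpha> / ph)\<^sup>2 \<le> 4608 * X"
  proof -
    have "(\<alpha> / ph)\<^sup>2 = \<alpha>\<^sup>2 * (1 / ph)\<^sup>2" by (simp add: power_divide)
    also have "\<alpha>\<^sup>2 = 384 * p * real n * l * real (L + 1)" using p0 l by (simp add: \<alpha>_def)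
    also have "384 * p * real n * l * real (L + 1) * (1 / ph)\<^sup>2 \<le> 384 * p * real n * l * (3 * l) * (2 / p)\<^sup>2"
      using p0 l ph0 L_le inv_ph by (intro mult_mono power_mono) auto
    also have "\<dots> = 4608 * X" using p0 by (simp add: X_def power2_eq_square)
    finally show ?thesis .
  qed
  have \<beta>_bound: "\<beta> / ph \<le> 11232 * X"
  proof -
    have "2 ^ L \<le> 2 * real n" using L(2) by (metis of_nat_le_iff of_nat_mult of_nat_numeral of_nat_power)
    then have "\<beta> \<le> (13 * l) * (2 * real n) * (216 * l)"
      unfolding \<beta>_def using l L_le by (intro mult_mono) auto
    then have "\<beta> * (1 / ph) \<le> (13 * l) * (2 * real n) * (216 * l) * (2 / p)"
      using inv_ph l ph0 by (intro mult_mono) auto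
    then show ?thesis by (simp add: X_def power2_eq_square mult_ac)
  qed
  have q_bound: "q\<^sup>2 \<le> 4 * (Q n p \<theta> / p\<^sup>2) + 4 * X"
  proof -
    define T where "T = (\<Sum>i\<in>{1..n}. \<Sum>k\<in>{1..n}. (\<theta> (inv \<pi> i) k - \<theta> (\<sigma> i) k)\<^sup>2)"
    have "p\<^sup>2 * T \<le> Q n p \<theta>"
      unfolding T_def using good \<sigma> by (intro sum_sorted_rows_le_Q) (auto simp: typical_def)
    then have "T \<le> Q n p \<theta> / p\<^sup>2" using p0 by (simp add: le_divide_eq mult.commute)
    moreover have "q\<^sup>2 \<le> 4 * T + 4 * real n"
      unfolding q_def frob_norm_square E_def T_def by (rule sum_relabel_diff_le[OF perm])
    moreover have "real n \<le> X"
    proof -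
      have "real n * p \<le> real n * 1" using p by (intro mult_left_mono) auto
      also have "\<dots> \<le> real n * l\<^sup>2"
        using l power_mono[of 1 l 2] by (intro mult_left_mono) auto
      finally show ?thesis using p0 by (simp add: X_def le_divide_eq)
    qed
    ultimately show ?thesis by linarith
  qed
  have "d\<^sup>2 \<le> (q + real n * t + \<alpha> / ph)\<^sup>2 + 2 * (\<beta> / ph)" by (rule quadratic_le[OF d2])
  also have "\<dots> \<le> 3 * (q\<^sup>2 + (real n * t)\<^sup>2 + (\<alpha> / ph)\<^sup>2) + 2 * (\<beta> / ph)"
    using square_sum3_le by (intro add_right_mono)
  finally have d_bound: "d\<^sup>2 \<le> 3 * (q\<^sup>2 + (real n * t)\<^sup>2 + (\<alpha> / ph)\<^sup>2) + 2 * (\<beta> / ph)" .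
  have "(frob_norm n (\<lambda>i j. estimate m n \<omega> \<sigma> i j - \<theta> i j))\<^sup>2
      = (\<Sum>i\<in>{1..n}. \<Sum>j\<in>{1..n}. (B i j - \<theta> (\<sigma> i) (\<sigma> j))\<^sup>2)"
  proof -
    have "(\<Sum>i\<in>{1..n}. \<Sum>j\<in>{1..n}. g i j) = (\<Sum>i\<in>{1..n}. \<Sum>j\<in>{1..n}. g (\<sigma> i) (\<sigma> j))"
      for g :: "nat \<Rightarrow> nat \<Rightarrow> real"
      by (subst sum.permute[OF perm], subst (2) sum.permute[OF perm]) (simp add: o_def)
    from this[of "\<lambda>i j. (relabel B (inv \<sigma>) i j - \<theta> i j)\<^sup>2"]
    show ?thesis unfolding frob_norm_square est by (simp add: relabel_def permutes_inverses(2)[OF perm])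
  qed
  also have "\<dots> \<le> (\<Sum>i\<in>{1..n}. \<Sum>j\<in>{1..n}. 2 * (D i j)\<^sup>2 + 2 * (E i j)\<^sup>2)"
  proof (intro sum_mono)
    fix i j
    have "(x - y)\<^sup>2 \<le> 2 * x\<^sup>2 + 2 * y\<^sup>2" for x y :: real
      using sum_squares_bound[of x "- y"] by (simp add: power2_diff)
    from this[of "D i j" "E i j"]
    show "(B i j - \<theta> (\<sigma> i) (\<sigma> j))\<^sup>2 \<le> 2 * (D i j)\<^sup>2 + 2 * (E i j)\<^sup>2" by (simp add: D_def E_def)
  qed
  also have "\<dots> = 2 * d\<^sup>2 + 2 * q\<^sup>2"
    by (simp only: d_def q_def frob_norm_square sum.distrib sum_distrib_left)
  also have "\<dots> \<le> 80000 * X + 32 * (Q n p \<theta> / p\<^sup>2)"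
  proof -
    \<comment> \<open>Collecting terms, w has coefficient 8 * 4 = 32 and X has 6 * (144 + 4608) + 4
      * 11232 + 32 = 73472.\<close>
    have "2 * d' + 2 * q' \<le> 80000 * X + 32 * w"
      if "d' \<le> 3 * (q' + t' + a') + 2 * b'" "q' \<le> 4 * w + 4 * X" "t' \<le> 144 * X" "a' \<le> 4608 * X"
        "b' \<le> 11232 * X" "0 \<le> X" for d' q' t' a' b' w
      using that by auto
    from this[OF d_bound q_bound t_bound \<alpha>_bound \<beta>_bound] show ?thesis using p0 by (simp add: X_def)
  qed
  finally show ?thesis by (simp add: X_def l_def)
qed

lemma estimate_error_trivial:
  assumes \<sigma>: "\<sigma> permutes {1..n}"
  shows "(frob_norm n (\<lambda>i j. estimate m n \<omega> \<sigma> i j - \<theta> i j))\<^sup>2 \<le> (real n)\<^sup>2"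
proof -
  have est: "0 \<le> estimate m n \<omega> \<sigma> i j \<and> estimate m n \<omega> \<sigma> i j \<le> 1" for i j
    using ordered_mats_bounds[OF frob_proj_ordered_mats(1)[OF \<theta>0]]
    by (auto simp: estimate_def relabel_def Jmat_def)
  have "(estimate m n \<omega> \<sigma> i j - \<theta> i j)\<^sup>2 \<le> 1" for i j
  proof -
    have "\<bar>estimate m n \<omega> \<sigma> i j - \<theta> i j\<bar> \<le> 1"
      unfolding abs_le_iff using est[of i j] \<theta>_bounds[of i j] by linarith
    then show ?thesis by (simp add: abs_square_le_1)
  qed
  then have "(frob_norm n (\<lambda>i j. estimate m n \<omega> \<sigma> i j - \<theta> i j))\<^sup>2 \<le> (\<Sum>i\<in>{1..n}. \<Sum>j\<in>{1..n}. 1)"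
    unfolding frob_norm_square by (intro sum_mono)
  then show ?thesis by (simp add: power2_eq_square)
qed

text \<open>The law of the estimator no longer carries the sample, so the exceptional event cannot
  be stated on it. The proof works with the joint law \<open>q\<close> of sample and permutation,
  whose first marginal is the law of the sample.\<close>

lemma expectation_estimator_le:
  assumes trivial: "\<And>\<omega> \<sigma>. \<sigma> \<in> sorting_perms n (data_matrix m n \<omega>) \<Longrightarrow> f (estimate m n \<omega> \<sigma>) \<le> K"
    and good: "\<And>\<omega> \<sigma>. \<sigma> \<in> sorting_perms n (data_matrix m n \<omega>) \<Longrightarrow> \<omega> \<notin> bad \<Longrightarrow> f (estimate m n \<omega> \<sigma>) \<le> G"
    and "0 \<le> G" "0 \<le> K"
  shows "measure_pmf.expectation (estimator_pmf m n p \<theta>) f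
    \<le> G + K * measure_pmf.prob (sample_pmf n p \<theta>) bad"
proof -
  let ?S = "\<lambda>\<omega>. sorting_perms n (data_matrix m n \<omega>)"
  define q where "q = bind_pmf (sample_pmf n p \<theta>) (\<lambda>\<omega>. map_pmf (Pair \<omega>) (pmf_of_set (?S \<omega>)))"
  have set_q: "set_pmf q = (SIGMA \<omega>:set_pmf (sample_pmf n p \<theta>). ?S \<omega>)"
    by (auto simp: q_def set_pmf_of_set[OF sorting_perms_nonempty finite_sorting_perms])
  then have fin: "finite (set_pmf q)"
    by (simp add: finite_set_sample_pmf finite_sorting_perms)
  have est: "estimator_pmf m n p \<theta> = map_pmf (\<lambda>z. estimate m n (fst z) (snd z)) q"
    by (simp add: estimator_pmf_def q_def map_bind_pmf pmf.map_comp o_def)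
  have fst: "map_pmf fst q = sample_pmf n p \<theta>"
    by (simp add: q_def map_bind_pmf pmf.map_comp o_def map_pmf_const bind_return_pmf')
  have "measure_pmf.expectation (estimator_pmf m n p \<theta>) f
      = measure_pmf.expectation q (\<lambda>z. f (estimate m n (fst z) (snd z)))"
    by (simp add: est)
  also have "\<dots> \<le> measure_pmf.expectation q (\<lambda>z. G + K * indicator bad (fst z))"
  proof (intro integral_mono_AE integrable_measure_pmf_finite fin AE_pmfI)
    fix z assume "z \<in> set_pmf q"
    then have z: "snd z \<in> ?S (fst z)" unfolding set_q by auto
    show "f (estimate m n (fst z) (snd z)) \<le> G + K * indicator bad (fst z)"
      using trivial[OF z] good[OF z] assms(3,4) by (cases "fst z \<in> bad") auto
  qed
  also have "\<dots> = G + K * measure_pmf.expectation q (\<lambda>z. indicator bad (fst z) :: real)"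
    by (simp add: integrable_measure_pmf_finite[OF fin])
  also have "measure_pmf.expectation q (\<lambda>z. indicator bad (fst z) :: real)
      = measure_pmf.expectation (map_pmf fst q) (indicator bad)"
    by (rule integral_map_pmf[symmetric])
  also have "\<dots> = measure_pmf.prob (sample_pmf n p \<theta>) bad" by (simp add: fst)
  finally show ?thesis .
qed

lemma Q_nonneg: "0 \<le> Q n p \<theta>"
  unfolding Q_def
proof (rule sum_nonneg)
  fix i assume i: "i \<in> {1..n}"
  let ?g = "\<lambda>j. \<Sum>k\<in>{1..n}. (p * \<theta> i k - p * \<theta> j k)\<^sup>2"
  let ?A = "{j \<in> {1..n}. \<bar>row_sum n (\<lambda>a b. p * \<theta> a b) j - row_sum n (\<lambda>a b. p * \<theta> a b) i\<bar>
             \<le> 4 * sqrt (real n * p * ln (real n))}"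
  have "0 \<le> ln (real n)" using i by simp
  then have "i \<in> ?A" using i p by simp
  have "0 \<le> ?g i" by (rule sum_nonneg) simp
  also have "?g i \<le> Max (?g ` ?A)" by (intro Max_ge imageI \<open>i \<in> ?A\<close>) simp
  finally show "0 \<le> Max (?g ` ?A)" .
qed

theorem risk_bound:
  assumes n: "n \<ge> 2" and np: "2 * ln (real n) \<le> real n * p"
  shows "1 / (real n)\<^sup>2 * measure_pmf.expectation (estimator_pmf m n p \<theta>)
          (\<lambda>\<theta>'. (frob_norm n (\<lambda>i j. \<theta>' i j - \<theta> i j))\<^sup>2)
      \<le> 100000 * ((ln (real n))\<^sup>2 / (real n * p) + Q n p \<theta> / ((real n)\<^sup>2 * p\<^sup>2))"
proof -
  define l where "l = ln (real n)"
  define f where "f = (\<lambda>\<theta>'. (frob_norm n (\<lambda>i j. \<theta>' i j - \<theta> i j))\<^sup>2)"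
  have l: "l > 0" using n by (simp add: l_def)
  then have np': "0 < real n * p" using np by (simp add: l_def)
  then have p0: "p > 0" using p by (simp add: zero_less_mult_iff)
  have trivial: "f (estimate m n \<omega> \<sigma>) \<le> (real n)\<^sup>2" if "\<sigma> \<in> sorting_perms n (data_matrix m n \<omega>)" for \<omega> \<sigma>
    using estimate_error_trivial[of \<sigma> \<omega>] that by (simp add: sorting_perms_def f_def)
  have Q0: "0 \<le> Q n p \<theta> / ((real n)\<^sup>2 * p\<^sup>2)" using Q_nonneg by simp
  show ?thesis
  proof (cases "n \<ge> 72")
    \<comment> \<open>Below 72 the trivial risk bound 1 suffices: n p is at most 72, and log n is at
      least 2/3, so the constant 100000 dominates.\<close>
    case False
    have "measure_pmf.expectation (estimator_pmf m n p \<theta>) f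
        \<le> 0 + (real n)\<^sup>2 * measure_pmf.prob (sample_pmf n p \<theta>) UNIV"
      using trivial by (intro expectation_estimator_le) auto
    then have "1 / (real n)\<^sup>2 * measure_pmf.expectation (estimator_pmf m n p \<theta>) f \<le> 1"
      using n by (simp add: divide_le_eq)
    also have "1 \<le> 100000 * (l\<^sup>2 / (real n * p))"
    proof -
      have "2 / 3 \<le> ln (2 :: real)" by (rule ln2_ge_two_thirds)
      also have "\<dots> \<le> l" using n by (simp add: l_def)
      finally have "(2 / 3)\<^sup>2 \<le> l\<^sup>2" by (intro power_mono) auto
      moreover have "real n * p \<le> 72 * 1" using False p by (intro mult_mono) auto
      ultimately have "real n * p \<le> 100000 * l\<^sup>2" by (simp add: power2_eq_square)
      then show ?thesis using np' by (simp add: le_divide_eq)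
    qed
    finally show ?thesis using Q0 by (simp add: f_def l_def)
  next
    case True
    obtain j where j: "2 ^ j \<le> n" "n < 2 ^ (j + 1)" using ex_power_ivl1[of 2 n] n by auto
    define L where "L = j + 1"
    have L: "n < 2 ^ L" "2 ^ L \<le> 2 * n" using j by (auto simp: L_def)
    have l2: "l \<ge> 2" using True ln_ge_2 by (simp add: l_def)
    define G where "G = 80000 * (real n * l\<^sup>2 / p) + 32 * (Q n p \<theta> / p\<^sup>2)"
    have "measure_pmf.expectation (estimator_pmf m n p \<theta>) f
        \<le> G + (real n)\<^sup>2 * measure_pmf.prob (sample_pmf n p \<theta>) {\<omega>. \<not> typical L \<omega>}"
    proof (rule expectation_estimator_le)
      show "f (estimate m n \<omega> \<sigma>) \<le> (real n)\<^sup>2"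
        if "\<sigma> \<in> sorting_perms n (data_matrix m n \<omega>)" for \<omega> \<sigma>
        using that by (rule trivial)
      show "f (estimate m n \<omega> \<sigma>) \<le> G"
        if "\<sigma> \<in> sorting_perms n (data_matrix m n \<omega>)" "\<omega> \<notin> {\<omega>. \<not> typical L \<omega>}" for \<omega> \<sigma>
        unfolding f_def G_def l_def using that by (intro estimate_error_le[OF True np L]) auto
      show "0 \<le> G" using p0 Q_nonneg by (simp add: G_def)
    qed auto
    also have "\<dots> \<le> G + (real n)\<^sup>2 * (50 / real n)"
      using True np L by (intro add_left_mono mult_left_mono prob_not_typical) auto
    \<comment> \<open>The exceptional event contributes only order n, which the main term dominates
      because (log n)^2 / p is at least 1.\<close>
    also have "\<dots> \<le> G + 50 * (real n * l\<^sup>2 / p)"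
    proof -
      have "p * 1 \<le> 1 * l\<^sup>2" using p l2 power_mono[of 1 l 2] by (intro mult_mono) auto
      then have "1 \<le> l\<^sup>2 / p" using p0 by (simp add: le_divide_eq)
      then have "real n * 1 \<le> real n * (l\<^sup>2 / p)" by (intro mult_left_mono) auto
      then show ?thesis using n by (simp add: power2_eq_square)
    qed
    finally have "1 / (real n)\<^sup>2 * measure_pmf.expectation (estimator_pmf m n p \<theta>) f
        \<le> 1 / (real n)\<^sup>2 * (80050 * (real n * l\<^sup>2 / p) + 32 * (Q n p \<theta> / p\<^sup>2))"
      by (intro mult_left_mono) (auto simp: G_def)
    also have "\<dots> = 80050 * (l\<^sup>2 / (real n * p)) + 32 * (Q n p \<theta> / ((real n)\<^sup>2 * p\<^sup>2))"
      using n p0 by (simp add: power2_eq_square field_simps)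
    also have "\<dots> \<le> 100000 * (l\<^sup>2 / (real n * p) + Q n p \<theta> / ((real n)\<^sup>2 * p\<^sup>2))"
      unfolding distrib_left using Q0 np' by (intro add_mono mult_right_mono) auto
    finally show ?thesis by (simp add: f_def l_def)
  qed
qed

end

theorem theorem2p1:
  fixes m :: model
  shows "\<exists>C::real. \<forall>n::nat. \<forall>p::real. \<forall>\<theta>.
    2 \<le> n \<longrightarrow> 0 \<le> p \<longrightarrow> p \<le> 1 \<longrightarrow> 2 * ln (real n) / real n \<le> p \<longrightarrow> \<theta> \<in> param_space m n \<longrightarrow>
      1 / (real n)\<^sup>2 * measure_pmf.expectation (estimator_pmf m n p \<theta>)
          (\<lambda>\<theta>'. (frob_norm n (\<lambda>i j. \<theta>' i j - \<theta> i j))\<^sup>2)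
      \<le> C * ((ln (real n))\<^sup>2 / (real n * p) + Q n p \<theta> / ((real n)\<^sup>2 * p\<^sup>2))"
proof (intro exI allI impI)
  fix n :: nat and p :: real and \<theta>
  assume *: "2 \<le> n" "0 \<le> p" "p \<le> 1" "2 * ln (real n) / real n \<le> p" "\<theta> \<in> param_space m n"
  then obtain \<theta>0 \<pi> where \<theta>: "\<theta> = relabel \<theta>0 \<pi>" "\<theta>0 \<in> ordered_mats m n" "\<pi> permutes {1..n}"
    by (auto simp: param_space_def)
  interpret obs: observation m n p \<theta>0 \<pi>
    using * \<theta> by unfold_locales auto
  have "2 * ln (real n) \<le> real n * p" using *(1,4) by (simp add: divide_le_eq mult.commute)
  from obs.risk_bound[OF *(1) this]
  show "1 / (real n)\<^sup>2 * measure_pmf.expectation (estimator_pmf m n p \<theta>)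
          (\<lambda>\<theta>'. (frob_norm n (\<lambda>i j. \<theta>' i j - \<theta> i j))\<^sup>2)
      \<le> 100000 * ((ln (real n))\<^sup>2 / (real n * p) + Q n p \<theta> / ((real n)\<^sup>2 * p\<^sup>2))"
    by (simp only: obs.\<theta>_def \<theta>(1))
qed

end
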